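(* Let $T>0$ and assume $F$ satisfies (F1), (F2), (F3). (i) Let $(\Omega_t)_{t\in(0,T)}$ be a family of open subsets of $\mathbb R^n$ such that $\Omega:=\bigcup_{t\in(0,T)}\Omega_t\times\{t\}$ is open in $\mathbb R^n\times[0,T]$. Then $(\Omega_t)_{t\in(0,T)}$ is a generalised superflow with normal velocity $-F$ if and only if $\chi=\mathbf 1_{\Omega}-\mathbf 1_{\Omega^c}$ is a viscosity supersolution of $u_t+F(x,t,Xu,X^2u)=0$ in $\mathbb R^n\times(0,T)$. (ii) Let $(\mathcal F_t)_{t\in(0,T)}$ be a family of closed subsets of $\mathbb R^n$ such that $\mathcal F:=\bigcup_{t\in(0,T)}\mathcal F_t\times\{t\}$ is closed in $\mathbb R^n\times[0,T]$. Then $(\mathcal F_t)_{t\in(0,T)}$ is a generalised subflow with normal velocity $-F$ if and only if $\overline\chi=\mathbf 1_{\mathcal F}-\mathbf 1_{\mathcal F^c}$ is a viscosity subsolution of $u_t+F(x,t,Xu,X^2u)=0$ in $\mathbb R^n\times(0,T)$.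
   Context: Step two Carnot group setting. Write $\mathbb R^n=\mathbb R^m\times\mathbb R^{n-m}$ with $2\le m<n$ and points $x=(x_h,x_v)$. Fix $n-m$ linearly independent skew-symmetric $m\times m$ real matrices $B^{(1)},\dots,B^{(n-m)}$. Let $\sigma(x)$ be the $n\times m$ matrix whose first $m$ rows form $I_m$ and whose $(m+k)$-th row is ${}^t(B^{(k)}x_h)$. The vector fields are $X_j=\sum_{i}\sigma_{ij}(x)\partial_i$. For $u\in C^2$, $Xu=\nabla u\,\sigma(x)$ and $X^2u={}^t\sigma(x)D^2u\,\sigma(x)$; $|X^2u|$ denotes a matrix norm. Standing assumptions on $F$: $F:\mathbb R^n\times(0,+\infty)\times(\mathbb R^m\setminus\{0\})\times\mathcal S^m\to\mathbb R$ is continuous and locally bounded near points $(x,t,0,A)$; $F_*,F^*$ are its lower/upper semicontinuous envelopes at $q=0$. (F1) $F^*(x,t,0,\mathbb O)=F_*(x,t,0,\mathbb O)$; (F2) $F(x,t,p,A)\le F(x,t,p,B)$ if $A\ge B$; (F3) $F(x,t,\lambda p,\lambda A+\mu\,p\otimes p)=\lambda F(x,t,p,A)$ for $\lambda>0,\mu\in\mathbb R$. Set $G(x,t,p,A)=F(x,t,p\sigma(x),{}^t\sigma(x)A\sigma(x))$ for $p\sigma(x)\ne0$, with lower/upper semicontinuous envelopes $G_*,G^*$ on $\mathbb R^n\times(0,\infty)\times\mathbb R^n\times\mathcal S^n$. Viscosity subsolution (supersolution) on an open set: upper (lower) semicontinuous $u$ such that for every $\phi\in C^2$ and local maximum (minimum)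 point $(x,t)$ of $u-\phi$, $\phi_t+G_*(x,t,\nabla\phi,D^2\phi)\le0$ (resp. $\phi_t+G^*(x,t,\nabla\phi,D^2\phi)\ge0$). Definition (generalised flows). $B(x_0,r]$ denotes the closed Euclidean ball. A family $(\Omega_t)_{t\in(0,T)}$ of open sets is a generalised superflow with normal velocity $-F$ if: for every $x_0\in\mathbb R^n$, $t\in(0,T)$, $r>0$, $h>0$ with $t+h<T$ and every smooth $\phi:B(x_0,r]\times[t,t+h]\to\mathbb R$ satisfying (a) $\partial_t\phi(x,s)+G^*(x,s,\nabla\phi(x,s),D^2\phi(x,s))<0$ on $B(x_0,r]\times[t,t+h]$; (b) for every $s\in[t,t+h]$, $\{x\in B(x_0,r]:\phi(x,s)=0\}\ne\emptyset$, and $\nabla\phi\ne0$ on $\{(x,s)\in B(x_0,r]\times[t,t+h]:\phi(x,s)=0\}$; (c) at every $(x,s)\in B(x_0,r]\times[t,t+h]$ with $X\phi(x,s)=0$ also $X^2\phi(x,s)=\mathbb O$; (d) $\{x\in B(x_0,r]:\phi(x,t)\ge0\}\subset\Omega_t$; (e) for all $s\in[t,t+h]$, $\{x\in\partial B(x_0,r]:\phi(x,s)\ge0\}\subset\Omega_s$; it follows that $\{x\in B(x_0,r]:\phi(x,s)>0\}\subset\Omega_s$ for every $s\in(t,t+h)$. A family $(\mathcal F_t)_{t\in(0,T)}$ of closed sets is a generalised subflow with normal velocity $-F$ if the same holds with (a) replaced by $\partial_t\phi+G_*(x,s,\nabla\phi,D^2\phi)>0$, (d) by $\{x\in B(x_0,r]:\phi(x,t)\le0\}\subset\mathcal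 F_t^c$, (e) by $\{x\in\partial B(x_0,r]:\phi(x,s)\le0\}\subset\mathcal F_s^c$, and the conclusion by $\{x\in B(x_0,r]:\phi(x,s)<0\}\subset\mathcal F_s^c$ for every $s\in(t,t+h)$. *)

theory Defs
  imports "HOL-Analysis.Analysis"
begin

text \<open>Step two Carnot group setting.  Points of R^n are vectors indexed by
  the finite type 'm + 'k: index Inl i (i :: 'm) is a horizontal coordinate,
  index Inr k (k :: 'k) is a vertical coordinate.  So m = CARD('m),
  n - m = CARD('k) (automatically at least 1).\<close>

definition hor :: "real^('m::finite + 'k::finite) \<Rightarrow> real^'m" where
  "hor x = (\<chi> i. x $ Inl i)"

definition sigma :: "('k \<Rightarrow> real^'m^'m) \<Rightarrow> real^('m::finite + 'k::finite) \<Rightarrow> real^'m^('m + 'k)" where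
  "sigma B x = (\<chi> r. case r of Inl i \<Rightarrow> axis i 1 | Inr k \<Rightarrow> B k *v hor x)"

definition carnot_data :: "('k::finite \<Rightarrow> real^'m::finite^'m) \<Rightarrow> bool" where
  "carnot_data B \<longleftrightarrow> (\<forall>k. transpose (B k) = - B k) \<and> inj B \<and> independent (range B)"

definition symm :: "real^'a::finite^'a \<Rightarrow> bool" where
  "symm A \<longleftrightarrow> transpose A = A"

definition psd :: "real^'a::finite^'a \<Rightarrow> bool" where
  "psd A \<longleftrightarrow> (\<forall>v. 0 \<le> v \<bullet> (A *v v))"

definition outer :: "real^'a::finite \<Rightarrow> real^'a \<Rightarrow> real^'a^'a" where
  "outer p q = (\<chi> i j. p $ i * q $ j)"

definition lsc_env :: "('a::metric_space \<Rightarrow> real) \<Rightarrow> 'a set \<Rightarrow> 'a \<Rightarrow> ereal" where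
  "lsc_env f D z = (SUP r\<in>{0<..}. INF w\<in>D \<inter> ball z r. ereal (f w))"

definition usc_env :: "('a::metric_space \<Rightarrow> real) \<Rightarrow> 'a set \<Rightarrow> 'a \<Rightarrow> ereal" where
  "usc_env f D z = (INF r\<in>{0<..}. SUP w\<in>D \<inter> ball z r. ereal (f w))"

definition Fu :: "(real^'n \<Rightarrow> real \<Rightarrow> real^'m \<Rightarrow> real^'m^'m \<Rightarrow> real)
   \<Rightarrow> (real^'n::finite) \<times> real \<times> (real^'m::finite) \<times> (real^'m^'m) \<Rightarrow> real" where
  "Fu F = (\<lambda>(x,t,q,A). F x t q A)"

definition FDom :: "((real^'n::finite) \<times> real \<times> (real^'m::finite) \<times> (real^'m^'m)) set" where
  "FDom = {(x,t,q,A). 0 < t \<and> q \<noteq> 0 \<and> symm A}"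

definition standing_F ::
  "(real^'n::finite \<Rightarrow> real \<Rightarrow> real^'m::finite \<Rightarrow> real^'m^'m \<Rightarrow> real) \<Rightarrow> bool" where
  "standing_F F \<longleftrightarrow>
     continuous_on FDom (Fu F) \<and>
     (\<forall>x t A. 0 < t \<longrightarrow> symm A \<longrightarrow>
        (\<exists>r>0. \<exists>M. \<forall>w\<in>FDom \<inter> ball (x,t,0,A) r. \<bar>Fu F w\<bar> \<le> M))"

definition F1 :: "(real^'n::finite \<Rightarrow> real \<Rightarrow> real^'m::finite \<Rightarrow> real^'m^'m \<Rightarrow> real) \<Rightarrow> bool" where
  "F1 F \<longleftrightarrow> (\<forall>x t. 0 < t \<longrightarrow> usc_env (Fu F) FDom (x,t,0,0) = lsc_env (Fu F) FDom (x,t,0,0))"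

definition F2 :: "(real^'n::finite \<Rightarrow> real \<Rightarrow> real^'m::finite \<Rightarrow> real^'m^'m \<Rightarrow> real) \<Rightarrow> bool" where
  "F2 F \<longleftrightarrow> (\<forall>x t p A B. 0 < t \<longrightarrow> p \<noteq> 0 \<longrightarrow> symm A \<longrightarrow> symm B \<longrightarrow> psd (A - B)
      \<longrightarrow> F x t p A \<le> F x t p B)"

definition F3 :: "(real^'n::finite \<Rightarrow> real \<Rightarrow> real^'m::finite \<Rightarrow> real^'m^'m \<Rightarrow> real) \<Rightarrow> bool" where
  "F3 F \<longleftrightarrow> (\<forall>x t p A (l::real) (\<mu>::real). 0 < t \<longrightarrow> p \<noteq> 0 \<longrightarrow> symm A \<longrightarrow> 0 < l
      \<longrightarrow> F x t (l *\<^sub>R p) (l *\<^sub>R A + \<mu> *\<^sub>R outer p p) = l * F x t p A)"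

definition Gu :: "('k \<Rightarrow> real^'m^'m) \<Rightarrow> (real^('m+'k) \<Rightarrow> real \<Rightarrow> real^'m \<Rightarrow> real^'m^'m \<Rightarrow> real)
   \<Rightarrow> (real^('m::finite+'k::finite)) \<times> real \<times> (real^('m+'k)) \<times> (real^('m+'k)^('m+'k)) \<Rightarrow> real" where
  "Gu B F = (\<lambda>(x,t,p,A). F x t (p v* sigma B x) (transpose (sigma B x) ** A ** sigma B x))"

definition GDom :: "('k \<Rightarrow> real^'m^'m)
   \<Rightarrow> ((real^('m::finite+'k::finite)) \<times> real \<times> (real^('m+'k)) \<times> (real^('m+'k)^('m+'k))) set" where
  "GDom B = {(x,t,p,A). 0 < t \<and> p v* sigma B x \<noteq> 0 \<and> symm A}"

fun Ck :: "nat \<Rightarrow> ('a::euclidean_space \<Rightarrow> real) \<Rightarrow> bool" where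
  "Ck 0 f = continuous_on UNIV f"
| "Ck (Suc k) f = ((\<forall>z. f differentiable (at z)) \<and>
      (\<forall>v. Ck k (\<lambda>z. frechet_derivative f (at z) v)))"

definition smooth_fun :: "('a::euclidean_space \<Rightarrow> real) \<Rightarrow> bool" where
  "smooth_fun f \<longleftrightarrow> (\<forall>k. Ck k f)"

definition dtime :: "((real^'n::finite) \<times> real \<Rightarrow> real) \<Rightarrow> (real^'n) \<times> real \<Rightarrow> real" where
  "dtime \<phi> z = frechet_derivative \<phi> (at z) (0, 1)"

definition grad :: "((real^'n::finite) \<times> real \<Rightarrow> real) \<Rightarrow> (real^'n) \<times> real \<Rightarrow> real^'n" where
  "grad \<phi> z = (\<chi> i. frechet_derivative \<phi> (at z) (axis i 1, 0))"

definition hess :: "((real^'n::finite) \<times> real \<Rightarrow> real) \<Rightarrow> (real^'n) \<times> real \<Rightarrow> real^'n^'n" where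
  "hess \<phi> z = (\<chi> i j. frechet_derivative (\<lambda>w. frechet_derivative \<phi> (at w) (axis j 1, 0))
                        (at z) (axis i 1, 0))"

definition lsc_on :: "('a::metric_space \<Rightarrow> real) \<Rightarrow> 'a set \<Rightarrow> bool" where
  "lsc_on u S \<longleftrightarrow> (\<forall>z\<in>S. \<forall>e>0. \<exists>d>0. \<forall>w\<in>S \<inter> ball z d. u z - e < u w)"

definition usc_on :: "('a::metric_space \<Rightarrow> real) \<Rightarrow> 'a set \<Rightarrow> bool" where
  "usc_on u S \<longleftrightarrow> (\<forall>z\<in>S. \<forall>e>0. \<exists>d>0. \<forall>w\<in>S \<inter> ball z d. u w < u z + e)"

definition visc_super where
  "visc_super B F S u \<longleftrightarrow> lsc_on u S \<and>
     (\<forall>\<phi> z. Ck 2 \<phi> \<longrightarrow> z \<in> S \<longrightarrow>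
        (\<exists>d>0. \<forall>w\<in>S \<inter> ball z d. u z - \<phi> z \<le> u w - \<phi> w) \<longrightarrow>
        0 \<le> ereal (dtime \<phi> z) + usc_env (Gu B F) (GDom B) (fst z, snd z, grad \<phi> z, hess \<phi> z))"

definition visc_sub where
  "visc_sub B F S u \<longleftrightarrow> usc_on u S \<and>
     (\<forall>\<phi> z. Ck 2 \<phi> \<longrightarrow> z \<in> S \<longrightarrow>
        (\<exists>d>0. \<forall>w\<in>S \<inter> ball z d. u w - \<phi> w \<le> u z - \<phi> z) \<longrightarrow>
        ereal (dtime \<phi> z) + lsc_env (Gu B F) (GDom B) (fst z, snd z, grad \<phi> z, hess \<phi> z) \<le> 0)"

definition admissible_test where
  "admissible_test B \<phi> x0 r t h \<longleftrightarrow>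
     (\<forall>s\<in>{t..t+h}. {x\<in>cball x0 r. \<phi> (x,s) = 0} \<noteq> {}) \<and>
     (\<forall>x\<in>cball x0 r. \<forall>s\<in>{t..t+h}. \<phi> (x,s) = 0 \<longrightarrow> grad \<phi> (x,s) \<noteq> 0) \<and>
     (\<forall>x\<in>cball x0 r. \<forall>s\<in>{t..t+h}. grad \<phi> (x,s) v* sigma B x = 0 \<longrightarrow>
        transpose (sigma B x) ** hess \<phi> (x,s) ** sigma B x = 0)"

definition gen_superflow where
  "gen_superflow B F T Om \<longleftrightarrow>
     (\<forall>x0 t r h \<phi>. 0 < t \<longrightarrow> 0 < r \<longrightarrow> 0 < h \<longrightarrow> t + h < T \<longrightarrow> smooth_fun \<phi> \<longrightarrow>
        (\<forall>x\<in>cball x0 r. \<forall>s\<in>{t..t+h}.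
           ereal (dtime \<phi> (x,s)) + usc_env (Gu B F) (GDom B) (x, s, grad \<phi> (x,s), hess \<phi> (x,s)) < 0) \<longrightarrow>
        admissible_test B \<phi> x0 r t h \<longrightarrow>
        {x\<in>cball x0 r. 0 \<le> \<phi> (x,t)} \<subseteq> Om t \<longrightarrow>
        (\<forall>s\<in>{t..t+h}. {x\<in>sphere x0 r. 0 \<le> \<phi> (x,s)} \<subseteq> Om s) \<longrightarrow>
        (\<forall>s\<in>{t<..<t+h}. {x\<in>cball x0 r. 0 < \<phi> (x,s)} \<subseteq> Om s))"

definition gen_subflow where
  "gen_subflow B F T Fm \<longleftrightarrow>
     (\<forall>x0 t r h \<phi>. 0 < t \<longrightarrow> 0 < r \<longrightarrow> 0 < h \<longrightarrow> t + h < T \<longrightarrow> smooth_fun \<phi> \<longrightarrow>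
        (\<forall>x\<in>cball x0 r. \<forall>s\<in>{t..t+h}.
           0 < ereal (dtime \<phi> (x,s)) + lsc_env (Gu B F) (GDom B) (x, s, grad \<phi> (x,s), hess \<phi> (x,s))) \<longrightarrow>
        admissible_test B \<phi> x0 r t h \<longrightarrow>
        {x\<in>cball x0 r. \<phi> (x,t) \<le> 0} \<subseteq> - Fm t \<longrightarrow>
        (\<forall>s\<in>{t..t+h}. {x\<in>sphere x0 r. \<phi> (x,s) \<le> 0} \<subseteq> - Fm s) \<longrightarrow>
        (\<forall>s\<in>{t<..<t+h}. {x\<in>cball x0 r. \<phi> (x,s) < 0} \<subseteq> - Fm s))"

end

theory Submission
  imports Defs
begin

text \<open>
  If the characteristic function is a supersolution and \<open>\<phi>\<close> is a flow test function whose positive set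
  leaves \<open>\<Omega>\<close>, then \<open>\<phi> - \<eta> exp (K (s - s\<^sub>1))\<close> attains its maximum over the complement of \<open>\<Omega>\<close> at
  an interior point, where it contradicts the supersolution inequality.

  Conversely, let \<open>P\<close> have a strict local maximum over the complement of \<open>\<Omega>\<close> at \<open>(x\<^sub>0, t\<^sub>0)\<close> and violate
  the inequality there; by Taylor's formula \<open>P\<close> may be taken quadratic. A flow test function must satisfy
  \<open>X\<^sup>2\<psi> = 0\<close> wherever \<open>X\<psi> = 0\<close>, so variables are doubled: maximise \<open>P(y, t) - C N(y\<inverse> \<circ> x)\<close> over
  \<open>x \<notin> \<Omega>\<^sub>t\<close> and \<open>y\<close>, where \<open>N(a) = |a\<^sub>h|\<^sup>4 + |a\<^sub>v|\<^sup>2\<close>. Let \<open>a = y\<inverse> \<circ> x\<close> at a maximum point. If \<open>a\<^sub>h \<noteq> 0\<close>, then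
  \<open>x \<mapsto> P(x \<circ> a\<inverse>, t)\<close> is a test function with nonzero horizontal gradient, and its jet is close to that
  of \<open>P\<close>. If \<open>a\<^sub>h = 0\<close>, then \<open>XP = 0\<close> and \<open>X\<^sup>2P \<le> 0\<close> at \<open>y\<close>, which forces \<open>P\<^sub>t < 0\<close> there; the function
  \<open>x \<mapsto> P(y, t) - C N(y\<inverse> \<circ> x)\<close>, made strict, is then a test function, because \<open>N(y\<inverse> \<circ> _)\<close> has vanishing
  horizontal gradient only where its horizontal Hessian vanishes too.

  The statement on subflows follows by applying the one on superflows to \<open>- F(x, t, - p, - A)\<close>.
\<close>

section \<open>Functions of class C^k and second-order jets\<close>

text \<open>Uniqueness of the Frechet derivative lets C^k regularity be checked on any explicit
  formula for the derivative.\<close>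

lemma Ck_SucI:
  assumes "\<And>z. (f has_derivative f' z) (at z)" and "\<And>v. Ck k (\<lambda>z. f' z v)"
  shows "Ck (Suc k) f"
proof -
  have "frechet_derivative f (at z) = f' z" for z
    using frechet_derivative_at[OF assms(1)[of z]] by simp
  then show ?thesis using assms by (auto simp: differentiable_def)
qed

lemma Ck_Suc_has_derivative:
  "Ck (Suc k) f \<Longrightarrow> (f has_derivative frechet_derivative f (at z)) (at z)"
  by (simp add: frechet_derivative_works)

lemma Ck_SucD: "Ck (Suc k) f \<Longrightarrow> Ck k f"
proof (induction k arbitrary: f)
  case 0
  then show ?case
    by (auto intro!: continuous_at_imp_continuous_on differentiable_imp_continuous_within)
qed auto

lemma Ck_const: "Ck k (\<lambda>z. c)"
proof (induction k arbitrary: c)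
  case (Suc k)
  show ?case by (rule Ck_SucI[where f' = "\<lambda>_ _. 0"]) (auto intro!: derivative_eq_intros Suc)
qed simp

lemma Ck_linear:
  assumes "bounded_linear f" shows "Ck k f"
proof (cases k)
  case 0
  then show ?thesis using assms by (simp add: linear_continuous_on)
next
  case (Suc j)
  show ?thesis unfolding Suc
    by (rule Ck_SucI[where f' = "\<lambda>_. f"]) (auto intro: bounded_linear_imp_has_derivative assms Ck_const)
qed

lemma Ck_add: "Ck k f \<Longrightarrow> Ck k g \<Longrightarrow> Ck k (\<lambda>z. f z + g z)"
proof (induction k arbitrary: f g)
  case 0
  then show ?case by (auto intro: continuous_intros)
next
  case (Suc k)
  show ?case
    by (rule Ck_SucI[where f' = "\<lambda>z v. frechet_derivative f (at z) v + frechet_derivative g (at z) v"])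
      (use Suc in \<open>auto intro!: has_derivative_add Ck_Suc_has_derivative\<close>)
qed

lemma Ck_mult: "Ck k f \<Longrightarrow> Ck k g \<Longrightarrow> Ck k (\<lambda>z. f z * g z)"
proof (induction k arbitrary: f g)
  case 0
  then show ?case by (auto intro: continuous_intros)
next
  case (Suc k)
  \<comment> \<open>The product rule leaves undifferentiated factors, so \<open>f\<close> and
    \<open>g\<close> themselves are needed at the lower order.\<close>
  have "Ck k f" "Ck k g" using Suc.prems Ck_SucD by blast+
  with Suc show ?case
    by (intro Ck_SucI[where f' = "\<lambda>z v. f z * frechet_derivative g (at z) v + frechet_derivative f (at z) v * g z"])
      (auto intro!: has_derivative_mult Ck_Suc_has_derivative Ck_add)
qed

lemma Ck_minus: "Ck k f \<Longrightarrow> Ck k (\<lambda>z. - f z)"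
  using Ck_mult[OF Ck_const[of k "-1"], of f] by simp

lemma Ck_diff: "Ck k f \<Longrightarrow> Ck k g \<Longrightarrow> Ck k (\<lambda>z. f z - g z)"
  using Ck_add[OF _ Ck_minus] by fastforce

lemma Ck_power: "Ck k f \<Longrightarrow> Ck k (\<lambda>z. f z ^ n)"
  by (induction n) (auto intro: Ck_const Ck_mult)

lemma Ck_affine_comp:
  assumes M: "bounded_linear M"
  shows "Ck k f \<Longrightarrow> Ck k (\<lambda>z. f (M z + c))"
proof (induction k arbitrary: f)
  case 0
  have "continuous_on UNIV (\<lambda>z. M z + c)"
    by (intro continuous_on_add continuous_on_const linear_continuous_on M)
  with 0 show ?case by (auto intro: continuous_on_compose2[of UNIV f])
next
  case (Suc k)
  have "((\<lambda>z. f (M z + c)) has_derivative (\<lambda>v. frechet_derivative f (at (M z + c)) (M v))) (at z)" for z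
    using has_derivative_compose[OF has_derivative_add[OF bounded_linear_imp_has_derivative[OF M] has_derivative_const]
        Ck_Suc_has_derivative[OF Suc.prems]] by simp
  then show ?case
    by (rule Ck_SucI) (use Suc.prems Suc.IH[of "\<lambda>z. frechet_derivative f (at z) (M _)"] in simp)
qed

lemma Ck_exp_affine:
  assumes M: "bounded_linear M"
  shows "Ck k (\<lambda>z. exp (M z + c))"
proof (induction k)
  case 0
  show ?case unfolding Ck.simps
    by (intro continuous_on_exp continuous_on_add continuous_on_const linear_continuous_on M)
next
  case (Suc k)
  have "((\<lambda>z. exp (M z + c)) has_derivative (\<lambda>v. exp (M z + c) * M v)) (at z)" for z
    by (auto intro!: derivative_eq_intros bounded_linear_imp_has_derivative[OF M])
  then show ?case
    by (rule Ck_SucI) (intro Ck_mult Suc Ck_const)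
qed

text \<open>The derivative is an affine function of \<open>z\<close>, hence of class C^k for every
  \<open>k\<close>.\<close>

lemma Ck_bilinear:
  assumes b: "bounded_bilinear b"
  shows "Ck k (\<lambda>z. b (z - z0) (z - z0) :: real)"
proof -
  interpret bounded_bilinear b by fact
  have d: "((\<lambda>z. b (z - z0) (z - z0)) has_derivative (\<lambda>v. b (z - z0) v + b v (z - z0))) (at z)" for z
    by (rule FDERIV) (auto intro!: derivative_eq_intros)
  have "Ck j (\<lambda>z. b (z - z0) v + b v (z - z0))" for j v
    unfolding diff_left diff_right
    by (intro Ck_add Ck_diff Ck_const Ck_linear bounded_linear_left bounded_linear_right)
  then have "Ck (Suc k) (\<lambda>z. b (z - z0) (z - z0))"
    using d by (rule Ck_SucI[rotated])
  then show ?thesis by (rule Ck_SucD)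
qed

lemma smooth_fun_imp_Ck: "smooth_fun f \<Longrightarrow> Ck k f"
  by (simp add: smooth_fun_def)

section \<open>Second derivatives in arbitrary directions and their symmetry\<close>

definition D2 :: "('a::euclidean_space \<Rightarrow> real) \<Rightarrow> 'a \<Rightarrow> 'a \<Rightarrow> 'a \<Rightarrow> real" where
  "D2 f z u v = frechet_derivative (\<lambda>w. frechet_derivative f (at w) v) (at z) u"

lemma Ck2_D1: "Ck 2 f \<Longrightarrow> (f has_derivative frechet_derivative f (at z)) (at z)"
  by (rule Ck_Suc_has_derivative[of 1]) (simp add: numeral_2_eq_2)

lemma Ck2_D2: "Ck 2 f \<Longrightarrow> ((\<lambda>w. frechet_derivative f (at w) v) has_derivative (\<lambda>u. D2 f z u v)) (at z)"
  unfolding D2_def numeral_2_eq_2 Ck.simps by (metis frechet_derivative_works)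

lemma D2_linear_left: "Ck 2 f \<Longrightarrow> linear (\<lambda>u. D2 f z u v)"
  using Ck2_D2 has_derivative_linear by blast

lemma D1_linear: "Ck 2 f \<Longrightarrow> linear (frechet_derivative f (at z))"
  using Ck2_D1 has_derivative_linear by blast

text \<open>Linearity of the first derivative in its direction passes to its derivative in
  \<open>z\<close>, because derivatives are unique.\<close>

lemma D2_linear_right: 
  assumes f: "Ck 2 f" shows "linear (D2 f z u)"
proof (rule linearI)
  fix v w and c :: real
  have "((\<lambda>y. frechet_derivative f (at y) (v + w)) has_derivative (\<lambda>u. D2 f z u v + D2 f z u w)) (at z)"
    unfolding linear_add[OF D1_linear[OF f]] by (intro has_derivative_add Ck2_D2 f)
  then show "D2 f z u (v + w) = D2 f z u v + D2 f z u w"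
    using has_derivative_unique[OF Ck2_D2[OF f, of "v+w"]] by metis
  have "((\<lambda>y. frechet_derivative f (at y) (c *\<^sub>R v)) has_derivative (\<lambda>u. c *\<^sub>R D2 f z u v)) (at z)"
    unfolding linear_scale[OF D1_linear[OF f]] by (intro has_derivative_scaleR_right Ck2_D2 f)
  then show "D2 f z u (c *\<^sub>R v) = c *\<^sub>R D2 f z u v"
    using has_derivative_unique[OF Ck2_D2[OF f, of "c *\<^sub>R v"]] by metis
qed

lemma D2_bilinear: "Ck 2 f \<Longrightarrow> bounded_bilinear (D2 f z)"
  by (simp add: bilinear_conv_bounded_bilinear[symmetric] bilinear_def D2_linear_left D2_linear_right)

lemma continuous_D1: "Ck 2 f \<Longrightarrow> continuous_on UNIV (\<lambda>z. frechet_derivative f (at z) v)"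
  unfolding numeral_2_eq_2 using Ck_SucD[of 0] by (metis Ck.simps(1) Ck.simps(2))

lemma continuous_D2: "Ck 2 f \<Longrightarrow> continuous_on UNIV (\<lambda>z. D2 f z u v)"
  unfolding numeral_2_eq_2 D2_def by simp

lemma Ck2_line:
  assumes "Ck 2 f"
  shows "((\<lambda>s. f (z + s *\<^sub>R v)) has_real_derivative frechet_derivative f (at (z + s *\<^sub>R v)) v) (at s)"
    and "((\<lambda>s. frechet_derivative f (at (z + s *\<^sub>R v)) w) has_real_derivative D2 f (z + s *\<^sub>R v) v w) (at s)"
proof -
  have l: "((\<lambda>s. z + s *\<^sub>R v) has_derivative (\<lambda>h. h *\<^sub>R v)) (at s)"
    by (auto intro!: derivative_eq_intros)
  show "((\<lambda>s. f (z + s *\<^sub>R v)) has_real_derivative frechet_derivative f (at (z + s *\<^sub>R v)) v) (at s)"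
    unfolding has_field_derivative_def
    by (rule has_derivative_eq_rhs[OF has_derivative_compose[OF l Ck2_D1[OF assms]]])
      (simp add: linear_scale[OF D1_linear[OF assms]] fun_eq_iff mult.commute)
  show "((\<lambda>s. frechet_derivative f (at (z + s *\<^sub>R v)) w) has_real_derivative D2 f (z + s *\<^sub>R v) v w) (at s)"
    unfolding has_field_derivative_def
    by (rule has_derivative_eq_rhs[OF has_derivative_compose[OF l Ck2_D2[OF assms]]])
      (simp add: linear_scale[OF D2_linear_left[OF assms]] fun_eq_iff mult.commute)
qed

text \<open>Two applications of the mean value theorem, first along \<open>u\<close> to the
  difference in direction \<open>v\<close>, then along \<open>v\<close>.\<close>

lemma second_difference:
  assumes f: "Ck 2 f" and h: "0 < h"
  shows "\<exists>s t. 0 < s \<and> s < h \<and> 0 < t \<and> t < h \<and>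
     f (z + h *\<^sub>R u + h *\<^sub>R v) - f (z + h *\<^sub>R u) - f (z + h *\<^sub>R v) + f z = h * (h * D2 f (z + s *\<^sub>R u + t *\<^sub>R v) v u)"
proof -
  let ?D = "\<lambda>z. frechet_derivative f (at z)"
  define g where "g s = f ((z + h *\<^sub>R v) + s *\<^sub>R u) - f (z + s *\<^sub>R u)" for s
  have "DERIV g s :> ?D ((z + h *\<^sub>R v) + s *\<^sub>R u) u - ?D (z + s *\<^sub>R u) u" for s
    unfolding g_def by (intro DERIV_diff Ck2_line f)
  from MVT2[OF h this] obtain s where s: "0 < s" "s < h"
    and gs: "g h - g 0 = h * (?D ((z + h *\<^sub>R v) + s *\<^sub>R u) u - ?D (z + s *\<^sub>R u) u)" by auto
  have "DERIV (\<lambda>t. ?D ((z + s *\<^sub>R u) + t *\<^sub>R v) u) t :> D2 f ((z + s *\<^sub>R u) + t *\<^sub>R v) v u" for t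
    by (intro Ck2_line f)
  from MVT2[OF h this] obtain t where t: "0 < t" "t < h"
    and "?D ((z + s *\<^sub>R u) + h *\<^sub>R v) u - ?D (z + s *\<^sub>R u) u = h * D2 f ((z + s *\<^sub>R u) + t *\<^sub>R v) v u" by auto
  with gs s show ?thesis
    by (intro exI[of _ s] exI[of _ t]) (simp add: g_def algebra_simps)
qed

text \<open>The second difference is symmetric in \<open>u\<close> and \<open>v\<close>, so mixed
  derivatives taken in the two orders agree at two points arbitrarily close to \<open>z\<close>;
  continuity does the rest.\<close>

lemma D2_symmetric:
  assumes f: "Ck 2 f"
  shows "D2 f z u v = D2 f z v u"
proof (rule ccontr)
  assume ne: "D2 f z u v \<noteq> D2 f z v u"
  define e where "e = \<bar>D2 f z u v - D2 f z v u\<bar> / 2"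
  have e: "0 < e" using ne by (simp add: e_def)
  obtain d1 where d1: "0 < d1" "\<And>w. dist w z < d1 \<Longrightarrow> \<bar>D2 f w u v - D2 f z u v\<bar> < e"
    using continuous_D2[OF f, of u v] e unfolding continuous_on_iff by (metis UNIV_I dist_real_def)
  obtain d2 where d2: "0 < d2" "\<And>w. dist w z < d2 \<Longrightarrow> \<bar>D2 f w v u - D2 f z v u\<bar> < e"
    using continuous_D2[OF f, of v u] e unfolding continuous_on_iff by (metis UNIV_I dist_real_def)
  \<comment> \<open>With this size the parallelogram spanned by \<open>h u\<close> and
    \<open>h v\<close> lies in both neighbourhoods; the \<open>+ 1\<close> guards against
    \<open>u = v = 0\<close>.\<close>
  define h where "h = min d1 d2 / (norm u + norm v + 1)"
  have h: "0 < h" using d1(1) d2(1) by (simp add: h_def add_nonneg_pos)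
  have "h * (norm u + norm v) < h * (norm u + norm v + 1)" using h by simp
  also have "\<dots> = min d1 d2"
    using add_nonneg_pos[of "norm u + norm v" 1] by (simp add: h_def)
  finally have hb: "h * (norm u + norm v) < min d1 d2" .
  have cl: "dist (z + s *\<^sub>R u + t *\<^sub>R v) z < min d1 d2" if "0 < s" "s < h" "0 < t" "t < h" for s t
  proof -
    have "norm (s *\<^sub>R u + t *\<^sub>R v) \<le> s * norm u + t * norm v"
      using norm_triangle_ineq[of "s *\<^sub>R u" "t *\<^sub>R v"] that by simp
    also have "\<dots> \<le> h * norm u + h * norm v"
      using that by (intro add_mono mult_right_mono) auto
    finally show ?thesis using hb by (simp add: dist_norm algebra_simps)
  qed
  obtain s t where 1: "0 < s" "s < h" "0 < t" "t < h"
    and A: "f (z + h *\<^sub>R u + h *\<^sub>R v) - f (z + h *\<^sub>R u) - f (z + h *\<^sub>R v) + f z = h * (h * D2 f (z + s *\<^sub>R u + t *\<^sub>R v) v u)"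
    using second_difference[OF f h, of z u v] by blast
  obtain s' t' where 2: "0 < s'" "s' < h" "0 < t'" "t' < h"
    and B: "f (z + h *\<^sub>R v + h *\<^sub>R u) - f (z + h *\<^sub>R v) - f (z + h *\<^sub>R u) + f z = h * (h * D2 f (z + s' *\<^sub>R v + t' *\<^sub>R u) u v)"
    using second_difference[OF f h, of z v u] by blast
  have "h * (h * D2 f (z + s *\<^sub>R u + t *\<^sub>R v) v u) = h * (h * D2 f (z + s' *\<^sub>R v + t' *\<^sub>R u) u v)"
    using A B by (simp add: algebra_simps)
  then have eq: "D2 f (z + s *\<^sub>R u + t *\<^sub>R v) v u = D2 f (z + s' *\<^sub>R v + t' *\<^sub>R u) u v"
    using h by simp
  have "\<bar>D2 f (z + s *\<^sub>R u + t *\<^sub>R v) v u - D2 f z v u\<bar> < e"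
    using d2(2) cl[OF 1] by simp
  moreover have "\<bar>D2 f (z + s' *\<^sub>R v + t' *\<^sub>R u) u v - D2 f z u v\<bar> < e"
    using d1(2) cl[OF 2(3,4,1,2)] by (simp add: add.commute add.left_commute)
  ultimately show False using eq unfolding e_def by argo
qed

section \<open>Derivatives of sums, negatives and affine compositions\<close>

lemma D1_eq: "(f has_derivative f') (at z) \<Longrightarrow> frechet_derivative f (at z) v = f' v"
  using frechet_derivative_at by metis

lemma D1_add:
  "Ck 2 f \<Longrightarrow> Ck 2 g \<Longrightarrow>
    frechet_derivative (\<lambda>z. f z + g z) (at z) v = frechet_derivative f (at z) v + frechet_derivative g (at z) v"
  by (intro D1_eq has_derivative_add Ck2_D1)

lemma D2_add:
  assumes "Ck 2 f" "Ck 2 g"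
  shows "D2 (\<lambda>z. f z + g z) z u v = D2 f z u v + D2 g z u v"
proof -
  have "((\<lambda>w. frechet_derivative (\<lambda>z. f z + g z) (at w) v) has_derivative (\<lambda>u. D2 f z u v + D2 g z u v)) (at z)"
    unfolding D1_add[OF assms] by (intro has_derivative_add Ck2_D2 assms)
  then show ?thesis unfolding D2_def by (rule D1_eq)
qed

lemma D1_minus: "Ck 2 f \<Longrightarrow> frechet_derivative (\<lambda>z. - f z) (at z) v = - frechet_derivative f (at z) v"
  by (intro D1_eq has_derivative_minus Ck2_D1)

lemma D2_minus:
  assumes "Ck 2 f"
  shows "D2 (\<lambda>z. - f z) z u v = - D2 f z u v"
proof -
  have "((\<lambda>w. frechet_derivative (\<lambda>z. - f z) (at w) v) has_derivative (\<lambda>u. - D2 f z u v)) (at z)"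
    unfolding D1_minus[OF assms] by (intro has_derivative_minus Ck2_D2 assms)
  then show ?thesis unfolding D2_def by (rule D1_eq)
qed

lemma has_derivative_affine_comp:
  assumes M: "bounded_linear M" and f: "(f has_derivative f') (at (M z + c))"
  shows "((\<lambda>z. f (M z + c)) has_derivative (\<lambda>v. f' (M v))) (at z)"
  using has_derivative_compose[OF has_derivative_add[OF bounded_linear_imp_has_derivative[OF M] has_derivative_const] f]
  by simp

lemma D1_affine:
  assumes "Ck 2 f" "bounded_linear M"
  shows "frechet_derivative (\<lambda>z. f (M z + c)) (at z) v = frechet_derivative f (at (M z + c)) (M v)"
  by (intro D1_eq has_derivative_affine_comp Ck2_D1 assms)

lemma D2_affine:
  assumes "Ck 2 f" "bounded_linear M"
  shows "D2 (\<lambda>z. f (M z + c)) z u v = D2 f (M z + c) (M u) (M v)"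
proof -
  have "((\<lambda>w. frechet_derivative (\<lambda>z. f (M z + c)) (at w) v) has_derivative (\<lambda>u. D2 f (M z + c) (M u) (M v))) (at z)"
    unfolding D1_affine[OF assms]
    by (rule has_derivative_affine_comp[OF assms(2) Ck2_D2[OF assms(1)]])
  then show ?thesis unfolding D2_def by (rule D1_eq)
qed

section \<open>Perturbations, second-order conditions and quadratic minorants\<close>

text \<open>A perturbation that makes a contact strict without changing any derivative of first or
  second order at \<open>z0\<close>.\<close>

definition quartic :: "'a::euclidean_space \<Rightarrow> 'a \<Rightarrow> real" where
  "quartic z0 z = ((z - z0) \<bullet> (z - z0))\<^sup>2"

lemma Ck_quartic: "Ck k (quartic z0)"
  unfolding quartic_def by (intro Ck_power Ck_bilinear bounded_bilinear_inner)

lemma quartic_simps [simp]: "quartic z0 z0 = 0" "z \<noteq> z0 \<Longrightarrow> 0 < quartic z0 z"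
  by (auto simp: quartic_def)

lemma D1_quartic: "frechet_derivative (quartic z0) (at z) v = 4 * (((z - z0) \<bullet> (z - z0)) * ((z - z0) \<bullet> v))"
  unfolding quartic_def
  by (rule D1_eq) (auto intro!: derivative_eq_intros simp: inner_commute algebra_simps)

lemma D2_quartic: "D2 (quartic z0) z0 u v = 0"
  unfolding D2_def D1_quartic
  by (rule D1_eq) (auto intro!: derivative_eq_intros)

text \<open>An error of order \<open>s ^ 4\<close> affects neither of the two derivatives at 0, so
  the usual conditions for a maximum survive. This tolerance matters because the penalty is quartic
  in horizontal directions.\<close>

lemma Ck2_max_line:
  assumes f: "Ck 2 f" and d: "0 < d"
    and le: "\<And>s. \<bar>s\<bar> < d \<Longrightarrow> f (z + s *\<^sub>R v) \<le> f z + K * s ^ 4"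
  shows "frechet_derivative f (at z) v = 0" and "D2 f z v v \<le> 0"
proof -
  define g where "g s = f (z + s *\<^sub>R v) - K * s ^ 4" for s :: real
  define g' where "g' s = frechet_derivative f (at (z + s *\<^sub>R v)) v - 4 * K * s ^ 3" for s :: real
  have g: "DERIV g s :> g' s" for s
    unfolding g_def g'_def by (auto intro!: derivative_eq_intros Ck2_line f)
  have g0: "g s \<le> g 0" if "\<bar>s\<bar> < d" for s
    using le[OF that] by (simp add: g_def)
  have g'0: "g' 0 = 0"
    by (rule DERIV_local_max[OF g d]) (use g0 in auto)
  then show "frechet_derivative f (at z) v = 0" by (simp add: g'_def)
  have g'': "DERIV g' 0 :> D2 f z v v"
    unfolding g'_def using Ck2_line(2)[OF f, of z v v 0]
    by (auto intro!: derivative_eq_intros)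
  show "D2 f z v v \<le> 0"
  proof (rule ccontr)
    assume "\<not> D2 f z v v \<le> 0"
    then obtain e where e: "0 < e" "\<And>h. 0 < h \<Longrightarrow> h < e \<Longrightarrow> g' 0 < g' (0 + h)"
      using DERIV_pos_inc_right[OF g''] by auto
    define s where "s = min d e / 2"
    have s: "0 < s" "s < d" "s < e" using d e by (auto simp: s_def)
    obtain x where x: "0 < x" "x < s" "g s - g 0 = (s - 0) * g' x"
      using MVT2[OF s(1) g] by blast
    have "0 < s * g' x" using e(2)[of x] x s g'0 by simp
    with x g0[of s] s show False by auto
  qed
qed

text \<open>The second-order Taylor polynomial minus a small multiple of the squared distance. It
  replaces a C^2 test function by a smooth one, as flows require, and gives strict contact.\<close>

lemma Ck2_quadratic_minorant:
  assumes f: "Ck 2 f" and k: "0 < \<kappa>"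
  obtains P d where "smooth_fun P" "P z0 = f z0"
    "\<And>v. frechet_derivative P (at z0) v = frechet_derivative f (at z0) v"
    "\<And>u v. D2 P z0 u v = D2 f z0 u v - \<kappa> * (u \<bullet> v)"
    "0 < d" "\<And>z. z \<noteq> z0 \<Longrightarrow> dist z z0 < d \<Longrightarrow> P z < f z"
proof -
  let ?D = "\<lambda>z. frechet_derivative f (at z)"
  define q where "q z = D2 f z0 (z - z0) (z - z0)" for z
  define l where "l z = f z0 + ?D z0 (z - z0)" for z
  define n where "n z = (z - z0) \<bullet> (z - z0)" for z
  define P where "P z = l z + (1/2) * q z + (- \<kappa> / 2) * n z" for z
  interpret b: bounded_bilinear "D2 f z0" by (rule D2_bilinear[OF f])
  have bl: "bounded_linear (?D z0)"
    using Ck2_D1[OF f] has_derivative_bounded_linear by blast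
  interpret bl: bounded_linear "?D z0" by (rule bl)
  have Cl: "Ck k l" for k unfolding l_def bl.diff
    by (intro Ck_add Ck_const Ck_diff Ck_linear bl)
  have Cq: "Ck k q" for k unfolding q_def by (rule Ck_bilinear[OF D2_bilinear[OF f]])
  have Cn: "Ck k n" for k unfolding n_def by (rule Ck_bilinear[OF bounded_bilinear_inner])
  have CP: "Ck k P" for k unfolding P_def by (intro Ck_add Ck_mult Ck_const Cl Cq Cn)
  have dP: "(P has_derivative (\<lambda>v. ?D z0 v + D2 f z0 (z - z0) v - \<kappa> * ((z - z0) \<bullet> v))) (at z)" for z
  proof -
    have 1: "(l has_derivative ?D z0) (at z)" unfolding l_def
      by (auto intro!: derivative_eq_intros bl.has_derivative)
    have "(q has_derivative (\<lambda>v. D2 f z0 (z - z0) v + D2 f z0 v (z - z0))) (at z)" unfolding q_def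
      by (rule b.FDERIV) (auto intro!: derivative_eq_intros)
    then have 2: "(q has_derivative (\<lambda>v. 2 * D2 f z0 (z - z0) v)) (at z)"
      using D2_symmetric[OF f] by simp
    have 3: "(n has_derivative (\<lambda>v. 2 * ((z - z0) \<bullet> v))) (at z)" unfolding n_def
      by (auto intro!: derivative_eq_intros simp: inner_commute)
    show ?thesis unfolding P_def
      by (rule has_derivative_eq_rhs[OF has_derivative_add[OF has_derivative_add[OF 1
          has_derivative_mult_right[OF 2]] has_derivative_mult_right[OF 3]]]) (auto simp: fun_eq_iff)
  qed
  have D1P: "frechet_derivative P (at z) v = ?D z0 v + D2 f z0 (z - z0) v - \<kappa> * ((z - z0) \<bullet> v)" for z v
    by (rule D1_eq[OF dP])
  have D2P: "D2 P z0 u v = D2 f z0 u v - \<kappa> * (u \<bullet> v)" for u v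
    unfolding D2_def[of P] D1P
    by (rule D1_eq) (auto intro!: derivative_eq_intros bounded_linear.has_derivative[OF b.bounded_linear_left])
  define N where "N = real DIM('a)"
  have N: "0 < N" by (simp add: N_def)
  \<comment> \<open>The derivative is controlled separately on each basis vector; dividing by the
    dimension leaves a total error of one quarter of \<open>\<kappa>\<close>.\<close>
  define e where "e = \<kappa> / (4 * N)"
  have e: "0 < e" using k N by (simp add: e_def)
  have "\<exists>d>0. \<forall>y. norm (y - z0) < d \<longrightarrow> norm (?D y v - ?D z0 v - D2 f z0 (y - z0) v) \<le> e * norm (y - z0)" for v
    using Ck2_D2[OF f, of v z0] e unfolding has_derivative_at_alt by blast
  then obtain dd where dd: "\<And>v. 0 < dd v"
    "\<And>v y. norm (y - z0) < dd v \<Longrightarrow> \<bar>?D y v - ?D z0 v - D2 f z0 (y - z0) v\<bar> \<le> e * norm (y - z0)"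
    unfolding real_norm_def by metis
  define d where "d = Min (dd ` Basis)"
  have d: "0 < d" using dd(1) by (auto simp: d_def)
  have dle: "d \<le> dd b" if "b \<in> Basis" for b using that by (simp add: d_def)
  have main: "P z < f z" if z: "z \<noteq> z0" "dist z z0 < d" for z
  proof -
    define w where "w = z - z0"
    have w: "0 < norm w" "norm w < d" using z by (auto simp: w_def dist_norm)
    \<comment> \<open>The increment of \<open>f - P\<close> along the segment is its derivative at
      an intermediate point, where the gain \<open>\<kappa> * s * (norm w)\<^sup>2\<close> dominates
      the error \<open>E w\<close>.\<close>
    define g where "g s = f (z0 + s *\<^sub>R w) - P (z0 + s *\<^sub>R w)" for s
    have "DERIV g s :> ?D (z0 + s *\<^sub>R w) w - frechet_derivative P (at (z0 + s *\<^sub>R w)) w" for s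
      unfolding g_def by (intro DERIV_diff Ck2_line f CP)
    from MVT2[OF zero_less_one this] obtain s where s: "0 < s" "s < 1"
      and g1: "g 1 - g 0 = ?D (z0 + s *\<^sub>R w) w - frechet_derivative P (at (z0 + s *\<^sub>R w)) w" by auto
    define y where "y = z0 + s *\<^sub>R w"
    define E where "E v = ?D y v - ?D z0 v - D2 f z0 (y - z0) v" for v
    have yz: "norm (y - z0) = s * norm w" using s by (simp add: y_def)
    have ny: "norm (y - z0) < d" using mult_strict_right_mono[OF s(2) w(1)] w(2) yz by linarith
    interpret by': bounded_linear "?D y" using Ck2_D1[OF f] has_derivative_bounded_linear by blast
    have linE: "linear E" unfolding E_def
      by (intro linear_compose_sub by'.linear bl.linear b.bounded_linear_right[THEN bounded_linear.linear])
    have "\<bar>E w\<bar> = \<bar>\<Sum>b\<in>Basis. (w \<bullet> b) * E b\<bar>"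
      using linear_sum[OF linE, of "\<lambda>b. (w \<bullet> b) *\<^sub>R b" Basis] linear_scale[OF linE]
      by (simp add: euclidean_representation)
    also have "\<dots> \<le> (\<Sum>b\<in>Basis. \<bar>(w \<bullet> b) * E b\<bar>)" by (rule sum_abs)
    also have "\<dots> \<le> (\<Sum>b::'a\<in>Basis. norm w * (e * (s * norm w)))"
    proof (rule sum_mono)
      fix b :: 'a assume b: "b \<in> Basis"
      have "\<bar>E b\<bar> \<le> e * (s * norm w)"
        unfolding E_def yz[symmetric] by (rule dd(2)) (use ny dle[OF b] in linarith)
      then show "\<bar>(w \<bullet> b) * E b\<bar> \<le> norm w * (e * (s * norm w))"
        unfolding abs_mult using Basis_le_norm[OF b, of w] by (intro mult_mono) auto
    qed
    also have "\<dots> = s * (\<kappa> / 4 * (norm w)\<^sup>2)"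
      using N by (simp add: e_def N_def power2_eq_square)
    finally have Ew: "\<bar>E w\<bar> \<le> s * (\<kappa> / 4 * (norm w)\<^sup>2)" .
    have "g 1 - g 0 = E w + \<kappa> * (s * (norm w)\<^sup>2)"
      unfolding g1 y_def[symmetric] D1P E_def by (simp add: y_def power2_norm_eq_inner)
    moreover have "0 < s * (\<kappa> / 4 * (norm w)\<^sup>2)" using s k w by simp
    moreover have "\<kappa> * (s * (norm w)\<^sup>2) = 4 * (s * (\<kappa> / 4 * (norm w)\<^sup>2))" by simp
    ultimately have "0 < g 1 - g 0" using Ew by linarith
    moreover have "g 0 = 0" by (simp add: g_def P_def l_def q_def n_def b.zero_left bl.zero)
    ultimately show ?thesis by (simp add: g_def w_def)
  qed
  show ?thesis
    by (rule that[of P d])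
     (use CP D2P d main in \<open>auto simp: smooth_fun_def D1P b.zero_left P_def l_def q_def n_def bl.zero\<close>)
qed

section \<open>Gradient, time derivative and Hessian in coordinates\<close>

lemma basis_expansion_vec: "(u::real^'n::finite) = (\<Sum>i\<in>UNIV. u $ i *\<^sub>R axis i 1)"
  by (simp add: vec_eq_iff axis_def if_distrib cong: if_cong)

lemma D1_grad_dtime:
  assumes f: "Ck 2 f"
  shows "frechet_derivative f (at z) (u, \<tau>) = u \<bullet> grad f z + \<tau> * dtime f z"
proof -
  let ?D = "frechet_derivative f (at z)"
  note lin = D1_linear[OF f, of z]
  have l1: "linear (\<lambda>u. ?D (u, 0))"
    using linear_compose[OF _ lin, of "\<lambda>u. (u, 0)"] by (simp add: linear_iff o_def)
  have "?D (u, \<tau>) = ?D (u, 0) + ?D (\<tau> *\<^sub>R (0, 1))"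
    using linear_add[OF lin, of "(u,0)" "\<tau> *\<^sub>R (0,1)"] by simp
  also have "?D (u, 0) = (\<Sum>i\<in>UNIV. u $ i * ?D (axis i 1, 0))"
    by (subst basis_expansion_vec[of u]) (simp add: linear_sum[OF l1] linear_scale[OF l1])
  finally show ?thesis
    by (simp only: linear_scale[OF lin] grad_def dtime_def inner_vec_def vec_lambda_beta inner_real_def real_scaleR_def)
qed

lemma hess_D2: "hess f z = (\<chi> i j. D2 f z (axis i 1, 0) (axis j 1, 0))"
  by (simp add: hess_def D2_def)

lemma D2_hess:
  assumes f: "Ck 2 f"
  shows "D2 f z (u, 0) (v, 0) = u \<bullet> (hess f z *v v)"
proof -
  have l1: "linear (\<lambda>u. D2 f z (u, 0) w)" for w
    using linear_compose[OF _ D2_linear_left[OF f], of "\<lambda>u. (u, 0)"] by (simp add: linear_iff o_def)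
  have l2: "linear (\<lambda>u. D2 f z w (u, 0))" for w
    using linear_compose[OF _ D2_linear_right[OF f], of "\<lambda>u. (u, 0)"] by (simp add: linear_iff o_def)
  have "D2 f z (u, 0) (v, 0) = (\<Sum>i\<in>UNIV. u $ i * D2 f z (axis i 1, 0) (v, 0))"
    by (subst basis_expansion_vec[of u]) (simp add: linear_sum[OF l1] linear_scale[OF l1])
  also have "\<dots> = (\<Sum>i\<in>UNIV. u $ i * (\<Sum>j\<in>UNIV. v $ j * D2 f z (axis i 1, 0) (axis j 1, 0)))"
  proof -
    have "D2 f z w (v, 0) = (\<Sum>j\<in>UNIV. v $ j * D2 f z w (axis j 1, 0))" for w
      by (subst basis_expansion_vec[of v]) (simp add: linear_sum[OF l2] linear_scale[OF l2])
    then show ?thesis by simp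
  qed
  finally show ?thesis
    by (simp add: inner_vec_def matrix_vector_mult_def hess_D2 mult.commute)
qed

lemma hess_symm: "Ck 2 f \<Longrightarrow> symm (hess f z)"
  by (simp add: symm_def hess_D2 transpose_def vec_eq_iff D2_symmetric)

lemma continuous_jets:
  assumes f: "Ck 2 f"
  shows "continuous_on UNIV (dtime f)" "continuous_on UNIV (grad f)" "continuous_on UNIV (hess f)"
proof -
  show "continuous_on UNIV (dtime f)"
    unfolding dtime_def by (rule continuous_D1[OF f])
  show "continuous_on UNIV (grad f)"
    unfolding grad_def by (intro continuous_on_vec_lambda continuous_D1 f)
  show "continuous_on UNIV (hess f)"
    unfolding hess_D2 by (intro continuous_on_vec_lambda continuous_D2 f)
qed

section \<open>Semicontinuous envelopes\<close>

text \<open>This is upper semicontinuity of the envelope: the supremum over a ball of radius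
  \<open>r\<close> bounds the envelope at every point within \<open>r / 2\<close> of its
  centre.\<close>

lemma usc_env_less_imp:
  assumes "ereal \<tau> + usc_env f D z < 0"
  shows "\<exists>\<rho>>0. \<forall>\<tau>' z'. \<bar>\<tau>' - \<tau>\<bar> < \<rho> \<longrightarrow> dist z' z < \<rho> \<longrightarrow> ereal \<tau>' + usc_env f D z' < 0"
proof -
  have "usc_env f D z < ereal (- \<tau>)"
    using assms by (cases "usc_env f D z") auto
  then obtain c where c: "usc_env f D z < ereal c" "c < - \<tau>"
    using ereal_dense2 by (metis ereal_less(2) less_ereal.simps(1))
  then obtain r where r: "0 < r" "(SUP w\<in>D \<inter> ball z r. ereal (f w)) < ereal c"
    unfolding usc_env_def INF_less_iff by auto
  define \<rho> where "\<rho> = min (r / 2) (- \<tau> - c)"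
  have "ereal \<tau>' + usc_env f D z' < 0" if "\<bar>\<tau>' - \<tau>\<bar> < \<rho>" "dist z' z < \<rho>" for \<tau>' z'
  proof -
    have "ball z' (r / 2) \<subseteq> ball z r"
      using that(2) unfolding \<rho>_def by (intro subsetI) (auto simp: dist_commute intro: dist_triangle_half_l)
    then have "(SUP w\<in>D \<inter> ball z' (r/2). ereal (f w)) \<le> (SUP w\<in>D \<inter> ball z r. ereal (f w))"
      by (intro SUP_subset_mono) auto
    moreover have "usc_env f D z' \<le> (SUP w\<in>D \<inter> ball z' (r/2). ereal (f w))"
      unfolding usc_env_def using r(1) by (intro INF_lower) auto
    ultimately have "usc_env f D z' \<le> ereal c" using r(2) by order
    then have "ereal \<tau>' + usc_env f D z' \<le> ereal (\<tau>' + c)"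
      using add_left_mono[of "usc_env f D z'" "ereal c" "ereal \<tau>'"] by simp
    also have "\<dots> < 0" using that(1) c(2) by (auto simp: \<rho>_def)
    finally show ?thesis .
  qed
  moreover have "0 < \<rho>" using r c by (simp add: \<rho>_def)
  ultimately show ?thesis by blast
qed

lemma usc_env_nonneg:
  assumes "\<And>r e. 0 < r \<Longrightarrow> 0 < e \<Longrightarrow> \<exists>w\<in>D \<inter> ball z r. - e \<le> f w"
  shows "0 \<le> usc_env f D z"
  unfolding usc_env_def
proof (rule INF_greatest)
  fix r :: real assume "r \<in> {0<..}"
  then have r: "0 < r" by simp
  show "0 \<le> (SUP w\<in>D \<inter> ball z r. ereal (f w))"
  proof (rule ereal_le_epsilon2)
    fix e :: real assume "0 < e"
    then obtain w where w: "w \<in> D \<inter> ball z r" "- e \<le> f w" using assms r by blast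
    then have "ereal (- e) \<le> (SUP w\<in>D \<inter> ball z r. ereal (f w))"
      by (intro SUP_upper2[OF w(1)]) simp
    then show "0 \<le> (SUP w\<in>D \<inter> ball z r. ereal (f w)) + ereal e"
      by (metis add.left_inverse add_right_mono ereal_eq_0(1) plus_ereal.simps(1))
  qed
qed

lemma lsc_env_nonpos:
  assumes "\<And>r e. 0 < r \<Longrightarrow> 0 < e \<Longrightarrow> \<exists>w\<in>D \<inter> ball z r. f w \<le> e"
  shows "lsc_env f D z \<le> 0"
  unfolding lsc_env_def
proof (rule SUP_least)
  fix r :: real assume "r \<in> {0<..}"
  then have r: "0 < r" by simp
  show "(INF w\<in>D \<inter> ball z r. ereal (f w)) \<le> 0"
  proof (rule ereal_le_epsilon2)
    fix e :: real assume "0 < e"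
    then obtain w where w: "w \<in> D \<inter> ball z r" "f w \<le> e" using assms r by blast
    then show "(INF w\<in>D \<inter> ball z r. ereal (f w)) \<le> 0 + ereal e"
      by (intro INF_lower2[OF w(1)]) simp
  qed
qed

text \<open>Continuity maps small balls in \<open>D\<close> into small balls in \<open>E\<close>.
  Only an inequality results, since the image of \<open>D\<close> may miss part of
  \<open>E\<close>.\<close>

lemma usc_env_comp_le:
  assumes c: "isCont g z" and D: "\<And>w. w \<in> D \<Longrightarrow> g w \<in> E" and fh: "\<And>w. f w = h (g w)"
  shows "usc_env f D z \<le> usc_env h E (g z)"
  unfolding usc_env_def[of h]
proof (rule INF_greatest)
  fix r :: real assume "r \<in> {0<..}"
  then obtain d where d: "0 < d" "\<And>w. dist w z < d \<Longrightarrow> dist (g w) (g z) < r"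
    using c unfolding continuous_at_eps_delta by auto
  have "usc_env f D z \<le> (SUP w\<in>D \<inter> ball z d. ereal (f w))"
    unfolding usc_env_def using d(1) by (intro INF_lower) auto
  also have "\<dots> \<le> (SUP w\<in>E \<inter> ball (g z) r. ereal (h w))"
    by (rule SUP_mono) (use D d(2) fh in \<open>auto simp: dist_commute intro!: bexI[of _ "g _"]\<close>)
  finally show "usc_env f D z \<le> (SUP w\<in>E \<inter> ball (g z) r. ereal (h w))" .
qed

text \<open>An isometric involution of the domain maps balls to balls, and the change of sign turns
  suprema into infima. It is meant for the change of sign of gradient and matrix.\<close>

lemma usc_env_uminus:
  assumes i: "\<And>w. \<iota> (\<iota> w) = w" "\<And>w v. dist (\<iota> w) (\<iota> v) = dist w v" "\<And>w. w \<in> D \<Longrightarrow> \<iota> w \<in> D"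
    and g: "\<And>w. g w = - f (\<iota> w)"
  shows "usc_env g D z = - lsc_env f D (\<iota> z)"
proof -
  have im: "\<iota> ` (D \<inter> ball z r) = D \<inter> ball (\<iota> z) r" for r
  proof (intro equalityI subsetI)
    fix x assume "x \<in> D \<inter> ball (\<iota> z) r"
    then have "\<iota> x \<in> D \<inter> ball z r" using i(2)[of z "\<iota> x"] by (auto simp: i)
    then show "x \<in> \<iota> ` (D \<inter> ball z r)" using i(1)[of x] by (metis imageI)
  qed (auto simp: i)
  have "(SUP w\<in>D \<inter> ball z r. ereal (g w)) = - (INF w\<in>D \<inter> ball (\<iota> z) r. ereal (f w))" for r
    unfolding im[symmetric] image_image ereal_SUP_uminus_eq[symmetric] g by (simp add: i)
  then show ?thesis
    unfolding usc_env_def lsc_env_def by (simp add: ereal_INF_uminus_eq)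
qed

lemma lsc_env_uminus:
  assumes i: "\<And>w. \<iota> (\<iota> w) = w" "\<And>w v. dist (\<iota> w) (\<iota> v) = dist w v" "\<And>w. w \<in> D \<Longrightarrow> \<iota> w \<in> D"
    and g: "\<And>w. g w = - f (\<iota> w)"
  shows "lsc_env g D z = - usc_env f D (\<iota> z)"
proof -
  have "usc_env f D (\<iota> z) = - lsc_env g D (\<iota> (\<iota> z))"
    by (rule usc_env_uminus[OF i]) (simp_all add: g i)
  then show ?thesis by (simp add: i)
qed

section \<open>Horizontal derivatives\<close>

definition ver :: "real^('m::finite + 'k::finite) \<Rightarrow> real^'k" where
  "ver x = (\<chi> k. x $ Inr k)"

definition pt :: "real^'m \<Rightarrow> real^'k \<Rightarrow> real^('m::finite + 'k::finite)" where
  "pt u v = (\<chi> r. case r of Inl i \<Rightarrow> u $ i | Inr k \<Rightarrow> v $ k)"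

text \<open>The bilinear term of the group law, and at the same time the vertical part of the
  horizontal direction \<open>sigma B x *v c\<close>.\<close>

definition bil :: "('k::finite \<Rightarrow> real^'m::finite^'m) \<Rightarrow> real^'m \<Rightarrow> real^'m \<Rightarrow> real^'k" where
  "bil B u v = (\<chi> k. (B k *v u) \<bullet> v)"

lemma hor_pt [simp]: "hor (pt u v) = u" and ver_pt [simp]: "ver (pt u v) = v"
  by (simp_all add: hor_def ver_def pt_def vec_eq_iff)

lemma pt_hor_ver [simp]: "pt (hor x) (ver x) = x"
  by (simp add: hor_def ver_def pt_def vec_eq_iff split: sum.split)

lemma hor_ver_eqI: "hor x = hor y \<Longrightarrow> ver x = ver y \<Longrightarrow> x = y"
  by (metis pt_hor_ver)

lemma linear_hor: "linear hor" and linear_ver: "linear ver"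
  by (auto intro!: linearI simp: hor_def ver_def vec_eq_iff)

lemma hor_simps [simp]: "hor (x + y) = hor x + hor y" "hor (x - y) = hor x - hor y" "hor (s *\<^sub>R x) = s *\<^sub>R hor x"
  and ver_simps [simp]: "ver (x + y) = ver x + ver y" "ver (x - y) = ver x - ver y" "ver (s *\<^sub>R x) = s *\<^sub>R ver x"
  by (simp_all add: hor_def ver_def vec_eq_iff)

lemma bilinear_bil: "bilinear (bil B)"
  unfolding bilinear_def bil_def
  by (auto intro!: linearI simp: vec_eq_iff matrix_vector_right_distrib inner_add_left inner_add_right
      matrix_vector_mult_scaleR)

lemma bounded_bilinear_bil: "bounded_bilinear (bil B)"
  using bilinear_bil bilinear_conv_bounded_bilinear by blast

lemma bil_skew:
  assumes "carnot_data B" shows "bil B u v = - bil B v u"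
proof -
  have "(B k *v u) \<bullet> v = - ((B k *v v) \<bullet> u)" for k
  proof -
    have "(B k *v u) \<bullet> v = u \<bullet> (transpose (B k) *v v)"
      by (metis dot_lmul_matrix transpose_matrix_vector inner_commute transpose_transpose)
    also have "transpose (B k) *v v = - (B k *v v)"
      using assms by (simp add: carnot_data_def matrix_vector_mult_def vec_eq_iff sum_negf)
    finally show ?thesis by (simp add: inner_commute)
  qed
  then show ?thesis by (simp add: bil_def vec_eq_iff)
qed

lemma bil_self: "carnot_data B \<Longrightarrow> bil B u u = 0"
  using bil_skew[of B u u] by (simp add: vec_eq_iff)

lemma sigma_mv: "sigma B x *v c = pt c (bil B (hor x) c)"
proof (intro vec_eq_iff[THEN iffD2] allI)
  fix r show "(sigma B x *v c) $ r = pt c (bil B (hor x) c) $ r"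
    by (cases r) (simp_all add: sigma_def pt_def bil_def matrix_vector_mul_component inner_axis')
qed

text \<open>Here and in \<open>X2dir\<close> the horizontal derivatives at \<open>x\<close> become
  ordinary derivatives in a direction frozen at \<open>x\<close>, so they can be read off along
  straight lines.\<close>

lemma Xdir:
  assumes "Ck 2 f"
  shows "frechet_derivative f (at (x, t)) (sigma B x *v c, 0) = (grad f (x, t) v* sigma B x) \<bullet> c"
  by (metis D1_grad_dtime[OF assms] dot_lmul_matrix inner_commute mult_zero_left add.right_neutral)

lemma sandwich_quadratic:
  fixes H :: "real^'n::finite^'n" and S :: "real^'m::finite^'n"
  shows "c \<bullet> ((transpose S ** H ** S) *v d) = (S *v c) \<bullet> (H *v (S *v d))"
  by (metis dot_lmul_matrix matrix_vector_mul_assoc transpose_matrix_vector transpose_transpose inner_commute)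

lemma X2dir:
  assumes "Ck 2 f"
  shows "D2 f (x, t) (sigma B x *v c, 0) (sigma B x *v d, 0) =
    c \<bullet> ((transpose (sigma B x) ** hess f (x, t) ** sigma B x) *v d)"
  by (simp add: D2_hess[OF assms] sandwich_quadratic)

lemma symm_sandwich: 
  fixes H :: "real^'n::finite^'n" and S :: "real^'m::finite^'n"
  shows "symm H \<Longrightarrow> symm (transpose S ** H ** S)"
  by (simp add: symm_def matrix_transpose_mul matrix_mul_assoc)

text \<open>Polarisation.\<close>

lemma symm_quadratic_zero:
  fixes M :: "real^'m::finite^'m"
  assumes "symm M" and z: "\<And>c. c \<bullet> (M *v c) = 0"
  shows "M = 0"
proof -
  have sy: "c \<bullet> (M *v d) = d \<bullet> (M *v c)" for c d
    using assms(1) unfolding symm_def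
    by (metis dot_lmul_matrix transpose_matrix_vector inner_commute)
  have "c \<bullet> (M *v d) = 0" for c d
    using z[of "c + d"] z[of c] z[of d] sy[of c d]
    by (simp add: matrix_vector_right_distrib inner_add_left inner_add_right)
  then have "M *v d = 0" for d by (metis inner_eq_zero_iff)
  then show ?thesis by (metis matrix_eq matrix_vector_mult_0)
qed

text \<open>The point is approached by gradients whose horizontal part is \<open>l\<close> times a
  unit vector. By (F2) the nonpositive horizontal Hessian may be replaced by 0, and by (F3) the
  value there is proportional to \<open>l\<close>.\<close>

lemma Gu_usc_nonneg:
  assumes F2: "F2 F" and F3: "F3 F" and t: "0 < t" and A: "symm A"
    and p: "p v* sigma B x = 0" and neg: "\<And>c. (sigma B x *v c) \<bullet> (A *v (sigma B x *v c)) \<le> 0"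
  shows "0 \<le> usc_env (Gu B F) (GDom B) (x, t, p, A)"
proof (rule usc_env_nonneg)
  fix r e :: real assume r: "0 < r" and e: "0 < e"
  define i :: 'a where "i = undefined"
  define q :: "real^('a + 'b)" where "q = axis (Inl i) 1"
  have q: "q v* sigma B x = axis i 1"
  proof -
    have "(q v* sigma B x) \<bullet> c = axis i 1 \<bullet> c" for c
      unfolding dot_lmul_matrix sigma_mv by (simp add: q_def inner_axis' pt_def)
    then show ?thesis by (metis vector_eq_rdot)
  qed
  define c where "c = F x t (axis i 1) 0"
  \<comment> \<open>The first bound keeps the perturbed gradient in the ball, the second keeps the
    value within \<open>e\<close> of 0.\<close>
  define l where "l = min (r / 2) (e / (\<bar>c\<bar> + 1))"
  have l: "0 < l" "l < r" using r e by (auto simp: l_def)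
  have "l * \<bar>c\<bar> \<le> e / (\<bar>c\<bar> + 1) * \<bar>c\<bar>" by (intro mult_right_mono) (auto simp: l_def)
  also have "\<dots> \<le> e" using e by (simp add: field_simps)
  finally have lc: "- e \<le> l * c" using l abs_mult[of l c] by (simp add: abs_le_iff)
  define A' where "A' = transpose (sigma B x) ** A ** sigma B x"
  have pl: "(p + l *\<^sub>R q) v* sigma B x = l *\<^sub>R axis i 1"
    by (simp add: vector_matrix_left_distrib p q scaleR_vector_matrix_assoc)
  have ax: "(axis i 1 :: real^'a) \<noteq> 0" by (simp add: axis_eq_0_iff)
  have s0: "symm (0 :: real^'a^'a)" by (simp add: symm_def transpose_def vec_eq_iff)
  have "psd (0 - A')"
    unfolding psd_def A'_def matrix_vector_mult_diff_rdistrib inner_diff_right sandwich_quadratic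
    using neg by simp
  then have "F x t (l *\<^sub>R axis i 1) 0 \<le> F x t (l *\<^sub>R axis i 1) A'"
    using F2 t ax l A s0 symm_sandwich[of A "sigma B x"] unfolding F2_def A'_def by auto
  moreover have "F x t (l *\<^sub>R axis i 1) 0 = l * c"
    using F3[unfolded F3_def, rule_format, of t "axis i 1" 0 l x 0] t ax s0 l(1) by (simp add: c_def)
  ultimately have "- e \<le> Gu B F (x, t, p + l *\<^sub>R q, A)"
    using lc by (simp add: Gu_def pl A'_def)
  moreover have "(x, t, p + l *\<^sub>R q, A) \<in> GDom B"
    using t A l ax by (simp add: GDom_def pl)
  moreover have "dist (x, t, p, A) (x, t, p + l *\<^sub>R q, A) < r"
    using l by (simp add: dist_Pair_Pair dist_norm q_def)
  ultimately show "\<exists>w\<in>GDom B \<inter> ball (x, t, p, A) r. - e \<le> Gu B F w" by auto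
qed

lemma sigma_continuous: "continuous_on UNIV (sigma B)"
proof -
  have "continuous_on UNIV (\<lambda>x. (case r of Inl i \<Rightarrow> axis i 1 | Inr k \<Rightarrow> B k *v hor x) :: real^'a)" for r
    by (cases r) (auto intro!: linear_continuous_on bounded_linear_compose[OF matrix_vector_mul_bounded_linear]
        linear_hor simp: linear_conv_bounded_linear[symmetric])
  then show ?thesis
    unfolding sigma_def by (intro continuous_on_vec_lambda)
qed

text \<open>Continuity of the map to horizontal jets bounds the envelope by that of \<open>F\<close>
  at zero gradient and matrix. There (F1) exchanges the upper envelope for the lower one, which
  homogeneity shows to be at most 0.\<close>

lemma Gu_usc_nonpos:
  assumes F1: "F1 F" and F3: "F3 F" and t: "0 < t"
    and p: "p v* sigma B x = 0" and A: "transpose (sigma B x) ** A ** sigma B x = 0"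
  shows "usc_env (Gu B F) (GDom B) (x, t, p, A) \<le> 0"
proof -
  define g where "g = (\<lambda>(x, t::real, p, A). (x, t, p v* sigma B x, transpose (sigma B x) ** A ** sigma B x))"
  have comp: "continuous_on UNIV (\<lambda>w. sigma B (fst w) $ i $ j)" for i j
    by (intro continuous_on_component continuous_on_compose2[OF sigma_continuous] continuous_on_fst continuous_on_id) auto
  have "continuous_on UNIV g"
    unfolding g_def case_prod_beta vector_matrix_mult_def matrix_matrix_mult_def transpose_def
    by (simp, intro continuous_intros comp)
  then have "isCont g (x, t, p, A)"
    by (simp add: continuous_on_eq_continuous_at)
  then have "usc_env (Gu B F) (GDom B) (x, t, p, A) \<le> usc_env (Fu F) FDom (g (x, t, p, A))"
    by (rule usc_env_comp_le) (auto simp: GDom_def FDom_def g_def Gu_def Fu_def intro: symm_sandwich)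
  also have "g (x, t, p, A) = (x, t, 0, 0)" by (simp add: g_def p A)
  also have "usc_env (Fu F) FDom (x, t, 0, 0) = lsc_env (Fu F) FDom (x, t, 0, 0)"
    using F1 t by (simp add: F1_def)
  also have "\<dots> \<le> 0"
  proof (rule lsc_env_nonpos)
    fix r e :: real assume r: "0 < r" and e: "0 < e"
    define a :: "real^'a" where "a = axis undefined 1"
    have a: "a \<noteq> 0" "norm a = 1" by (auto simp: a_def axis_eq_0_iff)
    define c where "c = F x t a 0"
    define l where "l = min (r / 2) (e / (\<bar>c\<bar> + 1))"
    have l: "0 < l" "l < r" using r e by (auto simp: l_def)
    have "l * \<bar>c\<bar> \<le> e / (\<bar>c\<bar> + 1) * \<bar>c\<bar>" by (intro mult_right_mono) (auto simp: l_def)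
    also have "\<dots> \<le> e" using e by (simp add: field_simps)
    finally have lc: "l * c \<le> e" using l abs_mult[of l c] by (simp add: abs_le_iff)
    have s0: "symm (0 :: real^'a^'a)" by (simp add: symm_def transpose_def vec_eq_iff)
    have "Fu F (x, t, l *\<^sub>R a, 0) = l * c"
      using F3[unfolded F3_def, rule_format, of t a 0 l x 0] t a s0 l(1) by (simp add: c_def Fu_def)
    moreover have "(x, t, l *\<^sub>R a, 0) \<in> FDom \<inter> ball (x, t, 0, 0) r"
      using t a l s0 by (simp add: FDom_def dist_Pair_Pair dist_norm)
    ultimately show "\<exists>w\<in>FDom \<inter> ball (x, t, 0, 0) r. Fu F w \<le> e" using lc by metis
  qed
  finally show ?thesis .
qed

section \<open>Flows and supersolutions\<close>

abbreviation (input) spacetime_set :: "real \<Rightarrow> (real \<Rightarrow> 'a set) \<Rightarrow> ('a \<times> real) set" where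
  "spacetime_set T Om \<equiv> {(x, t). t \<in> {0<..<T} \<and> x \<in> Om t}"

lemma visc_superD:
  assumes "visc_super B F S u" "Ck 2 \<phi>" "z \<in> S" "0 < d"
    and "\<And>w. w \<in> S \<inter> ball z d \<Longrightarrow> u z - \<phi> z \<le> u w - \<phi> w"
  shows "0 \<le> ereal (dtime \<phi> z) + usc_env (Gu B F) (GDom B) (fst z, snd z, grad \<phi> z, hess \<phi> z)"
  using assms unfolding visc_super_def by blast

text \<open>The maximum point is not at the initial time or on the sphere, where (d) and (e) put the
  nonnegative set of \<open>\<phi>\<close> into \<open>Om\<close>, nor at the final time, where the
  exponential term is too large. That term depends on time only and lowers the time derivative, so
  (a) still contradicts the supersolution inequality.\<close>

lemma superflow_if_visc_super:
  assumes op: "open (spacetime_set T Om)"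
    and vs: "visc_super B F (UNIV \<times> {0<..<T}) (\<lambda>z. if z \<in> spacetime_set T Om then 1 else -1)"
  shows "gen_superflow B F T Om"
  unfolding gen_superflow_def
proof (intro allI impI ballI subsetI)
  fix x0 :: "real^('a+'b)" and t r h :: real and \<phi> s1 x1
  assume t: "0 < t" and r: "0 < r" and h: "0 < h" and tT: "t + h < T" and sm: "smooth_fun \<phi>"
    and a: "\<forall>x\<in>cball x0 r. \<forall>s\<in>{t..t+h}.
      ereal (dtime \<phi> (x,s)) + usc_env (Gu B F) (GDom B) (x, s, grad \<phi> (x,s), hess \<phi> (x,s)) < 0"
    and d: "{x\<in>cball x0 r. 0 \<le> \<phi> (x,t)} \<subseteq> Om t"
    and e: "\<forall>s\<in>{t..t+h}. {x\<in>sphere x0 r. 0 \<le> \<phi> (x,s)} \<subseteq> Om s"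
    and s1: "s1 \<in> {t<..<t+h}" and x1: "x1 \<in> {x\<in>cball x0 r. 0 < \<phi> (x,s1)}"
  show "x1 \<in> Om s1"
  proof (rule ccontr)
    assume nin: "x1 \<notin> Om s1"
    let ?Q = "cball x0 r \<times> {t..t+h}"
    have C: "Ck k \<phi>" for k using sm by (rule smooth_fun_imp_Ck)
    have cont: "continuous_on UNIV \<phi>" using C[of 0] by simp
    have Q: "compact ?Q" by (intro compact_Times compact_cball compact_Icc)
    have in1: "(x1, s1) \<in> ?Q" using x1 s1 by auto
    obtain M where M: "\<And>z. z \<in> ?Q \<Longrightarrow> \<phi> z \<le> M"
      using continuous_attains_sup[OF Q _ continuous_on_subset[OF cont subset_UNIV]] in1 by blast
    \<comment> \<open>Half the value leaves \<open>\<psi> (x1, s1) = \<eta> > 0\<close>, since the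
      exponential equals 1 at time \<open>s1\<close>.\<close>
    define \<eta> where "\<eta> = \<phi> (x1, s1) / 2"
    have \<eta>: "0 < \<eta>" using x1 by (simp add: \<eta>_def)
    have M0: "0 < M" using M[OF in1] x1 by simp
    \<comment> \<open>The exponent at time \<open>t + h\<close> becomes \<open>M / \<eta>\<close>,
      so the subtracted term there is at least \<open>\<eta> + M\<close>.\<close>
    define k where "k = M / (\<eta> * (t + h - s1))"
    have k: "0 < k" using M0 \<eta> s1 by (simp add: k_def)
    define E where "E z = exp (k * snd z + - k * s1)" for z :: "(real^('a+'b)) \<times> real"
    have bl: "bounded_linear (\<lambda>z :: (real^('a+'b)) \<times> real. k * snd z)"
      by (intro bounded_linear_const_mult bounded_linear_snd)
    have CE: "Ck j E" for j unfolding E_def by (rule Ck_exp_affine[OF bl])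
    have D1E: "frechet_derivative E (at z) v = E z * (k * snd v)" for z v
      unfolding E_def by (rule D1_eq) (auto intro!: derivative_eq_intros simp: algebra_simps)
    have D2E: "D2 E z u v = E z * (k * snd u) * (k * snd v)" for z u v
      unfolding D2_def D1E
      by (rule D1_eq, rule has_derivative_eq_rhs[OF has_derivative_mult_left[OF Ck2_D1[OF CE]]])
        (simp add: D1E fun_eq_iff)
    define \<psi> where "\<psi> z = \<phi> z + - \<eta> * E z" for z
    have CmE: "Ck j (\<lambda>z. - \<eta> * E z)" for j by (intro Ck_mult Ck_const CE)
    have D1mE: "frechet_derivative (\<lambda>z. - \<eta> * E z) (at z) v = - \<eta> * (E z * (k * snd v))" for z v
      by (rule D1_eq, rule has_derivative_eq_rhs[OF has_derivative_mult_right[OF Ck2_D1[OF CE]]])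
        (simp add: D1E fun_eq_iff)
    have D2mE: "D2 (\<lambda>z. - \<eta> * E z) z u v = - \<eta> * (E z * (k * snd u) * (k * snd v))" for z u v
      unfolding D2_def D1mE
      by (rule D1_eq, rule has_derivative_eq_rhs[OF has_derivative_mult_right[OF has_derivative_mult_left[OF Ck2_D1[OF CE]]]])
        (simp add: D1E fun_eq_iff)
    have C\<psi>: "Ck j \<psi>" for j unfolding \<psi>_def by (intro Ck_add C CmE)
    have jets: "grad \<psi> z = grad \<phi> z" "hess \<psi> z = hess \<phi> z" "dtime \<psi> z \<le> dtime \<phi> z" for z
    proof -
      have D1: "frechet_derivative \<psi> (at z) v = frechet_derivative \<phi> (at z) v - \<eta> * (E z * (k * snd v))" for v
        unfolding \<psi>_def D1_add[OF C CmE] D1mE by simp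
      have D2: "D2 \<psi> z u v = D2 \<phi> z u v - \<eta> * (E z * (k * snd u) * (k * snd v))" for u v
        unfolding \<psi>_def D2_add[OF C CmE] D2mE by simp
      show "grad \<psi> z = grad \<phi> z" by (simp add: grad_def D1)
      show "hess \<psi> z = hess \<phi> z" by (simp add: hess_D2 D2)
      show "dtime \<psi> z \<le> dtime \<phi> z" using \<eta> k by (simp add: dtime_def D1 E_def)
    qed
    let ?K = "?Q - spacetime_set T Om"
    have K: "compact ?K" using Q op by (rule compact_diff)
    have in1K: "(x1, s1) \<in> ?K" using in1 nin by auto
    have cont\<psi>: "continuous_on UNIV \<psi>" using C\<psi>[of 0] by simp
    have Kne: "?K \<noteq> {}" using in1K by blast
    obtain z where z: "z \<in> ?K" "\<forall>w\<in>?K. \<psi> w \<le> \<psi> z"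
      using continuous_attains_sup[OF K Kne continuous_on_subset[OF cont\<psi> subset_UNIV]] by blast
    obtain y s where zys: "z = (y, s)" by (cases z)
    have ys: "(y, s) \<in> ?K" and mx: "\<And>z. z \<in> ?K \<Longrightarrow> \<psi> z \<le> \<psi> (y, s)"
      using z unfolding zys by blast+
    have "\<psi> (x1, s1) = \<eta>" by (simp add: \<psi>_def E_def \<eta>_def)
    then have pos: "0 < \<psi> (y, s)" using mx[OF in1K] \<eta> by simp
    have "0 < \<eta> * E (y, s)" using \<eta> by (simp add: E_def)
    with pos have pos': "0 < \<phi> (y, s)" by (simp add: \<psi>_def)
    have ny: "y \<notin> Om s" using ys t tT by auto
    have "s \<noteq> t" using ny d pos' ys by auto
    moreover have "y \<notin> sphere x0 r"
    proof
      assume "y \<in> sphere x0 r"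
      moreover have "s \<in> {t..t+h}" using ys by blast
      ultimately have "y \<in> Om s" using bspec[OF e, of s] pos' by (auto simp: less_imp_le)
      with ny show False by contradiction
    qed
    moreover have "s \<noteq> t + h"
    proof
      assume s: "s = t + h"
      have kk: "k * (t + h - s1) = M / \<eta>" unfolding k_def times_divide_eq_left
        by (rule nonzero_mult_divide_mult_cancel_right) (use s1 in simp)
      have "M < \<eta> * (1 + M / \<eta>)" using \<eta> by (simp add: field_simps)
      also have "\<dots> \<le> \<eta> * exp (M / \<eta>)" using \<eta> by (intro mult_left_mono exp_ge_add_one_self) auto
      also have "exp (M / \<eta>) = E (y, s)" unfolding E_def s kk[symmetric] by (simp add: algebra_simps)
      finally have "\<psi> (y, s) < 0" using M[of "(y, s)"] ys by (auto simp: \<psi>_def)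
      then show False using pos by simp
    qed
    ultimately have int: "(y, s) \<in> ball x0 r \<times> {t<..<t+h}" using ys by auto
    have "open (ball x0 r \<times> {t<..<t+h})" by (intro open_Times) auto
    then obtain d1 where d1: "0 < d1" "ball (y, s) d1 \<subseteq> ball x0 r \<times> {t<..<t+h}"
      using int open_contains_ball by blast
    \<comment> \<open>The characteristic function jumps by 2 on entering the open set, so a
      variation of \<open>\<psi>\<close> below 1 is harmless there.\<close>
    obtain d2 where d2: "0 < d2" "\<And>w. dist w (y, s) < d2 \<Longrightarrow> dist (\<psi> w) (\<psi> (y, s)) < 1"
      using cont\<psi> unfolding continuous_on_iff by (metis UNIV_I zero_less_one)
    let ?u = "\<lambda>z. if z \<in> spacetime_set T Om then 1 else -1 :: real"
    have loc: "?u (y, s) - \<psi> (y, s) \<le> ?u w - \<psi> w"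
      if w: "w \<in> (UNIV \<times> {0<..<T}) \<inter> ball (y, s) (min d1 d2)" for w
    proof -
      have u: "?u (y, s) = -1" using ny by simp
      show "?u (y, s) - \<psi> (y, s) \<le> ?u w - \<psi> w"
      proof (cases "w \<in> spacetime_set T Om")
        case True
        have "\<psi> w < \<psi> (y, s) + 1" using d2(2)[of w] w by (auto simp: dist_commute dist_real_def abs_less_iff)
        then show ?thesis unfolding u using True by simp
      next
        case False
        have "w \<in> ball x0 r \<times> {t<..<t+h}" using d1(2) w by auto
        then have "w \<in> ?Q" by auto
        then have "\<psi> w \<le> \<psi> (y, s)" using mx False by blast
        then show ?thesis unfolding u using False by simp
      qed
    qed
    have "0 < min d1 d2" "(y, s) \<in> UNIV \<times> {0<..<T}" using d1 d2 ys t tT by auto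
    then have "0 \<le> ereal (dtime \<psi> (y, s)) + usc_env (Gu B F) (GDom B) (y, s, grad \<psi> (y, s), hess \<psi> (y, s))"
      using visc_superD[OF vs C\<psi> _ _ loc] by (metis fst_conv snd_conv)
    also have "\<dots> \<le> ereal (dtime \<phi> (y, s)) + usc_env (Gu B F) (GDom B) (y, s, grad \<phi> (y, s), hess \<phi> (y, s))"
      unfolding jets using jets(3)[of "(y, s)"] by (intro add_right_mono) simp
    also have "\<dots> < 0" using a ys by auto
    finally show False by simp
  qed
qed

section \<open>Local tests of a superflow at a contact point\<close>

lemma negative_near:
  assumes f: "Ck 2 \<phi>"
    and neg: "ereal (dtime \<phi> z1) + usc_env g D (fst z1, snd z1, grad \<phi> z1, hess \<phi> z1) < 0"
  shows "\<exists>r>0. \<forall>z. dist z z1 < r \<longrightarrow> ereal (dtime \<phi> z) + usc_env g D (fst z, snd z, grad \<phi> z, hess \<phi> z) < 0"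
proof -
  obtain \<rho> where \<rho>: "0 < \<rho>" "\<And>\<tau> w. \<bar>\<tau> - dtime \<phi> z1\<bar> < \<rho> \<Longrightarrow> dist w (fst z1, snd z1, grad \<phi> z1, hess \<phi> z1) < \<rho>
      \<Longrightarrow> ereal \<tau> + usc_env g D w < 0"
    using usc_env_less_imp[OF neg] by blast
  have "continuous_on UNIV (\<lambda>z. (fst z, snd z, grad \<phi> z, hess \<phi> z))"
    by (intro continuous_intros continuous_jets f)
  then obtain r1 where r1: "0 < r1" "\<And>z. dist z z1 < r1 \<Longrightarrow>
      dist (fst z, snd z, grad \<phi> z, hess \<phi> z) (fst z1, snd z1, grad \<phi> z1, hess \<phi> z1) < \<rho>"
    unfolding continuous_on_iff using \<rho>(1) by (metis UNIV_I)
  obtain r2 where r2: "0 < r2" "\<And>z. dist z z1 < r2 \<Longrightarrow> dist (dtime \<phi> z) (dtime \<phi> z1) < \<rho>"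
    using continuous_jets(1)[OF f] \<rho>(1) unfolding continuous_on_iff by (metis UNIV_I)
  show ?thesis
    by (rule exI[of _ "min r1 r2"]) (use r1 r2 \<rho> in \<open>auto simp: dist_real_def\<close>)
qed

lemma continuous_near_less:
  fixes f :: "'a::metric_space \<Rightarrow> real"
  assumes "continuous_on UNIV f" and "f z < c"
  obtains d where "0 < d" "\<And>w. dist w z < d \<Longrightarrow> f w < c"
proof -
  have "isCont f z" using assms(1) by (simp add: continuous_on_eq_continuous_at)
  then have "eventually (\<lambda>w. f w < c) (nhds z)"
    using assms(2) by (metis isCont_def tendsto_at_iff_tendsto_nhds order_tendstoD(2))
  then show ?thesis unfolding eventually_nhds_metric using that by blast
qed

lemma continuous_near_greater:
  fixes f :: "'a::metric_space \<Rightarrow> real"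
  assumes "continuous_on UNIV f" and "c < f z"
  obtains d where "0 < d" "\<And>w. dist w z < d \<Longrightarrow> c < f w"
  using continuous_near_less[of "\<lambda>w. - f w" z "- c"] assms by (auto intro: continuous_intros)

lemma gen_superflowD:
  assumes "gen_superflow B F T Om" and "0 < t" "0 < r" "0 < h" "t + h < T" "smooth_fun \<phi>"
    and "\<And>x s. x \<in> cball x0 r \<Longrightarrow> s \<in> {t..t+h} \<Longrightarrow>
      ereal (dtime \<phi> (x,s)) + usc_env (Gu B F) (GDom B) (x, s, grad \<phi> (x,s), hess \<phi> (x,s)) < 0"
    and "admissible_test B \<phi> x0 r t h"
    and "{x\<in>cball x0 r. 0 \<le> \<phi> (x,t)} \<subseteq> Om t"
    and "\<And>s. s \<in> {t..t+h} \<Longrightarrow> {x\<in>sphere x0 r. 0 \<le> \<phi> (x,s)} \<subseteq> Om s"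
    and "s \<in> {t<..<t+h}"
  shows "{x\<in>cball x0 r. 0 < \<phi> (x,s)} \<subseteq> Om s"
proof -
  note flow = assms(1)[unfolded gen_superflow_def]
  show ?thesis
    by (rule flow[THEN spec[where x = x0], THEN spec[where x = t], THEN spec[where x = r],
          THEN spec[where x = h], THEN spec[where x = \<phi>], THEN mp, THEN mp, THEN mp, THEN mp, THEN mp,
          THEN mp, THEN mp, THEN mp, THEN mp, THEN bspec])
      (use assms(2-) in \<open>blast+\<close>)
qed

text \<open>The flow is tested with \<open>\<psi> - \<psi> (x1, t1) + \<delta>\<close> on a time interval reaching only slightly beyond \<open>t1\<close>,
  chosen after \<open>\<delta>\<close>: if \<open>\<psi>\<close> has a degenerate spatial maximum at \<open>x1\<close> and decreases in time, its
  \<open>-\<delta>\<close> level set becomes singular and then empty soon after \<open>t1\<close>.\<close>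

lemma flow_local_test:
  assumes flow: "gen_superflow B F T Om" and op: "open (spacetime_set T Om)"
    and sm: "smooth_fun \<psi>" and t1: "0 < t1" "t1 < T" and nin: "x1 \<notin> Om t1" and R: "0 < R"
    and strict: "\<And>x t. dist x x1 \<le> R \<Longrightarrow> \<bar>t - t1\<bar> \<le> R \<Longrightarrow> x \<notin> Om t \<Longrightarrow> (x, t) \<noteq> (x1, t1) \<Longrightarrow> \<psi> (x, t) < \<psi> (x1, t1)"
    and neg: "ereal (dtime \<psi> (x1, t1)) + usc_env (Gu B F) (GDom B) (x1, t1, grad \<psi> (x1, t1), hess \<psi> (x1, t1)) < 0"
    and c: "\<And>x t. dist x x1 \<le> R \<Longrightarrow> \<bar>t - t1\<bar> \<le> R \<Longrightarrow> grad \<psi> (x, t) v* sigma B x = 0 \<Longrightarrow>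
      transpose (sigma B x) ** hess \<psi> (x, t) ** sigma B x = 0"
    and lo: "\<And>r. 0 < r \<Longrightarrow> \<exists>x\<in>cball x1 r. \<psi> (x, t1) < \<psi> (x1, t1)"
    and hi: "\<And>r. 0 < r \<Longrightarrow> \<exists>x\<in>cball x1 r. \<exists>h>0. \<forall>t\<in>{t1-h..t1}. \<psi> (x1, t1) \<le> \<psi> (x, t)"
    and g: "\<And>x t. dist x x1 \<le> R \<Longrightarrow> \<bar>t - t1\<bar> \<le> R \<Longrightarrow> grad \<psi> (x, t) = 0 \<Longrightarrow>
      x = x1 \<and> (\<forall>s\<in>{t1-R..t1}. \<psi> (x1, t1) \<le> \<psi> (x1, s))"
  shows False
proof -
  define m where "m = \<psi> (x1, t1)"
  have C: "Ck k \<psi>" for k using sm by (rule smooth_fun_imp_Ck)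
  have cont: "continuous_on UNIV \<psi>" using C[of 0] by simp
  have contt: "continuous_on UNIV (\<lambda>t. \<psi> (x, t))" for x
    by (intro continuous_on_compose2[OF cont] continuous_intros) auto
  obtain r0 where r0: "0 < r0" "\<And>z. dist z (x1, t1) < r0 \<Longrightarrow>
      ereal (dtime \<psi> z) + usc_env (Gu B F) (GDom B) (fst z, snd z, grad \<psi> z, hess \<psi> z) < 0"
    using negative_near[OF C, of "(x1, t1)" "Gu B F" "GDom B"] neg by auto
  \<comment> \<open>The box must stay where \<open>strict\<close> and the differential inequality
    hold, and between the times 0 and \<open>T\<close>. Thirds of \<open>r0\<close> suffice because
    the distance is at most the sum of the space and time distances.\<close>
  define r where "r = min (min R (r0 / 3)) (min (t1 / 2) ((T - t1) / 2))"
  have r: "0 < r" using R r0 t1 by (simp add: r_def)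
  have "r \<le> R" "r \<le> t1 / 2" "r \<le> (T - t1) / 2" unfolding r_def by linarith+
  then have r_le: "r \<le> R" "r < t1" "r < T - t1" using t1 by simp_all
  have near: "dist (x, t) (x1, t1) < r0" if "dist x x1 \<le> r" "\<bar>t - t1\<bar> \<le> r" for x t
  proof -
    have "dist (x, t) (x1, t1) \<le> dist x x1 + dist t t1"
      unfolding dist_Pair_Pair by (rule sqrt_sum_squares_le_sum) auto
    also have "\<dots> \<le> r0 / 3 + r0 / 3" using that by (intro add_mono) (auto simp: r_def dist_real_def)
    also have "\<dots> < r0" using r0 by simp
    finally show ?thesis .
  qed
  obtain xm where xm: "xm \<in> cball x1 r" "\<psi> (xm, t1) < m" using lo[OF r] by (auto simp: m_def)
  obtain xp hp where xp: "xp \<in> cball x1 r" "0 < hp" "\<And>t. t \<in> {t1-hp..t1} \<Longrightarrow> m \<le> \<psi> (xp, t)"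
    using hi[OF r] unfolding m_def by blast
  define dm where "dm = (m - \<psi> (xm, t1)) / 2"
  have dm: "0 < dm" using xm by (simp add: dm_def)
  obtain hm where hm: "0 < hm" "\<And>t. dist t t1 < hm \<Longrightarrow> \<psi> (xm, t) < m - dm"
    using continuous_near_less[OF contt, of xm t1 "m - dm"] xm by (auto simp: dm_def field_simps)
  \<comment> \<open>Within time \<open>h\<close> of \<open>t1\<close> the point \<open>xm\<close>
    stays below level \<open>m - dm\<close>, and \<open>xp\<close> stays at or above
    \<open>m\<close> before \<open>t1\<close>.\<close>
  define h where "h = min r (min hp (hm / 2))"
  have h: "0 < h" "h \<le> r" "h \<le> hp" "h < hm" using r xp hm by (auto simp: h_def)
  \<comment> \<open>The initial and lateral boundary of the box outside \<open>Om\<close>. It misses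
    \<open>(x1, t1)\<close>, so strictness and compactness give a uniform gap \<open>d1\<close>
    below \<open>m\<close>.\<close>
  define K where "K = (cball x1 r \<times> {t1 - h} \<union> sphere x1 r \<times> {t1-h..t1+h}) - spacetime_set T Om"
  have K: "compact K" unfolding K_def
    by (intro compact_diff op compact_Un compact_Times compact_cball compact_sphere compact_Icc) auto
  have Km: "\<psi> z < m" if "z \<in> K" for z
  proof -
    obtain x t where z: "z = (x, t)" by force
    have xt: "dist x x1 \<le> r" "\<bar>t - t1\<bar> \<le> h" "(x, t) \<noteq> (x1, t1)"
      using that h r unfolding z K_def by (auto simp: dist_commute)
    moreover have "x \<notin> Om t" using that xt h r_le unfolding z K_def by auto
    ultimately show ?thesis unfolding z m_def using h r_le by (intro strict) auto
  qed
  obtain d1 where d1: "0 < d1" "\<And>z. z \<in> K \<Longrightarrow> \<psi> z < m - d1"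
  proof (cases "K = {}")
    case False
    obtain z where z: "z \<in> K" "\<And>w. w \<in> K \<Longrightarrow> \<psi> w \<le> \<psi> z"
      using continuous_attains_sup[OF K False continuous_on_subset[OF cont subset_UNIV]] by blast
    show ?thesis by (rule that[of "(m - \<psi> z) / 2"]) (use z Km[OF z(1)] in \<open>auto simp: field_simps dest: z(2)\<close>)
  qed (use that[of 1] in auto)
  define \<delta> where "\<delta> = min d1 dm"
  have \<delta>: "0 < \<delta>" "\<delta> \<le> d1" "\<delta> \<le> dm" using d1 dm by (auto simp: \<delta>_def)
  have "\<psi> (x1, t1) > m - \<delta>" using \<delta> by (simp add: m_def)
  then obtain e1 where e1: "0 < e1" "\<And>t. dist t t1 < e1 \<Longrightarrow> \<psi> (x1, t) > m - \<delta>"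
    using continuous_near_greater[OF contt] by blast
  have "\<psi> (xp, t1) > m - \<delta>" using \<delta> xp(2) xp(3)[of t1] by auto
  then obtain e2 where e2: "0 < e2" "\<And>t. dist t t1 < e2 \<Longrightarrow> \<psi> (xp, t) > m - \<delta>"
    using continuous_near_greater[OF contt] by blast
  \<comment> \<open>Until \<open>t1 + h2\<close> the values at \<open>x1\<close> and
    \<open>xp\<close> remain above the level \<open>m - \<delta>\<close>, which covers the times not
    reached by \<open>hi\<close> and \<open>g\<close>.\<close>
  define h2 where "h2 = min h (min e1 e2 / 2)"
  have h2: "0 < h2" "h2 \<le> h" "h2 < e1" "h2 < e2" using h e1 e2 by (auto simp: h2_def)
  define \<Phi> where "\<Phi> z = \<psi> z + (\<delta> - m)" for z
  have C\<Phi>: "Ck k \<Phi>" for k unfolding \<Phi>_def by (intro Ck_add C Ck_const)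
  have D1: "frechet_derivative \<Phi> (at z) v = frechet_derivative \<psi> (at z) v" for z v
    by (rule D1_eq) (auto simp: \<Phi>_def intro!: derivative_eq_intros Ck2_D1 C)
  have jets: "dtime \<Phi> = dtime \<psi>" "grad \<Phi> = grad \<psi>" "hess \<Phi> = hess \<psi>"
    by (simp_all add: fun_eq_iff dtime_def grad_def hess_def D1)
  have hh: "t1 - h + (h + h2) = t1 + h2" by simp
  have tr: "\<bar>s - t1\<bar> \<le> h" if "s \<in> {t1-h..t1+h2}" for s using that h2 by auto
  have xr: "dist x x1 \<le> r" if "x \<in> cball x1 r" for x using that by (simp add: dist_commute)
  \<comment> \<open>At each time \<open>\<Phi>\<close> is negative at \<open>xm\<close> and positive
    at \<open>xp\<close>, so it vanishes somewhere on the segment between them.\<close>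
  have nonempty: "{x\<in>cball x1 r. \<Phi> (x, s) = 0} \<noteq> {}" if s: "s \<in> {t1-h..t1+h2}" for s
  proof -
    have m0: "\<Phi> (xm, s) < 0" using hm(2)[of s] tr[OF s] h \<delta> by (simp add: \<Phi>_def dist_real_def)
    have p0: "\<Phi> (xp, s) > 0"
    proof (cases "s \<le> t1")
      case True
      then have "m \<le> \<psi> (xp, s)" using s h by (intro xp(3)) auto
      then show ?thesis using \<delta> by (simp add: \<Phi>_def)
    next
      case False
      then have "dist s t1 < e2" using s h2 by (simp add: dist_real_def)
      then show ?thesis using e2(2)[of s] by (simp add: \<Phi>_def)
    qed
    define G where "G l = \<Phi> ((1 - l) *\<^sub>R xm + l *\<^sub>R xp, s)" for l
    have cont\<Phi>: "continuous_on UNIV \<Phi>" using C\<Phi>[of 0] by simp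
    have "continuous_on {0..1} G" unfolding G_def
      by (intro continuous_on_compose2[OF cont\<Phi>] continuous_intros) auto
    moreover have "G 0 \<le> 0" "0 \<le> G 1" using m0 p0 by (simp_all add: G_def less_imp_le)
    ultimately obtain l where l: "0 \<le> l" "l \<le> 1" "G l = 0"
      using IVT'[of G 0 0 1] zero_le_one by blast
    have "(1 - l) *\<^sub>R xm + l *\<^sub>R xp \<in> cball x1 r"
      using convex_cball[of x1 r] l xm xp unfolding convex_alt by blast
    then show ?thesis using l by (auto simp: G_def)
  qed
  \<comment> \<open>By \<open>g\<close> a critical point lies over \<open>x1\<close>, where
    \<open>\<Phi>\<close> is positive both before and after \<open>t1\<close>.\<close>
  have gradne: "grad \<psi> (x, s) \<noteq> 0" if x: "x \<in> cball x1 r" and s: "s \<in> {t1-h..t1+h2}" and z: "\<Phi> (x, s) = 0" for x s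
  proof
    assume "grad \<psi> (x, s) = 0"
    with g[of x s] xr[OF x] tr[OF s] r_le h
    have 1: "x = x1" "\<And>s. s\<in>{t1-R..t1} \<Longrightarrow> m \<le> \<psi> (x1, s)" by (auto simp: m_def)
    show False
    proof (cases "s \<le> t1")
      case True
      then have "m \<le> \<psi> (x1, s)" using s h r_le by (intro 1(2)) auto
      then show ?thesis using z \<delta> 1(1) by (simp add: \<Phi>_def)
    next
      case False
      then have "dist s t1 < e1" using s h2 by (simp add: dist_real_def)
      then show ?thesis using e1(2)[of s] z 1(1) by (simp add: \<Phi>_def)
    qed
  qed
  have adm: "admissible_test B \<Phi> x1 r (t1 - h) (h + h2)"
    unfolding admissible_test_def hh jets
    using nonempty gradne c xr tr h(2) r_le(1) by (meson order_trans)
  have inO: "x \<in> Om s" if "(x, s) \<in> cball x1 r \<times> {t1 - h} \<union> sphere x1 r \<times> {t1-h..t1+h2}" "0 \<le> \<Phi> (x, s)" for x s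
  proof (rule ccontr)
    assume "x \<notin> Om s"
    then have "(x, s) \<in> K" using that(1) h2 unfolding K_def by auto
    then show False using d1(2)[of "(x, s)"] that(2) \<delta> by (simp add: \<Phi>_def)
  qed
  have "{x\<in>cball x1 r. 0 < \<Phi> (x, t1)} \<subseteq> Om t1"
  proof (rule gen_superflowD[OF flow, of "t1 - h" r "h + h2" \<Phi> x1])
    show "t1 \<in> {t1-h<..<t1-h+(h+h2)}" using h h2 by simp
    show "0 < t1 - h" "0 < r" "0 < h + h2" using h r_le r h2 by auto
    show "t1 - h + (h + h2) < T" unfolding hh using h2 h r_le by auto
    show "smooth_fun \<Phi>" using C\<Phi> by (simp add: smooth_fun_def)
    show "admissible_test B \<Phi> x1 r (t1 - h) (h + h2)" by (rule adm)
    show "ereal (dtime \<Phi> (x, s)) + usc_env (Gu B F) (GDom B) (x, s, grad \<Phi> (x, s), hess \<Phi> (x, s)) < 0"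
      if "x \<in> cball x1 r" "s \<in> {t1 - h..t1 - h + (h + h2)}" for x s
      using r0(2)[of "(x, s)"] near[OF xr[OF that(1)], of s] tr[of s] that h unfolding jets hh by auto
    show "{x \<in> cball x1 r. 0 \<le> \<Phi> (x, t1 - h)} \<subseteq> Om (t1 - h)" using inO by auto
    show "{x \<in> sphere x1 r. 0 \<le> \<Phi> (x, s)} \<subseteq> Om s" if "s \<in> {t1 - h..t1 - h + (h + h2)}" for s
      using inO that unfolding hh by auto
  qed
  then have "x1 \<in> Om t1" using r \<delta> by (auto simp: \<Phi>_def m_def)
  with nin show False by simp
qed

text \<open>With a nonzero gradient, small steps against and along it supply \<open>lo\<close> and
  \<open>hi\<close>, and the condition on critical points is vacuous near the contact.\<close>

lemma flow_local_test_regular: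
  assumes flow: "gen_superflow B F T Om" and op: "open (spacetime_set T Om)"
    and sm: "smooth_fun \<psi>" and t1: "0 < t1" "t1 < T" and nin: "x1 \<notin> Om t1" and R: "0 < R"
    and strict: "\<And>x t. dist x x1 \<le> R \<Longrightarrow> \<bar>t - t1\<bar> \<le> R \<Longrightarrow> x \<notin> Om t \<Longrightarrow> (x, t) \<noteq> (x1, t1) \<Longrightarrow> \<psi> (x, t) < \<psi> (x1, t1)"
    and neg: "ereal (dtime \<psi> (x1, t1)) + usc_env (Gu B F) (GDom B) (x1, t1, grad \<psi> (x1, t1), hess \<psi> (x1, t1)) < 0"
    and c: "\<And>x t. dist x x1 \<le> R \<Longrightarrow> \<bar>t - t1\<bar> \<le> R \<Longrightarrow> grad \<psi> (x, t) v* sigma B x = 0 \<Longrightarrow>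
      transpose (sigma B x) ** hess \<psi> (x, t) ** sigma B x = 0"
    and ne: "grad \<psi> (x1, t1) \<noteq> 0"
  shows False
proof -
  have C: "Ck k \<psi>" for k using sm by (rule smooth_fun_imp_Ck)
  have cont: "continuous_on UNIV \<psi>" using C[of 0] by simp
  define v where "v = grad \<psi> (x1, t1)"
  have "continuous_on UNIV (\<lambda>z. norm (grad \<psi> z))" by (intro continuous_on_norm continuous_jets C)
  then obtain R1 where R1: "0 < R1" "\<And>z. dist z (x1, t1) < R1 \<Longrightarrow> 0 < norm (grad \<psi> z)"
    using continuous_near_greater[of "\<lambda>z. norm (grad \<psi> z)" 0 "(x1, t1)"] ne by auto
  define R' where "R' = min R (R1 / 3)"
  have R': "0 < R'" "R' \<le> R" using R R1 by (auto simp: R'_def)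
  have gne: "grad \<psi> (x, t) \<noteq> 0" if "dist x x1 \<le> R'" "\<bar>t - t1\<bar> \<le> R'" for x t
  proof -
    have "dist (x, t) (x1, t1) \<le> dist x x1 + dist t t1"
      unfolding dist_Pair_Pair by (rule sqrt_sum_squares_le_sum) auto
    also have "\<dots> \<le> R1 / 3 + R1 / 3" using that by (intro add_mono) (auto simp: R'_def dist_real_def)
    also have "\<dots> < R1" using R1 by simp
    finally show ?thesis using R1(2) by auto
  qed
  have der: "DERIV (\<lambda>s. \<psi> ((x1, t1) + s *\<^sub>R (v, 0))) 0 :> v \<bullet> v"
    using Ck2_line(1)[OF C, of "(x1, t1)" "(v, 0)" 0] by (simp add: D1_grad_dtime[OF C] v_def)
  have vpos: "0 < v \<bullet> v" using ne by (simp add: v_def)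
  have small: "\<exists>s>0. s < e \<and> s * norm v \<le> r" if "0 < r" "0 < e" for r e :: real
  proof -
    define s where "s = min (e / 2) (r / (norm v + 1))"
    have n: "0 < norm v + 1" by (simp add: add_nonneg_pos)
    then have s: "0 < s" "s < e" using that by (auto simp: s_def)
    have "s * norm v \<le> r / (norm v + 1) * (norm v + 1)"
      using s n by (intro mult_mono) (auto simp: s_def)
    then show ?thesis using n s by auto
  qed
  show False
  proof (rule flow_local_test[OF flow op sm t1 nin R'(1)])
    fix r :: real assume r: "0 < r"
    obtain e where e: "0 < e" "\<And>h. 0 < h \<Longrightarrow> h < e \<Longrightarrow> \<psi> ((x1, t1) + (0 - h) *\<^sub>R (v, 0)) < \<psi> (x1, t1)"
      using DERIV_pos_inc_left[OF der vpos] by auto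
    obtain s where "0 < s" "s < e" "s * norm v \<le> r" using small[OF r e(1)] by blast
    then show "\<exists>x\<in>cball x1 r. \<psi> (x, t1) < \<psi> (x1, t1)"
      by (intro bexI[of _ "x1 - s *\<^sub>R v"]) (use e(2)[of s] in \<open>auto simp: dist_norm\<close>)
  next
    fix r :: real assume r: "0 < r"
    obtain e where e: "0 < e" "\<And>h. 0 < h \<Longrightarrow> h < e \<Longrightarrow> \<psi> (x1, t1) < \<psi> ((x1, t1) + (0 + h) *\<^sub>R (v, 0))"
      using DERIV_pos_inc_right[OF der vpos] by auto
    obtain s where s: "0 < s" "s < e" "s * norm v \<le> r" using small[OF r e(1)] by blast
    let ?x = "x1 + s *\<^sub>R v"
    have "\<psi> (x1, t1) < \<psi> (?x, t1)" using e(2)[of s] s by simp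
    moreover have "continuous_on UNIV (\<lambda>t. \<psi> (?x, t))"
      by (intro continuous_on_compose2[OF cont] continuous_intros) auto
    ultimately obtain h where h: "0 < h" "\<And>t. dist t t1 < h \<Longrightarrow> \<psi> (x1, t1) < \<psi> (?x, t)"
      using continuous_near_greater by blast
    then show "\<exists>x\<in>cball x1 r. \<exists>h>0. \<forall>t\<in>{t1-h..t1}. \<psi> (x1, t1) \<le> \<psi> (x, t)"
      by (intro bexI[of _ ?x] exI[of _ "h/2"]) (use s in \<open>auto simp: dist_norm dist_real_def intro!: less_imp_le h(2)\<close>)
  qed (use strict neg c gne R' in \<open>auto\<close>)
qed

section \<open>Doubling of variables\<close>

text \<open>With the group law \<open>x \<circ> y = (x\<^sub>h + y\<^sub>h, x\<^sub>v + y\<^sub>v + bil B x\<^sub>h y\<^sub>h)\<close>, \<open>gquot B y x\<close> is \<open>y\<inverse> \<circ> x\<close> and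
  \<open>rtrans B a x\<close> is \<open>x \<circ> a\<inverse>\<close>. The horizontal lines \<open>x \<circ> (s c, 0)\<close> are the straight lines
  \<open>x + s \<sigma>(x) c\<close>, so all horizontal derivatives below are computed along straight lines.\<close>

definition gquot :: "('k::finite \<Rightarrow> real^'m::finite^'m) \<Rightarrow> real^('m + 'k) \<Rightarrow> real^('m + 'k) \<Rightarrow> real^('m + 'k)" where
  "gquot B y x = pt (hor x - hor y) (ver x - ver y - bil B (hor y) (hor x))"

definition rtrans :: "('k::finite \<Rightarrow> real^'m::finite^'m) \<Rightarrow> real^('m + 'k) \<Rightarrow> real^('m + 'k) \<Rightarrow> real^('m + 'k)" where
  "rtrans B a x = x - pt 0 (bil B (hor x) (hor a)) - a"

text \<open>The fourth power of a homogeneous gauge: a polynomial, quartic in the horizontal part so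
  that its horizontal gradient and horizontal Hessian degenerate together.\<close>

definition hnorm :: "real^('m::finite + 'k::finite) \<Rightarrow> real" where
  "hnorm a = (hor a \<bullet> hor a)\<^sup>2 + ver a \<bullet> ver a"

lemma hnorm_nonneg: "0 \<le> hnorm a"
  by (simp add: hnorm_def)

lemma hnorm_eq_0: "hnorm a = 0 \<longleftrightarrow> a = 0"
proof
  assume "hnorm a = 0"
  then have "(hor a \<bullet> hor a)\<^sup>2 = 0" "ver a \<bullet> ver a = 0"
    unfolding hnorm_def by (simp_all add: add_nonneg_eq_0_iff)
  then have "hor a = hor 0" "ver a = ver 0" by (simp_all add: hor_def ver_def vec_eq_iff)
  then show "a = 0" by (rule hor_ver_eqI)
qed (simp add: hnorm_def hor_def ver_def inner_vec_def)

section \<open>Algebra of the group quotient and of right translation\<close>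

lemma bil_simps:
  "bil B (u + u') v = bil B u v + bil B u' v" "bil B (u - u') v = bil B u v - bil B u' v"
  "bil B u (v + v') = bil B u v + bil B u v'" "bil B u (v - v') = bil B u v - bil B u v'"
  "bil B (s *\<^sub>R u) v = s *\<^sub>R bil B u v" "bil B u (s *\<^sub>R v) = s *\<^sub>R bil B u v"
  "bil B 0 v = 0" "bil B u 0 = 0"
proof -
  interpret bounded_bilinear "bil B" by (rule bounded_bilinear_bil)
  show "bil B (u + u') v = bil B u v + bil B u' v" "bil B (u - u') v = bil B u v - bil B u' v"
    "bil B u (v + v') = bil B u v + bil B u v'" "bil B u (v - v') = bil B u v - bil B u v'"
    "bil B (s *\<^sub>R u) v = s *\<^sub>R bil B u v" "bil B u (s *\<^sub>R v) = s *\<^sub>R bil B u v"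
    "bil B 0 v = 0" "bil B u 0 = 0"
    by (simp_all add: add_left diff_left add_right diff_right scaleR_left scaleR_right zero_left zero_right)
qed

lemma hor_0 [simp]: "hor 0 = 0" and ver_0 [simp]: "ver 0 = 0"
  by (simp_all add: hor_def ver_def vec_eq_iff)

lemma gquot_eq_0:
  assumes "carnot_data B" "gquot B y x = 0" shows "x = y"
proof -
  have h: "hor x = hor y" using arg_cong[OF assms(2), of hor] by (simp add: gquot_def)
  moreover have "ver x = ver y"
    using arg_cong[OF assms(2), of ver] by (simp add: gquot_def h bil_self[OF assms(1)])
  ultimately show ?thesis by (rule hor_ver_eqI)
qed

lemma rtrans_gquot: "carnot_data B \<Longrightarrow> rtrans B (gquot B y x) x = y"
  by (rule hor_ver_eqI)
    (simp_all add: rtrans_def gquot_def bil_simps bil_self bil_skew[of B "hor x" "hor y"])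

text \<open>Substituting \<open>y = rtrans B a x\<close> freezes the penalty at
  \<open>hnorm a\<close>, which turns the doubled functional into a function of \<open>x\<close> and
  time alone.\<close>

lemma gquot_rtrans: "carnot_data B \<Longrightarrow> gquot B (rtrans B a x) x = a"
  by (rule hor_ver_eqI)
    (simp_all add: rtrans_def gquot_def bil_simps bil_self bil_skew[of B "hor x" "hor a"])

lemma gquot_rtrans_line:
  assumes "carnot_data B"
  shows "gquot B (rtrans B a (x + s *\<^sub>R (sigma B x *v hor a))) x = pt ((1 - s) *\<^sub>R hor a) (ver a)"
  by (rule hor_ver_eqI)
    (simp_all add: rtrans_def gquot_def bil_simps bil_self[OF assms] bil_skew[OF assms, of "hor x" "hor a"]
      sigma_mv algebra_simps)

text \<open>Skewness cancels the change of the vertical part. When the horizontal parts agree, a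
  horizontal move of \<open>y\<close> therefore changes \<open>hnorm\<close> of the quotient only by
  a term of order \<open>s ^ 4\<close>.\<close>

lemma gquot_line:
  assumes B: "carnot_data B" and h: "hor x = hor y"
  shows "gquot B (y + s *\<^sub>R (sigma B y *v c)) x = pt (- s *\<^sub>R c) (ver (gquot B y x))"
  by (rule hor_ver_eqI)
    (simp_all add: gquot_def bil_simps bil_self[OF B] bil_skew[OF B, of "hor y" c] sigma_mv h algebra_simps)

text \<open>For fixed \<open>y\<close>, the vertical part of the quotient as a linear function of
  \<open>u = x - y\<close>; this makes the smoothness of the penalty evident.\<close>

definition vquot :: "('k::finite \<Rightarrow> real^'m::finite^'m) \<Rightarrow> real^('m + 'k) \<Rightarrow> real^('m + 'k) \<Rightarrow> real^'k" where
  "vquot B y u = ver u - bil B (hor y) (hor u)"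

lemma gquot_vquot: "carnot_data B \<Longrightarrow> gquot B y x = pt (hor (x - y)) (vquot B y (x - y))"
  by (simp add: gquot_def vquot_def bil_simps bil_self)

section \<open>Linearity and continuity of the group operations\<close>

lemma bounded_linear_hor: "bounded_linear hor" and bounded_linear_ver: "bounded_linear ver"
  using linear_hor linear_ver linear_conv_bounded_linear by auto

lemma bounded_linear_vquot: "bounded_linear (vquot B y)"
  unfolding vquot_def
  by (intro bounded_linear_sub bounded_linear_ver
      bounded_linear_compose[OF bounded_bilinear.bounded_linear_right[OF bounded_bilinear_bil] bounded_linear_hor])

lemma bounded_linear_pt_0: "bounded_linear (pt 0 :: real^'k::finite \<Rightarrow> real^('m::finite + 'k))"
proof -
  have "linear (pt 0 :: real^'k \<Rightarrow> real^('m + 'k))"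
    by (rule linearI) (auto simp: pt_def vec_eq_iff split: sum.split)
  then show ?thesis by (simp add: linear_conv_bounded_linear)
qed

text \<open>The linear part of the affine map \<open>rtrans B a\<close>; second derivatives of a
  composition with that map need no first-order correction.\<close>

definition rtrans_lin :: "('k::finite \<Rightarrow> real^'m::finite^'m) \<Rightarrow> real^('m + 'k) \<Rightarrow> real^('m + 'k) \<Rightarrow> real^('m + 'k)" where
  "rtrans_lin B a u = u - pt 0 (bil B (hor u) (hor a))"

lemma bounded_linear_rtrans_lin: "bounded_linear (rtrans_lin B a)"
  unfolding rtrans_lin_def
  by (intro bounded_linear_sub bounded_linear_ident bounded_linear_compose[OF bounded_linear_pt_0]
      bounded_linear_compose[OF bounded_bilinear.bounded_linear_left[OF bounded_bilinear_bil] bounded_linear_hor])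

lemma continuous_rtrans_lin:
  assumes "continuous_on UNIV f" "continuous_on UNIV g"
  shows "continuous_on UNIV (\<lambda>z. rtrans_lin B (f z) (g z))"
  unfolding rtrans_lin_def
  by (intro continuous_on_diff assms bounded_linear.continuous_on[OF bounded_linear_pt_0]
      bounded_bilinear.continuous_on[OF bounded_bilinear_bil] bounded_linear.continuous_on[OF bounded_linear_hor])

lemma rtrans_eq: "rtrans B a x = rtrans_lin B a x - a"
  by (simp add: rtrans_def rtrans_lin_def)

lemma continuous_rtrans:
  assumes "continuous_on UNIV f" "continuous_on UNIV g"
  shows "continuous_on UNIV (\<lambda>z. rtrans B (f z) (g z))"
  unfolding rtrans_eq by (intro continuous_on_diff assms continuous_rtrans_lin)

lemma bounded_linear_pt_fst: "bounded_linear (\<lambda>u. pt u 0 :: real^('m::finite + 'k::finite))"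
proof -
  have "linear (\<lambda>u. pt u 0 :: real^('m + 'k))"
    by (rule linearI) (auto simp: pt_def vec_eq_iff split: sum.split)
  then show ?thesis by (simp add: linear_conv_bounded_linear)
qed

lemma pt_split: "pt u v = pt u 0 + pt 0 v"
  by (rule hor_ver_eqI) simp_all

lemma continuous_gquot:
  assumes f: "continuous_on UNIV f" and g: "continuous_on UNIV g"
  shows "continuous_on UNIV (\<lambda>z. gquot B (f z) (g z))"
proof -
  note h = bounded_linear.continuous_on[OF bounded_linear_hor] bounded_linear.continuous_on[OF bounded_linear_ver]
  have "continuous_on UNIV (\<lambda>z. pt (hor (g z) - hor (f z)) 0
      + pt 0 (ver (g z) - ver (f z) - bil B (hor (f z)) (hor (g z))))"
    by (intro continuous_on_add continuous_on_diff bounded_linear.continuous_on[OF bounded_linear_pt_0]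
        bounded_linear.continuous_on[OF bounded_linear_pt_fst]
        bounded_bilinear.continuous_on[OF bounded_bilinear_bil] h f g)
  then show ?thesis unfolding gquot_def by (simp only: pt_split[symmetric])
qed

lemma continuous_hnorm:
  assumes "continuous_on S f" shows "continuous_on S (\<lambda>z. hnorm (f z))"
  unfolding hnorm_def
  by (intro continuous_intros bounded_linear.continuous_on[OF bounded_linear_hor]
      bounded_linear.continuous_on[OF bounded_linear_ver] assms)

text \<open>On the compact set where \<open>f\<close> is nonnegative, \<open>g\<close> has a
  positive minimum, so a large multiple of \<open>g\<close> beats the maximum of \<open>f\<close>.
  Elsewhere subtracting the penalty does no harm.\<close>

lemma compact_penalty:
  fixes f g :: "'a::metric_space \<Rightarrow> real"
  assumes K: "compact K" and f: "continuous_on K f" and g: "continuous_on K g"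
    and g0: "\<And>z. z \<in> K \<Longrightarrow> 0 \<le> g z" and neg: "\<And>z. z \<in> K \<Longrightarrow> g z = 0 \<Longrightarrow> f z < 0"
  obtains C where "0 < C" "\<And>z. z \<in> K \<Longrightarrow> f z - C * g z < 0"
proof -
  define S where "S = K \<inter> f -` {0..}"
  have SK: "S \<subseteq> K" by (auto simp: S_def)
  have "closed S" unfolding S_def
    by (rule continuous_closed_preimage[OF f compact_imp_closed[OF K] closed_atLeast])
  then have S: "compact S" using K SK by (metis compact_Int_closed inf.absorb2)
  show ?thesis
  proof (cases "S = {}")
    case True
    have "f z - 1 * g z < 0" if "z \<in> K" for z
      using True that g0[OF that] by (auto simp: S_def not_le)
    then show ?thesis using that[of 1] by auto
  next
    case False
    obtain a where a: "a \<in> S" "\<And>z. z \<in> S \<Longrightarrow> g a \<le> g z"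
      using continuous_attains_inf[OF S False continuous_on_subset[OF g SK]] by blast
    obtain b where b: "b \<in> S" "\<And>z. z \<in> S \<Longrightarrow> f z \<le> f b"
      using continuous_attains_sup[OF S False continuous_on_subset[OF f SK]] by blast
    have ga: "0 < g a"
    proof (rule ccontr)
      assume "\<not> 0 < g a"
      then have "g a = 0" using g0[of a] a(1) SK by auto
      then show False using neg[of a] a(1) by (auto simp: S_def)
    qed
    have fb: "0 \<le> f b" using b(1) by (simp add: S_def)
    define C where "C = f b / g a + 1"
    have C: "0 < C" using ga fb by (simp add: C_def add_nonneg_pos)
    have "f z - C * g z < 0" if z: "z \<in> K" for z
    proof (cases "z \<in> S")
      case True
      have "f z \<le> f b" by (rule b(2)[OF True])
      also have "\<dots> < C * g a" using ga by (simp add: C_def field_simps)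
      also have "\<dots> \<le> C * g z" using a(2)[OF True] C by simp
      finally show ?thesis by simp
    next
      case False
      then have "f z < 0" using z by (simp add: S_def not_le)
      moreover have "0 \<le> C * g z" using C g0[OF z] by simp
      ultimately show ?thesis by simp
    qed
    then show ?thesis using that C by blast
  qed
qed

section \<open>Jets of perturbed and translated test functions\<close>

lemma D1_line_eq:
  assumes "Ck 2 f" "((\<lambda>s. f (z + s *\<^sub>R v)) has_real_derivative D) (at 0)"
  shows "frechet_derivative f (at z) v = D"
  using DERIV_unique[OF Ck2_line(1)[OF assms(1), of z v 0]] assms(2) by simp

lemma jets_diff_quartic:
  assumes C: "Ck 2 f"
  shows "dtime (\<lambda>z. f z - quartic z1 z) z1 = dtime f z1"
    and "grad (\<lambda>z. f z - quartic z1 z) z1 = grad f z1"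
    and "hess (\<lambda>z. f z - quartic z1 z) z1 = hess f z1"
proof -
  have Cq: "Ck 2 (\<lambda>z. - quartic z1 z)" by (intro Ck_minus Ck_quartic)
  have D1: "frechet_derivative (\<lambda>z. f z - quartic z1 z) (at z1) v = frechet_derivative f (at z1) v" for v
    using D1_add[OF C Cq, of z1 v] by (simp add: D1_minus[OF Ck_quartic] D1_quartic)
  have D2: "D2 (\<lambda>z. f z - quartic z1 z) z1 u v = D2 f z1 u v" for u v
    using D2_add[OF C Cq, of z1 u v] by (simp add: D2_minus[OF Ck_quartic] D2_quartic)
  show "dtime (\<lambda>z. f z - quartic z1 z) z1 = dtime f z1" "grad (\<lambda>z. f z - quartic z1 z) z1 = grad f z1"
    "hess (\<lambda>z. f z - quartic z1 z) z1 = hess f z1"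
    by (simp_all add: dtime_def grad_def hess_D2 D1 D2)
qed

lemma rtrans_jets:
  fixes B :: "'k::finite \<Rightarrow> real^'m::finite^'m" and P :: "(real^('m::finite + 'k::finite)) \<times> real \<Rightarrow> real"
  assumes C: "Ck 2 P"
  defines "\<psi> \<equiv> \<lambda>a (x, t). P (rtrans B a x, t)"
  shows "Ck k P \<Longrightarrow> Ck k (\<psi> a)"
    and "dtime (\<psi> a) (x, t) = dtime P (rtrans B a x, t)"
    and "grad (\<psi> a) (x, t) = (\<chi> i. rtrans_lin B a (axis i 1) \<bullet> grad P (rtrans B a x, t))"
    and "hess (\<psi> a) (x, t) = (\<chi> i j. rtrans_lin B a (axis i 1) \<bullet> (hess P (rtrans B a x, t) *v rtrans_lin B a (axis j 1)))"
proof -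
  define M where "M z = (rtrans_lin B a (fst z), snd z)" for z :: "(real^('m + 'k)) \<times> real"
  have M: "bounded_linear M" unfolding M_def
    by (intro bounded_linear_Pair bounded_linear_compose[OF bounded_linear_rtrans_lin bounded_linear_fst] bounded_linear_snd)
  have eq: "\<psi> a = (\<lambda>z. P (M z + (- a, 0)))"
    by (auto simp: fun_eq_iff \<psi>_def M_def rtrans_eq)
  show "Ck k P \<Longrightarrow> Ck k (\<psi> a)" unfolding eq by (rule Ck_affine_comp[OF M])
  have z: "M (x, t) + (- a, 0) = (rtrans B a x, t)" by (simp add: M_def rtrans_eq)
  have M0: "rtrans_lin B a 0 = 0" by (rule linear_simps(3)[OF bounded_linear_rtrans_lin])
  show "dtime (\<psi> a) (x, t) = dtime P (rtrans B a x, t)"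
    unfolding dtime_def[of "\<psi> a"] unfolding eq D1_affine[OF C M] z by (simp add: M_def M0 dtime_def)
  show "grad (\<psi> a) (x, t) = (\<chi> i. rtrans_lin B a (axis i 1) \<bullet> grad P (rtrans B a x, t))"
    unfolding grad_def[of "\<psi> a"] unfolding eq D1_affine[OF C M] z by (simp add: M_def D1_grad_dtime[OF C])
  show "hess (\<psi> a) (x, t) = (\<chi> i j. rtrans_lin B a (axis i 1) \<bullet> (hess P (rtrans B a x, t) *v rtrans_lin B a (axis j 1)))"
    unfolding hess_D2[of "\<psi> a"] unfolding eq D2_affine[OF C M] z by (simp add: M_def D2_hess[OF C])
qed

text \<open>The translated jets depend jointly continuously on \<open>a\<close>, \<open>x\<close>
  and \<open>t\<close> and reduce to those of \<open>P\<close> at \<open>a = 0\<close>, so the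
  strict inequality is uniform over small translations.\<close>

lemma negative_near_rtrans:
  fixes P :: "(real^('m::finite + 'k::finite)) \<times> real \<Rightarrow> real"
  assumes C: "Ck 2 P"
    and neg: "ereal (dtime P (x0, t0)) + usc_env g D (x0, t0, grad P (x0, t0), hess P (x0, t0)) < 0"
  obtains r where "0 < r" "\<And>a x t. norm a < r \<Longrightarrow> dist (x, t) (x0, t0) < r \<Longrightarrow>
    ereal (dtime (\<lambda>(x, t). P (rtrans B a x, t)) (x, t)) + usc_env g D (x, t,
      grad (\<lambda>(x, t). P (rtrans B a x, t)) (x, t), hess (\<lambda>(x, t). P (rtrans B a x, t)) (x, t)) < 0"
proof -
  obtain \<rho> where \<rho>: "0 < \<rho>" "\<And>\<tau> w. \<bar>\<tau> - dtime P (x0, t0)\<bar> < \<rho> \<Longrightarrow> dist w (x0, t0, grad P (x0, t0), hess P (x0, t0)) < \<rho>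
      \<Longrightarrow> ereal \<tau> + usc_env g D w < 0"
    using usc_env_less_imp[OF neg] by blast
  define y where "y w = (rtrans B (fst w) (fst (snd w)), snd (snd w))" for w :: "(real^('m+'k)) \<times> (real^('m+'k)) \<times> real"
  define J where "J w = (fst (snd w), snd (snd w),
     (\<chi> i. rtrans_lin B (fst w) (axis i 1) \<bullet> grad P (y w)) :: real^('m+'k),
     (\<chi> i j. rtrans_lin B (fst w) (axis i 1) \<bullet> (hess P (y w) *v rtrans_lin B (fst w) (axis j 1))) :: real^('m+'k)^('m+'k))" for w
  have cy: "continuous_on UNIV y" unfolding y_def
    by (intro continuous_on_Pair continuous_rtrans continuous_intros)
  have cg: "continuous_on UNIV (\<lambda>w. grad P (y w))"
    by (rule continuous_on_compose2[OF continuous_jets(2)[OF C] cy]) simp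
  have ch: "continuous_on UNIV (\<lambda>w. hess P (y w))"
    by (rule continuous_on_compose2[OF continuous_jets(3)[OF C] cy]) simp
  have ct: "continuous_on UNIV (\<lambda>w. dtime P (y w))"
    by (rule continuous_on_compose2[OF continuous_jets(1)[OF C] cy]) simp
  have cl: "continuous_on UNIV (\<lambda>w :: (real^('m+'k)) \<times> (real^('m+'k)) \<times> real. rtrans_lin B (fst w) u)" for u
    by (intro continuous_rtrans_lin continuous_intros)
  have cJ: "continuous_on UNIV J" unfolding J_def matrix_vector_mult_def
    by (intro continuous_on_Pair continuous_on_vec_lambda continuous_on_inner continuous_on_sum continuous_on_mult
        continuous_on_component cg ch cl continuous_on_fst continuous_on_snd continuous_on_id)
  have y0: "y (0, x0, t0) = (x0, t0)" and l0: "rtrans_lin B 0 u = u" for u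
    by (simp_all add: y_def rtrans_def rtrans_lin_def bil_simps linear_simps(3)[OF bounded_linear_pt_0])
  have J0: "J (0, x0, t0) = (x0, t0, grad P (x0, t0), hess P (x0, t0))"
    unfolding J_def y0 fst_conv snd_conv l0 matrix_vector_mult_basis
    by (simp add: inner_axis' column_def vec_lambda_eta)
  obtain r1 where r1: "0 < r1" "\<And>w. dist w (0, x0, t0) < r1 \<Longrightarrow> dist (J w) (J (0, x0, t0)) < \<rho>"
    using cJ \<rho>(1) unfolding continuous_on_iff by (metis UNIV_I)
  obtain r2 where r2: "0 < r2" "\<And>w. dist w (0, x0, t0) < r2 \<Longrightarrow> dist (dtime P (y w)) (dtime P (y (0, x0, t0))) < \<rho>"
    using ct \<rho>(1) unfolding continuous_on_iff by (metis UNIV_I)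
  define r where "r = min r1 r2 / 2"
  show ?thesis
  proof (rule that[of r])
    show "0 < r" using r1 r2 by (simp add: r_def)
    fix a :: "real^('m+'k)" and x t assume "norm a < r" and xt: "dist (x, t) (x0, t0) < r"
    moreover have "dist (a, x, t) (0, x0, t0) \<le> dist a 0 + dist (x, t) (x0, t0)"
      unfolding dist_Pair_Pair[of a] by (rule sqrt_sum_squares_le_sum) auto
    ultimately have d: "dist (a, x, t) (0, x0, t0) < min r1 r2" by (simp add: r_def)
    have 1: "\<bar>dtime (\<lambda>(x, t). P (rtrans B a x, t)) (x, t) - dtime P (x0, t0)\<bar> < \<rho>"
      using r2(2)[of "(a, x, t)"] d unfolding rtrans_jets(2)[OF C] y0 by (simp add: y_def dist_real_def)
    have "dist (J (a, x, t)) (x0, t0, grad P (x0, t0), hess P (x0, t0)) < \<rho>"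
      using r1(2)[of "(a, x, t)"] d unfolding J0 by simp
    then have 2: "dist (x, t, grad (\<lambda>(x, t). P (rtrans B a x, t)) (x, t), hess (\<lambda>(x, t). P (rtrans B a x, t)) (x, t))
        (x0, t0, grad P (x0, t0), hess P (x0, t0)) < \<rho>"
      unfolding rtrans_jets(3,4)[OF C] by (simp add: J_def y_def)
    show "ereal (dtime (\<lambda>(x, t). P (rtrans B a x, t)) (x, t)) + usc_env g D (x, t,
      grad (\<lambda>(x, t). P (rtrans B a x, t)) (x, t), hess (\<lambda>(x, t). P (rtrans B a x, t)) (x, t)) < 0"
      by (rule \<rho>(2)[OF 1 2])
  qed
qed

lemma inner_scaleR_self_square: "((s *\<^sub>R a) \<bullet> (s *\<^sub>R a))\<^sup>2 = s ^ 4 * (a \<bullet> a)\<^sup>2"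
  by (simp add: power2_eq_square power4_eq_xxxx mult_ac)

text \<open>Moving \<open>x\<close> along the horizontal line in direction \<open>a\<^sub>h\<close> moves \<open>x \<circ> a\<inverse>\<close> so that its quotient with
  the fixed \<open>x\<close> is \<open>((1 - s) a\<^sub>h, a\<^sub>v)\<close>; maximality in \<open>y\<close> then determines the derivative.\<close>

lemma frechet_rtrans_line:
  fixes B :: "'k::finite \<Rightarrow> real^'m::finite^'m" and P :: "(real^('m + 'k)) \<times> real \<Rightarrow> real"
  assumes B: "carnot_data B" and C: "Ck 2 P" and e: "0 < e"
    and mx: "\<And>y. dist y (rtrans B a x) < e \<Longrightarrow> P (y, t) - K * hnorm (gquot B y x) \<le> P (rtrans B a x, t) - K * hnorm a"
  shows "frechet_derivative (\<lambda>(x, t). P (rtrans B a x, t)) (at (x, t)) (sigma B x *v hor a, 0) = - 4 * K * (hor a \<bullet> hor a)\<^sup>2"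
proof -
  let ?\<psi> = "\<lambda>(x, t). P (rtrans B a x, t)" and ?w = "sigma B x *v hor a"
  let ?D = "frechet_derivative ?\<psi> (at (x, t)) (?w, 0)"
  have C\<psi>: "Ck 2 ?\<psi>" by (rule rtrans_jets(1)[OF C C])
  have d1: "((\<lambda>s. P (rtrans B a (x + s *\<^sub>R ?w), t)) has_real_derivative ?D) (at 0)"
    using Ck2_line(1)[OF C\<psi>, of "(x, t)" "(?w, 0)" 0] by simp
  \<comment> \<open>The doubled functional along this path, with \<open>x\<close> fixed in the
    penalty. It is maximal at \<open>s = 0\<close>, so its derivative there vanishes.\<close>
  define G where "G s = P (rtrans B a (x + s *\<^sub>R ?w), t) - K * ((1 - s) ^ 4 * (hor a \<bullet> hor a)\<^sup>2 + ver a \<bullet> ver a)" for s :: real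
  have dG: "(G has_real_derivative ?D + 4 * K * (hor a \<bullet> hor a)\<^sup>2) (at 0)"
    unfolding G_def by (auto intro!: derivative_eq_intros d1)
  have "continuous_on UNIV (\<lambda>s. rtrans B a (x + s *\<^sub>R ?w))"
    by (intro continuous_rtrans continuous_intros)
  then obtain d where d: "0 < d" "\<And>s. dist s 0 < d \<Longrightarrow> dist (rtrans B a (x + s *\<^sub>R ?w)) (rtrans B a (x + 0 *\<^sub>R ?w)) < e"
    using e unfolding continuous_on_iff by (metis UNIV_I)
  have G_le: "G s \<le> G 0" if "\<bar>0 - s\<bar> < d" for s
  proof -
    have "P (rtrans B a (x + s *\<^sub>R ?w), t) - K * hnorm (gquot B (rtrans B a (x + s *\<^sub>R ?w)) x) \<le> P (rtrans B a x, t) - K * hnorm a"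
      using d(2)[of s] that by (intro mx) (simp add: dist_real_def)
    then show ?thesis
      unfolding gquot_rtrans_line[OF B] hnorm_def hor_pt ver_pt inner_scaleR_self_square by (simp add: G_def)
  qed
  have "?D + 4 * K * (hor a \<bullet> hor a)\<^sup>2 = 0"
    by (rule DERIV_local_max[OF dG d(1)]) (use G_le in auto)
  then show ?thesis by simp
qed

text \<open>Along the horizontal line through \<open>y1\<close> the penalty varies only by a
  multiple of \<open>s ^ 4\<close>, so \<open>P\<close> satisfies the first- and second-order
  conditions of \<open>Ck2_max_line\<close>.\<close>

lemma horizontal_max:
  fixes B :: "'k::finite \<Rightarrow> real^'m::finite^'m" and P :: "(real^('m + 'k)) \<times> real \<Rightarrow> real"
  assumes B: "carnot_data B" and C: "Ck 2 P" and e: "0 < e" and h: "hor x = hor y1"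
    and mx: "\<And>y. dist y y1 < e \<Longrightarrow> P (y, t) - K * hnorm (gquot B y x) \<le> P (y1, t) - K * hnorm (gquot B y1 x)"
  shows "grad P (y1, t) v* sigma B y1 = 0"
    and "(sigma B y1 *v c) \<bullet> (hess P (y1, t) *v (sigma B y1 *v c)) \<le> 0"
proof -
  have *: "frechet_derivative P (at (y1, t)) (sigma B y1 *v c, 0) = 0 \<and> D2 P (y1, t) (sigma B y1 *v c, 0) (sigma B y1 *v c, 0) \<le> 0" for c
  proof -
    let ?w = "sigma B y1 *v c"
    define d where "d = e / (norm ?w + 1)"
    have n: "0 < norm ?w + 1" by (simp add: add_nonneg_pos)
    have d: "0 < d" using e n by (simp add: d_def)
    have le: "P ((y1, t) + s *\<^sub>R (?w, 0)) \<le> P (y1, t) + K * (c \<bullet> c)\<^sup>2 * s ^ 4" if s: "\<bar>s\<bar> < d" for s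
    proof -
      have "\<bar>s\<bar> * norm ?w \<le> \<bar>s\<bar> * (norm ?w + 1)" by (intro mult_left_mono) auto
      also have "\<dots> < d * (norm ?w + 1)" using s n by (intro mult_strict_right_mono) auto
      also have "\<dots> = e" using n by (simp add: d_def)
      finally have "dist (y1 + s *\<^sub>R ?w) y1 < e" by (simp add: dist_norm)
      from mx[OF this] have "P (y1 + s *\<^sub>R ?w, t) \<le> P (y1, t) + K * (hnorm (gquot B (y1 + s *\<^sub>R ?w) x) - hnorm (gquot B y1 x))"
        by (simp add: algebra_simps)
      also have "hor (gquot B y1 x) = 0" by (simp add: gquot_def h)
      then have "hnorm (gquot B (y1 + s *\<^sub>R ?w) x) - hnorm (gquot B y1 x) = (c \<bullet> c)\<^sup>2 * s ^ 4"
        unfolding gquot_line[OF B h] hnorm_def hor_pt ver_pt inner_scaleR_self_square by simp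
      finally show ?thesis by simp
    qed
    show ?thesis
      using Ck2_max_line[OF C d, of "(y1, t)" "(?w, 0)" "K * (c \<bullet> c)\<^sup>2"] le by blast
  qed
  have "(grad P (y1, t) v* sigma B y1) \<bullet> c = 0" for c
    using * Xdir[OF C] by metis
  then show "grad P (y1, t) v* sigma B y1 = 0" by (metis inner_eq_zero_iff)
  show "(sigma B y1 *v c) \<bullet> (hess P (y1, t) *v (sigma B y1 *v c)) \<le> 0"
    using *[of c] by (simp add: D2_hess[OF C])
qed

text \<open>The test function is built from the penalty centred at \<open>y1\<close>. Its horizontal
  gradient vanishes exactly where \<open>x\<close> and \<open>y1\<close> have the same horizontal
  part, and its horizontal Hessian vanishes there too. Thus (c) holds, and by (F1) and (F3) the
  negative time derivative alone yields (a) at the contact point.\<close>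

lemma vertical_contact_test:
  fixes B :: "'k::finite \<Rightarrow> real^'m::finite^'m" and P :: "(real^('m + 'k)) \<times> real \<Rightarrow> real"
  assumes B: "carnot_data B" and F1: "F1 F" and F3: "F3 F"
    and flow: "gen_superflow B F T Om" and op: "open (spacetime_set T Om)"
    and sm: "smooth_fun P" and t1: "0 < t1" "t1 < T" and nin: "x1 \<notin> Om t1" and e: "0 < e" and K: "0 < K"
    and h: "hor x1 = hor y1"
    and mx: "\<And>x t. dist x x1 \<le> e \<Longrightarrow> \<bar>t - t1\<bar> \<le> e \<Longrightarrow> x \<notin> Om t \<Longrightarrow>
        P (y1, t) - K * hnorm (gquot B y1 x) \<le> P (y1, t1) - K * hnorm (gquot B y1 x1)"
    and dt: "dtime P (y1, t1) < 0"
  shows False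
proof -
  have C: "Ck k P" for k using sm by (rule smooth_fun_imp_Ck)
  define W where "W = vquot B y1"
  have W: "bounded_linear W" unfolding W_def by (rule bounded_linear_vquot)
  interpret W: bounded_linear W by (rule W)
  define v1 where "v1 = W (x1 - y1)"
  define h4 where "h4 z = (hor (fst z - y1) \<bullet> hor (fst z - y1))\<^sup>2" for z :: "(real^('m + 'k)) \<times> real"
  define w2 where "w2 z = W (fst z - y1) \<bullet> W (fst z - y1)" for z :: "(real^('m + 'k)) \<times> real"
  define v2 where "v2 z = W (fst z - x1) \<bullet> W (fst z - x1)" for z :: "(real^('m + 'k)) \<times> real"
  \<comment> \<open>The terms added to the penalty make the contact strict; the one in the vertical variable is centred
    at \<open>x1\<close>, which does not matter for \<open>X\<psi>\<close> and \<open>X\<^sup>2\<psi>\<close> where the horizontal part vanishes.\<close>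
  define \<psi> where "\<psi> z = P (y1, snd z) - (snd z - t1)\<^sup>2 - (K + 1) * h4 z - K * w2 z - v2 z" for z
  have Cy: "Ck k (\<lambda>z :: (real^('m + 'k)) \<times> real. P (y1, snd z))" for k
    using Ck_affine_comp[where M = "\<lambda>z :: (real^('m + 'k)) \<times> real. (0, snd z)" and c = "(y1, 0)", OF _ C]
    by (simp add: bounded_linear_Pair bounded_linear_zero bounded_linear_snd)
  have Ct: "Ck k (\<lambda>z :: (real^('m + 'k)) \<times> real. (snd z - t1)\<^sup>2)" for k
    by (intro Ck_power Ck_diff Ck_linear bounded_linear_snd Ck_const)
  have bi: "bounded_bilinear (\<lambda>u v. f (fst u) \<bullet> f (fst v))" if "bounded_linear f" for f :: "real^('m + 'k) \<Rightarrow> 'z::real_inner"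
    using bounded_bilinear.comp[OF bounded_bilinear_inner bounded_linear_compose[OF that bounded_linear_fst]
        bounded_linear_compose[OF that bounded_linear_fst]] by blast
  have Ch: "Ck k h4" for k unfolding h4_def
    using Ck_power[OF Ck_bilinear[OF bi[OF bounded_linear_hor], where ?z0.0 = "(y1, 0)"]] by simp
  have Cw: "Ck k w2" for k unfolding w2_def
    using Ck_bilinear[OF bi[OF W], where ?z0.0 = "(y1, 0)"] by simp
  have Cv: "Ck k v2" for k unfolding v2_def
    using Ck_bilinear[OF bi[OF W], where ?z0.0 = "(x1, 0)"] by simp
  have C\<psi>: "Ck k \<psi>" for k unfolding \<psi>_def
    by (intro Ck_diff Ck_mult Ck_const Cy Ct Ch Cw Cv)
  have sm\<psi>: "smooth_fun \<psi>" using C\<psi> by (simp add: smooth_fun_def)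
  have Wh: "W (x1 - y1) = v1" and hx: "hor (x1 - y1) = 0" by (simp_all add: v1_def h)
  have hn: "hnorm (gquot B y1 x) = h4 (x, t) + w2 (x, t)" for x t
    by (simp add: hnorm_def gquot_vquot[OF B] h4_def w2_def W_def)
  have h40: "h4 (x1, t) = 0" and v20: "v2 (x1, t) = 0" and w20: "w2 (x1, t) = v1 \<bullet> v1" for t
    using hx Wh by (simp_all add: h4_def v2_def w2_def W.zero)
  have \<psi>1: "\<psi> (x1, t) = P (y1, t) - (t - t1)\<^sup>2 - K * (v1 \<bullet> v1)" for t
    by (simp add: \<psi>_def h40 v20 w20)
  have h4_nn: "0 \<le> h4 z" and v2_nn: "0 \<le> v2 z" and w2_nn: "0 \<le> w2 z" for z
    by (simp_all add: h4_def v2_def w2_def)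
  have hW0: "x = y" if "hor (x - y) = 0" "W (x - y) = 0" for x y
  proof (rule hor_ver_eqI)
    show "hor x = hor y" using that(1) by simp
    then show "ver x = ver y" using that(2) by (simp add: W_def vquot_def bil_simps)
  qed
  have strict: "\<psi> (x, t) < \<psi> (x1, t1)" if "dist x x1 \<le> e" "\<bar>t - t1\<bar> \<le> e" "x \<notin> Om t" "(x, t) \<noteq> (x1, t1)" for x t
  proof -
    have "P (y1, t) - K * h4 (x, t) - K * w2 (x, t) \<le> \<psi> (x1, t1)"
      using mx[OF that(1-3)] unfolding \<psi>1 hn[of x t] hn[of x1 t1] h40 w20
      by (simp add: algebra_simps)
    moreover have "0 < (t - t1)\<^sup>2 + h4 (x, t) + v2 (x, t)"
    proof (rule ccontr)
      assume "\<not> ?thesis"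
      then have "(t - t1)\<^sup>2 = 0" "h4 (x, t) = 0" "v2 (x, t) = 0"
        using h4_nn[of "(x, t)"] v2_nn[of "(x, t)"] zero_le_power2[of "t - t1"] by linarith+
      then have "t = t1" "hor (x - x1) = 0" "W (x - x1) = 0" using h by (simp_all add: h4_def v2_def)
      then show False using hW0 that(4) by blast
    qed
    ultimately show ?thesis by (simp add: \<psi>_def algebra_simps)
  qed
  have Wsig: "W (sigma B x *v c) = bil B (hor (x - y1)) c" for x c
    by (simp add: W_def vquot_def sigma_mv bil_simps)
  have line: "\<psi> ((x, t) + s *\<^sub>R (u, 0)) = P (y1, t) - (t - t1)\<^sup>2
      - (K + 1) * (((hor (x - y1) + s *\<^sub>R hor u) \<bullet> (hor (x - y1) + s *\<^sub>R hor u))\<^sup>2)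
      - K * ((W (x - y1) + s *\<^sub>R W u) \<bullet> (W (x - y1) + s *\<^sub>R W u))
      - (W (x - x1) + s *\<^sub>R W u) \<bullet> (W (x - x1) + s *\<^sub>R W u)" for x t s u
  proof -
    have e: "W (x + s *\<^sub>R u - y) = W (x - y) + s *\<^sub>R W u" "hor (x + s *\<^sub>R u - y) = hor (x - y) + s *\<^sub>R hor u" for y
      by (simp_all add: W.add W.diff W.scaleR)
    show ?thesis
      by (simp add: \<psi>_def h4_def w2_def v2_def e del: hor_simps(2))
  qed
  \<comment> \<open>In the direction given by \<open>a = hor (x - y1)\<close> the vertical terms
    stay constant, since \<open>bil B a a = 0\<close>. Only the quartic term
    \<open>(1 + s) ^ 4\<close> moves, with nonzero slope.\<close>
  have X_hor: "hor (x - y1) = 0" if "grad \<psi> (x, t) v* sigma B x = 0" for x t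
  proof (rule ccontr)
    define a where "a = hor (x - y1)"
    assume "hor (x - y1) \<noteq> 0"
    then have a: "0 < (a \<bullet> a)\<^sup>2" by (simp add: a_def)
    have "W (sigma B x *v a) = 0" unfolding Wsig a_def[symmetric] by (rule bil_self[OF B])
    moreover have "hor (sigma B x *v a) = a" by (simp add: sigma_mv)
    moreover have "a + s *\<^sub>R a = (1 + s) *\<^sub>R a" for s by (simp add: algebra_simps)
    ultimately have l: "\<psi> ((x, t) + s *\<^sub>R (sigma B x *v a, 0)) = P (y1, t) - (t - t1)\<^sup>2
      - (K + 1) * ((1 + s) ^ 4 * (a \<bullet> a)\<^sup>2) - K * (W (x - y1) \<bullet> W (x - y1)) - W (x - x1) \<bullet> W (x - x1)" for s
      unfolding line a_def[symmetric] by (simp add: inner_scaleR_self_square del: inner_scaleR_left inner_scaleR_right)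
    have "frechet_derivative \<psi> (at (x, t)) (sigma B x *v a, 0) = - 4 * (K + 1) * (a \<bullet> a)\<^sup>2"
      by (rule D1_line_eq[OF C\<psi>], unfold l) (auto intro!: derivative_eq_intros simp: algebra_simps)
    then have "- 4 * (K + 1) * (a \<bullet> a)\<^sup>2 = 0" using that by (simp add: Xdir[OF C\<psi>])
    then show False using a K by simp
  qed
  have hor_X: "grad \<psi> (x, t) v* sigma B x = 0 \<and> transpose (sigma B x) ** hess \<psi> (x, t) ** sigma B x = 0"
    if h0: "hor (x - y1) = 0" for x t
  proof -
    have *: "frechet_derivative \<psi> (at (x, t)) (sigma B x *v c, 0) = 0 \<and> D2 \<psi> (x, t) (sigma B x *v c, 0) (sigma B x *v c, 0) = 0" for c
    proof -
      let ?v = "(sigma B x *v c, 0) :: (real^('m + 'k)) \<times> real"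
      have "W (sigma B x *v c) = 0" unfolding Wsig h0 by (simp add: bil_simps)
      moreover have "hor (sigma B x *v c) = c" by (simp add: sigma_mv)
      ultimately have l: "\<psi> ((x, t) + s *\<^sub>R ?v) = P (y1, t) - (t - t1)\<^sup>2
        - (K + 1) * (s ^ 4 * (c \<bullet> c)\<^sup>2) - K * (W (x - y1) \<bullet> W (x - y1)) - W (x - x1) \<bullet> W (x - x1)" for s
        unfolding line h0 by (simp add: inner_scaleR_self_square del: inner_scaleR_left inner_scaleR_right)
      define k4 where "k4 = (K + 1) * (c \<bullet> c)\<^sup>2"
      have l0: "\<psi> ((x, t) + s *\<^sub>R ?v) = \<psi> (x, t) - k4 * s ^ 4" for s
        using l[of s] l[of 0] by (simp add: k4_def)
      have 1: "frechet_derivative \<psi> (at (x, t)) ?v = 0" "D2 \<psi> (x, t) ?v ?v \<le> 0"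
        using Ck2_max_line[OF C\<psi> zero_less_one, of "(x, t)" ?v "- k4"] l0 by simp_all
      \<comment> \<open>\<open>l0\<close> is an equality, so the bound applies to
        \<open>- \<psi>\<close> as well and the second derivative has both signs.\<close>
      have 2: "D2 (\<lambda>z. - \<psi> z) (x, t) ?v ?v \<le> 0"
        using Ck2_max_line(2)[OF Ck_minus[OF C\<psi>] zero_less_one, of "(x, t)" ?v k4] l0 by simp
      show ?thesis using 1 2 unfolding D2_minus[OF C\<psi>] by simp
    qed
    have "(grad \<psi> (x, t) v* sigma B x) \<bullet> c = 0" for c using * Xdir[OF C\<psi>] by metis
    then have 1: "grad \<psi> (x, t) v* sigma B x = 0" by (metis inner_eq_zero_iff)
    have "transpose (sigma B x) ** hess \<psi> (x, t) ** sigma B x = 0"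
      by (rule symm_quadratic_zero[OF symm_sandwich[OF hess_symm[OF C\<psi>]]])
        (use * X2dir[OF C\<psi>] in metis)
    with 1 show ?thesis by simp
  qed
  have cnd: "transpose (sigma B x) ** hess \<psi> (x, t) ** sigma B x = 0" if "grad \<psi> (x, t) v* sigma B x = 0" for x t
    using hor_X[OF X_hor[OF that]] by simp
  have dt\<psi>: "dtime \<psi> (x1, t1) = dtime P (y1, t1)"
  proof -
    have "((\<lambda>s. P (y1, t1 + s)) has_real_derivative dtime P (y1, t1)) (at 0)"
      using Ck2_line(1)[OF C, of "(y1, t1)" "(0, 1)" 0] by (simp add: dtime_def)
    then have "((\<lambda>s. P (y1, t1 + s) - s\<^sup>2 - K * (v1 \<bullet> v1)) has_real_derivative dtime P (y1, t1)) (at 0)"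
      by (auto intro!: derivative_eq_intros)
    then show ?thesis
      unfolding dtime_def[of \<psi>] by (intro D1_line_eq[OF C\<psi>]) (simp add: \<psi>1)
  qed
  have "usc_env (Gu B F) (GDom B) (x1, t1, grad \<psi> (x1, t1), hess \<psi> (x1, t1)) \<le> 0"
    using hor_X[OF hx, of t1] by (intro Gu_usc_nonpos[OF F1 F3 t1(1)]) simp_all
  then have neg: "ereal (dtime \<psi> (x1, t1)) + usc_env (Gu B F) (GDom B) (x1, t1, grad \<psi> (x1, t1), hess \<psi> (x1, t1)) < 0"
    using dt unfolding dt\<psi>
    by (cases "usc_env (Gu B F) (GDom B) (x1, t1, grad \<psi> (x1, t1), hess \<psi> (x1, t1))") auto
  \<comment> \<open>Where the horizontal gradient vanishes, the direction
    \<open>pt 0 (W (x - y1))\<close> can still detect a nonzero full gradient.\<close>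
  have vert: "frechet_derivative \<psi> (at (x, t)) (pt 0 (W (x - y1)), 0) =
      - 2 * K * (W (x - y1) \<bullet> W (x - y1)) - 2 * (W (x - x1) \<bullet> W (x - y1))" if h0: "hor (x - y1) = 0" for x t
  proof -
    define w where "w = W (x - y1)"
    have "W (pt 0 w) = w" by (simp add: W_def vquot_def bil_simps)
    then have l: "\<psi> ((x, t) + s *\<^sub>R (pt 0 w, 0)) = P (y1, t) - (t - t1)\<^sup>2
      - K * ((w + s *\<^sub>R w) \<bullet> (w + s *\<^sub>R w)) - (W (x - x1) + s *\<^sub>R w) \<bullet> (W (x - x1) + s *\<^sub>R w)" for s
      unfolding line h0 w_def[symmetric] by simp
    show ?thesis unfolding w_def[symmetric]
      by (rule D1_line_eq[OF C\<psi>], unfold l) (auto intro!: derivative_eq_intros simp: algebra_simps inner_commute)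
  qed
  show False
  proof (cases "v1 = 0")
    \<comment> \<open>The vertical derivative at \<open>x1\<close> is
      \<open>- 2 * K * (v1 \<bullet> v1)\<close>, so the full gradient is nonzero although its
      horizontal part vanishes.\<close>
    case False
    have "grad \<psi> (x1, t1) \<noteq> 0"
    proof
      assume "grad \<psi> (x1, t1) = 0"
      then have "K * (v1 \<bullet> v1) = 0"
        using vert[OF hx, of t1] by (simp add: D1_grad_dtime[OF C\<psi>] Wh W.zero)
      then show False using K False by simp
    qed
    then show False
      using flow_local_test_regular[OF flow op sm\<psi> t1 nin e strict neg cnd] by blast
  next
    \<comment> \<open>The contact is at \<open>y1\<close> itself, a critical point in space. Every
      nearby point is lower at time \<open>t1\<close>, and the decrease in time keeps the value at
      \<open>x1\<close> high shortly before \<open>t1\<close>; this supplies \<open>lo\<close> and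
      \<open>hi\<close>.\<close>
    case True
    then have x1: "x1 = y1" using hW0[OF hx] Wh by simp
    have "((\<lambda>s. \<psi> ((x1, t1) + s *\<^sub>R (0, 1))) has_real_derivative dtime \<psi> (x1, t1)) (at 0)"
      using Ck2_line(1)[OF C\<psi>, of "(x1, t1)" "(0, 1)" 0] by (simp add: dtime_def)
    from DERIV_neg_dec_left[OF this] dt dt\<psi> obtain d where
      d: "0 < d" "\<And>s. 0 < s \<Longrightarrow> s < d \<Longrightarrow> \<psi> (x1, t1) < \<psi> (x1, t1 - s)" by auto
    define R where "R = min e (d / 2)"
    have R: "0 < R" "R \<le> e" "R < d" using d e by (auto simp: R_def)
    have dec: "\<psi> (x1, t1) \<le> \<psi> (x1, t)" if "t \<in> {t1 - R..t1}" for t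
      using d(2)[of "t1 - t"] that R by (cases "t = t1") auto
    show False
    proof (rule flow_local_test[OF flow op sm\<psi> t1 nin R(1) strict neg cnd])
      fix r :: real assume r: "0 < r"
      let ?x = "x1 + axis undefined r"
      have ne: "?x \<noteq> x1" using r by (simp add: axis_eq_0_iff)
      then have "hor (?x - y1) \<noteq> 0 \<or> W (?x - y1) \<noteq> 0" using hW0[of ?x y1] x1 by metis
      then have "0 < h4 (?x, t1) \<or> 0 < w2 (?x, t1)"
        unfolding h4_def w2_def fst_conv by (metis inner_gt_zero_iff zero_less_power)
      then have "0 < (K + 1) * h4 (?x, t1) + K * w2 (?x, t1)"
      proof (elim disjE)
        assume "0 < h4 (?x, t1)"
        then show ?thesis using w2_nn[of "(?x, t1)"] K by (intro add_pos_nonneg mult_pos_pos mult_nonneg_nonneg) auto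
      next
        assume "0 < w2 (?x, t1)"
        then show ?thesis using h4_nn[of "(?x, t1)"] K by (intro add_nonneg_pos mult_pos_pos mult_nonneg_nonneg) auto
      qed
      then have "\<psi> (?x, t1) < \<psi> (x1, t1)"
        using v2_nn[of "(?x, t1)"] unfolding \<psi>1 by (simp add: \<psi>_def True)
      then show "\<exists>x\<in>cball x1 r. \<psi> (x, t1) < \<psi> (x1, t1)"
        using r by (intro bexI[of _ ?x]) (auto simp: dist_norm norm_eq_sqrt_inner inner_axis_axis)
    next
      fix r :: real assume r: "0 < r"
      show "\<exists>x\<in>cball x1 r. \<exists>h>0. \<forall>t\<in>{t1-h..t1}. \<psi> (x1, t1) \<le> \<psi> (x, t)"
        using r R dec by (intro bexI[of _ x1] exI[of _ R]) auto
    next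
      \<comment> \<open>A critical point first has the horizontal part of \<open>y1\<close>; the
        derivative in the vertical direction then removes the vertical difference.\<close>
      fix x t assume g0: "grad \<psi> (x, t) = 0"
      then have h0: "hor (x - y1) = 0" by (intro X_hor[of x t]) simp
      have "frechet_derivative \<psi> (at (x, t)) (pt 0 (W (x - y1)), 0) = 0"
        by (simp add: D1_grad_dtime[OF C\<psi>] g0)
      then have "- 2 * K * (W (x - y1) \<bullet> W (x - y1)) - 2 * (W (x - y1) \<bullet> W (x - y1)) = 0"
        unfolding vert[OF h0, of t] x1 .
      then have "(K + 1) * (W (x - y1) \<bullet> W (x - y1)) = 0" by algebra
      then have "W (x - y1) = 0" using K by simp
      then show "x = x1 \<and> (\<forall>s\<in>{t1-R..t1}. \<psi> (x1, t1) \<le> \<psi> (x1, s))"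
        using hW0[OF h0] dec x1 by blast
    qed (use R in auto)
  qed
qed

text \<open>A large penalty confines the maximum point to a region where the strict inequality for
  \<open>P\<close> survives translation by \<open>a\<close>. Whether \<open>hor a\<close> vanishes
  decides between the penalty and the translate of \<open>P\<close> as the test function.\<close>

lemma doubling_contradiction:
  fixes B :: "'k::finite \<Rightarrow> real^'m::finite^'m" and P :: "(real^('m + 'k)) \<times> real \<Rightarrow> real"
  assumes B: "carnot_data B" and F1: "F1 F" and F2: "F2 F" and F3: "F3 F"
    and flow: "gen_superflow B F T Om" and op: "open (spacetime_set T Om)"
    and sm: "smooth_fun P" and nin: "x0 \<notin> Om t0" and d: "0 < d" "d < t0" "d < T - t0"
    and strict: "\<And>x t. dist (x, t) (x0, t0) \<le> d \<Longrightarrow> x \<notin> Om t \<Longrightarrow> (x, t) \<noteq> (x0, t0) \<Longrightarrow> P (x, t) < P (x0, t0)"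
    and neg: "ereal (dtime P (x0, t0)) + usc_env (Gu B F) (GDom B) (x0, t0, grad P (x0, t0), hess P (x0, t0)) < 0"
  shows False
proof -
  have C: "Ck k P" for k using sm by (rule smooth_fun_imp_Ck)
  have cont: "continuous_on UNIV P" using C[of 0] by simp
  obtain r where r: "0 < r" and negr: "\<And>a x t. norm a < r \<Longrightarrow> dist (x, t) (x0, t0) < r \<Longrightarrow>
    ereal (dtime (\<lambda>(x, t). P (rtrans B a x, t)) (x, t)) + usc_env (Gu B F) (GDom B) (x, t,
      grad (\<lambda>(x, t). P (rtrans B a x, t)) (x, t), hess (\<lambda>(x, t). P (rtrans B a x, t)) (x, t)) < 0"
    using negative_near_rtrans[OF C neg] by blast
  \<comment> \<open>Halving allows the space and time distances, each below \<open>r2\<close>, to be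
    added while staying below both \<open>r\<close> and \<open>d\<close>.\<close>
  define r2 where "r2 = min r d / 2"
  have r2: "0 < r2" "2 * r2 \<le> r" "2 * r2 \<le> d" using r d by (auto simp: r2_def)
  define q where "q w = gquot B (snd w) (fst (fst w))" for w :: "((real^('m + 'k)) \<times> real) \<times> (real^('m + 'k))"
  define f where "f w = P (snd w, snd (fst w)) - P (x0, t0)" for w :: "((real^('m + 'k)) \<times> real) \<times> (real^('m + 'k))"
  define g where "g w = hnorm (q w)" for w
  have cq: "continuous_on UNIV q" unfolding q_def by (intro continuous_gquot continuous_intros)
  have cg: "continuous_on S g" for S unfolding g_def
    by (intro continuous_hnorm continuous_on_subset[OF cq]) auto
  have cf: "continuous_on S f" for S unfolding f_def
    by (intro continuous_intros continuous_on_compose2[OF cont]) auto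
  define K where "K = (cball (x0, t0) d - spacetime_set T Om) \<times> cball x0 d"
  define U where "U = {w. dist (fst w) (x0, t0) < r2 \<and> dist (snd w) x0 < r2 \<and> norm (q w) < r2}"
  have "open U" unfolding U_def
    by (intro open_Collect_conj open_Collect_less continuous_intros cq)
  moreover have K: "compact K" unfolding K_def by (intro compact_Times compact_diff compact_cball op)
  ultimately have KU: "compact (K - U)" by (intro compact_diff)
  have timeT: "0 < t \<and> t < T" if "dist (x, t) (x0, t0) \<le> d" for x t
    using that dist_snd_le[of "(x, t)" "(x0, t0)"] d by (auto simp: dist_real_def)
  have inK: "((x, t), y) \<in> K \<longleftrightarrow> dist (x, t) (x0, t0) \<le> d \<and> x \<notin> Om t \<and> dist y x0 \<le> d" for x t y
    using timeT[of x t] by (auto simp: K_def dist_commute)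
  \<comment> \<open>A vanishing penalty means \<open>x = y\<close>, and then \<open>strict\<close>
    makes \<open>f\<close> negative unless \<open>(x, t) = (x0, t0)\<close>, a configuration lying
    in \<open>U\<close>.\<close>
  obtain c where c: "0 < c" "\<And>w. w \<in> K - U \<Longrightarrow> f w - c * g w < 0"
  proof (rule compact_penalty[OF KU cf cg])
    show "0 \<le> g w" for w by (simp add: g_def hnorm_nonneg)
    fix w assume w: "w \<in> K - U" and g0: "g w = 0"
    obtain x t y where xty: "w = ((x, t), y)" by (cases w, cases "fst w") auto
    have q0: "q w = 0" using g0 by (simp add: g_def hnorm_eq_0)
    then have xy: "x = y" using gquot_eq_0[OF B, of y x] by (simp add: q_def xty)
    have "(x, t) \<noteq> (x0, t0)"
    proof
      assume "(x, t) = (x0, t0)"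
      then have "w \<in> U" using r2(1) q0 xy by (auto simp: U_def xty)
      with w show False by blast
    qed
    then have "P (x, t) < P (x0, t0)" using w inK[of x t y] unfolding xty by (intro strict) auto
    then show "f w < 0" by (simp add: f_def xty xy)
  qed blast
  have K0: "((x0, t0), x0) \<in> K" using d nin by (simp add: inK)
  then have Kne: "K \<noteq> {}" by blast
  have "continuous_on K (\<lambda>w. f w - c * g w)" by (intro continuous_intros cf cg)
  then obtain w1 where w1: "w1 \<in> K" "\<forall>w\<in>K. f w - c * g w \<le> f w1 - c * g w1"
    using continuous_attains_sup[OF K Kne] by blast
  obtain x1 t1 y1 where w1_eq: "w1 = ((x1, t1), y1)" by (cases w1, cases "fst w1") auto
  define a where "a = gquot B y1 x1"
  have "gquot B x0 x0 = 0" by (simp add: gquot_vquot[OF B] vquot_def bil_simps pt_def vec_eq_iff split: sum.split)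
  then have "f ((x0, t0), x0) - c * g ((x0, t0), x0) = 0"
    by (simp add: f_def g_def q_def hnorm_def)
  then have "0 \<le> f w1 - c * g w1" using w1(2) K0 by metis
  then have "w1 \<in> U" using c(2)[of w1] w1(1) by force
  then have near: "dist (x1, t1) (x0, t0) < r2" "dist y1 x0 < r2" "norm a < r2"
    by (auto simp: U_def w1_eq q_def a_def)
  have nin1: "x1 \<notin> Om t1" using w1(1) by (simp add: w1_eq inK)
  have t1: "0 < t1" "t1 < T" using timeT[of x1 t1] near(1) r2 by auto
  have y1: "rtrans B a x1 = y1" unfolding a_def by (rule rtrans_gquot[OF B])
  have MX: "P (y, t) - c * hnorm (gquot B y x) \<le> P (y1, t1) - c * hnorm a"
    if "dist (x, t) (x0, t0) \<le> d" "x \<notin> Om t" "dist y x0 \<le> d" for x t y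
    using w1(2)[rule_format, of "((x, t), y)"] that by (simp add: inK f_def g_def q_def w1_eq a_def)
  \<comment> \<open>Two coordinate displacements of \<open>d / 4\<close> together with
    \<open>r2 \<le> d / 2\<close> stay within distance \<open>d\<close> of
    \<open>(x0, t0)\<close>.\<close>
  define e where "e = d / 4"
  have e: "0 < e" using d by (simp add: e_def)
  have near1: "dist (x, t) (x0, t0) \<le> d" if "dist x x1 \<le> e" "\<bar>t - t1\<bar> \<le> e" for x t
  proof -
    have "dist (x, t) (x1, t1) \<le> dist x x1 + dist t t1"
      unfolding dist_Pair_Pair by (rule sqrt_sum_squares_le_sum) auto
    then have "dist (x, t) (x1, t1) \<le> d / 2" using that by (simp add: e_def dist_real_def)
    then show ?thesis using dist_triangle[of "(x, t)" "(x0, t0)" "(x1, t1)"] near(1) r2 by linarith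
  qed
  have nearY: "dist y x0 \<le> d" if "dist y y1 < e" for y
    using dist_triangle[of y x0 y1] near(2) r2 that d by (simp add: e_def)
  have mx1: "P (y, t1) - c * hnorm (gquot B y x1) \<le> P (y1, t1) - c * hnorm a" if "dist y y1 < e" for y
    using MX[of x1 t1 y] near1[of x1 t1] e nin1 nearY[OF that] by simp
  show False
  proof (cases "hor a = 0")
    case True
    have h: "hor x1 = hor y1" using True by (simp add: a_def gquot_def)
    note hm = horizontal_max[OF B C e h mx1[unfolded a_def]]
    have nonneg: "0 \<le> usc_env (Gu B F) (GDom B) (y1, t1, grad P (y1, t1), hess P (y1, t1))"
      by (rule Gu_usc_nonneg[OF F2 F3 t1(1) hess_symm[OF C]]) (use hm in auto)
    have "dist (y1, t1) (x0, t0) \<le> dist y1 x0 + dist t1 t0"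
      unfolding dist_Pair_Pair by (rule sqrt_sum_squares_le_sum) auto
    then have "dist (y1, t1) (x0, t0) < r"
      using near(2) dist_snd_le[of "(x1, t1)" "(x0, t0)"] near(1) r2 by simp
    \<comment> \<open>The trivial translation turns \<open>negr\<close> into the inequality for
      \<open>P\<close> itself at \<open>(y1, t1)\<close>.\<close>
    moreover have "(\<lambda>(x, t). P (rtrans B 0 x, t)) = P"
      by (simp add: fun_eq_iff rtrans_def bil_simps linear_simps(3)[OF bounded_linear_pt_0])
    ultimately have "ereal (dtime P (y1, t1)) + usc_env (Gu B F) (GDom B) (y1, t1, grad P (y1, t1), hess P (y1, t1)) < 0"
      using negr[of 0 y1 t1] r by simp
    then have dt: "dtime P (y1, t1) < 0" using nonneg
      by (cases "usc_env (Gu B F) (GDom B) (y1, t1, grad P (y1, t1), hess P (y1, t1))") auto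
    show False
    proof (rule vertical_contact_test[OF B F1 F3 flow op sm t1 nin1 e c(1) h _ dt])
      show "P (y1, t) - c * hnorm (gquot B y1 x) \<le> P (y1, t1) - c * hnorm (gquot B y1 x1)"
        if "dist x x1 \<le> e" "\<bar>t - t1\<bar> \<le> e" "x \<notin> Om t" for x t
        using MX[OF near1[OF that(1,2)] that(3), of y1] near(2) r2 d by (simp add: a_def)
    qed
  next
    case False
    define \<psi> where "\<psi> = (\<lambda>(x, t). P (rtrans B a x, t))"
    have C\<psi>: "Ck k \<psi>" for k unfolding \<psi>_def by (rule rtrans_jets(1)[OF C C])
    \<comment> \<open>The quartic makes the contact strict and leaves the jets at
      \<open>(x1, t1)\<close> unchanged.\<close>
    define \<Psi> where "\<Psi> z = \<psi> z - quartic (x1, t1) z" for z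
    have C\<Psi>: "Ck k \<Psi>" for k unfolding \<Psi>_def by (intro Ck_diff C\<psi> Ck_quartic)
    note jets = jets_diff_quartic[OF C\<psi>, of "(x1, t1)", folded \<Psi>_def]
    have "frechet_derivative \<psi> (at (x1, t1)) (sigma B x1 *v hor a, 0) = - 4 * c * (hor a \<bullet> hor a)\<^sup>2"
      unfolding \<psi>_def by (rule frechet_rtrans_line[OF B C e]) (use mx1 y1 in auto)
    then have "grad \<Psi> (x1, t1) v* sigma B x1 \<noteq> 0"
      using False c(1) unfolding Xdir[OF C\<psi>] jets by auto
    moreover have "continuous_on UNIV (\<lambda>z. norm (grad \<Psi> z v* sigma B (fst z)))"
    proof -
      have "continuous_on UNIV (\<lambda>z :: (real^('m + 'k)) \<times> real. sigma B (fst z))"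
        by (rule continuous_on_compose2[OF sigma_continuous]) (auto intro: continuous_intros)
      then show ?thesis unfolding vector_matrix_mult_def
        by (intro continuous_on_norm continuous_on_vec_lambda continuous_on_sum continuous_on_mult
            continuous_on_component continuous_jets C\<Psi>; assumption)
    qed
    \<comment> \<open>The horizontal gradient is nonzero throughout this neighbourhood, so (c) is
      vacuous there.\<close>
    ultimately obtain R1 where R1: "0 < R1" "\<And>z. dist z (x1, t1) < R1 \<Longrightarrow> 0 < norm (grad \<Psi> z v* sigma B (fst z))"
      using continuous_near_greater[of "\<lambda>z. norm (grad \<Psi> z v* sigma B (fst z))" 0 "(x1, t1)"] by auto
    have "continuous_on UNIV (\<lambda>x. rtrans B a x)" by (intro continuous_rtrans continuous_intros)
    then obtain R2 where R2: "0 < R2" "\<And>x. dist x x1 < R2 \<Longrightarrow> dist (rtrans B a x) y1 < e"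
      using e y1 unfolding continuous_on_iff by (metis UNIV_I)
    define R where "R = min e (min (R1 / 3) (R2 / 2))"
    have R: "0 < R" "R \<le> e" "R < R2" "R \<le> R1 / 3" using e R1(1) R2(1) by (auto simp: R_def)
    have eqP: "\<Psi> (x1, t1) = P (y1, t1)" by (simp add: \<Psi>_def \<psi>_def y1)
    show False
    proof (rule flow_local_test_regular[OF flow op _ t1 nin1 R(1)])
      show "smooth_fun \<Psi>" using C\<Psi> by (simp add: smooth_fun_def)
      show "\<Psi> (x, t) < \<Psi> (x1, t1)" if "dist x x1 \<le> R" "\<bar>t - t1\<bar> \<le> R" "x \<notin> Om t" "(x, t) \<noteq> (x1, t1)" for x t
      proof -
        have "P (rtrans B a x, t) - c * hnorm (gquot B (rtrans B a x) x) \<le> P (y1, t1) - c * hnorm a"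
          by (rule MX) (use that R near1[of x t] R2(2)[of x] nearY in auto)
        then have "\<psi> (x, t) \<le> P (y1, t1)" by (simp add: \<psi>_def gquot_rtrans[OF B])
        then show ?thesis using quartic_simps(2)[OF that(4)] unfolding eqP by (simp add: \<Psi>_def)
      qed
      show "ereal (dtime \<Psi> (x1, t1)) + usc_env (Gu B F) (GDom B) (x1, t1, grad \<Psi> (x1, t1), hess \<Psi> (x1, t1)) < 0"
        unfolding jets unfolding \<psi>_def using near(1,3) r2 by (intro negr) auto
      show "grad \<Psi> (x1, t1) \<noteq> 0" using R1(2)[of "(x1, t1)"] R1(1) by auto
      show "transpose (sigma B x) ** hess \<Psi> (x, t) ** sigma B x = 0"
        if "dist x x1 \<le> R" "\<bar>t - t1\<bar> \<le> R" "grad \<Psi> (x, t) v* sigma B x = 0" for x t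
      proof -
        have "dist (x, t) (x1, t1) \<le> dist x x1 + dist t t1"
          unfolding dist_Pair_Pair by (rule sqrt_sum_squares_le_sum) auto
        then have "dist (x, t) (x1, t1) < R1" using that(1,2) R(4) R1(1) by (simp add: dist_real_def)
        then show ?thesis using R1(2)[of "(x, t)"] that(3) by simp
      qed
    qed
  qed
qed

text \<open>Openness gives lower semicontinuity. At a contact inside the open set the test function
  has a local maximum and \<open>Gu_usc_nonneg\<close> suffices; at a contact in the complement a
  violated inequality is passed to a smooth strict minorant, for which doubling yields a
  contradiction.\<close>

lemma visc_super_if_superflow:
  fixes B :: "'k::finite \<Rightarrow> real^'m::finite^'m"
  assumes B: "carnot_data B" and F1: "F1 F" and F2: "F2 F" and F3: "F3 F"
    and op: "open (spacetime_set T Om)" and flow: "gen_superflow B F T Om"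
  shows "visc_super B F (UNIV \<times> {0<..<T}) (\<lambda>z. if z \<in> spacetime_set T Om then 1 else -1)"
proof -
  let ?u = "\<lambda>z. if z \<in> spacetime_set T Om then 1 else -1 :: real"
  let ?S = "UNIV \<times> {0<..<T} :: ((real^('m + 'k)) \<times> real) set"
  have "lsc_on ?u ?S"
    unfolding lsc_on_def
  proof (intro ballI allI impI)
    fix z e :: "_" assume z: "z \<in> ?S" and e: "(0::real) < e"
    show "\<exists>d>0. \<forall>w\<in>?S \<inter> ball z d. ?u z - e < ?u w"
    proof (cases "z \<in> spacetime_set T Om")
      case True
      then obtain d where "0 < d" "ball z d \<subseteq> spacetime_set T Om" using op open_contains_ball by blast
      then show ?thesis using e True by (intro exI[of _ d]) auto
    next
      case False
      then show ?thesis using e by (intro exI[of _ 1]) auto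
    qed
  qed
  moreover have "0 \<le> ereal (dtime \<phi> z) + usc_env (Gu B F) (GDom B) (fst z, snd z, grad \<phi> z, hess \<phi> z)"
    if C: "Ck 2 \<phi>" and z: "z \<in> ?S" and loc: "\<exists>d>0. \<forall>w\<in>?S \<inter> ball z d. ?u z - \<phi> z \<le> ?u w - \<phi> w" for \<phi> z
  proof (rule ccontr)
    obtain x0 t0 where z_eq: "z = (x0, t0)" by force
    have t0: "0 < t0" "t0 < T" using z by (auto simp: z_eq)
    obtain d where d0: "0 < d" "\<forall>w\<in>?S \<inter> ball z d. ?u z - \<phi> z \<le> ?u w - \<phi> w"
      using loc by blast
    have d: "0 < d" "\<And>w. w \<in> ?S \<Longrightarrow> dist w z < d \<Longrightarrow> ?u z - \<phi> z \<le> ?u w - \<phi> w"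
      using d0(1) bspec[OF d0(2)] by (simp_all only: Int_iff mem_ball dist_commute simp_thms)
    assume "\<not> ?thesis"
    then have neg: "ereal (dtime \<phi> z) + usc_env (Gu B F) (GDom B) (x0, t0, grad \<phi> z, hess \<phi> z) < 0"
      by (simp add: z_eq)
    show False
    proof (cases "z \<in> spacetime_set T Om")
      case True
      then obtain d' where d': "0 < d'" "ball z d' \<subseteq> spacetime_set T Om" using op open_contains_ball by blast
      \<comment> \<open>The characteristic function is constant near \<open>z\<close>, so the
        minimum of the difference is a maximum of \<open>\<phi>\<close>.\<close>
      have mx: "\<phi> w \<le> \<phi> z" if "dist w z < min d d'" for w
      proof -
        have "w \<in> spacetime_set T Om" using d'(2) that by (auto simp: dist_commute)
        then show ?thesis using d(2)[of w] that True by (cases w) auto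
      qed
      have line: "frechet_derivative \<phi> (at z) v = 0 \<and> D2 \<phi> z v v \<le> 0" for v
      proof -
        define e where "e = min d d' / (norm v + 1)"
        have n: "0 < norm v + 1" by (simp add: add_nonneg_pos)
        have e: "0 < e" using d(1) d'(1) n by (simp add: e_def)
        have le: "\<phi> (z + s *\<^sub>R v) \<le> \<phi> z + 0 * s ^ 4" if s: "\<bar>s\<bar> < e" for s
        proof -
          have "\<bar>s\<bar> * norm v \<le> \<bar>s\<bar> * (norm v + 1)" by (intro mult_left_mono) auto
          also have "\<dots> < e * (norm v + 1)" using s n by (intro mult_strict_right_mono) auto
          also have "\<dots> = min d d'" using n by (simp add: e_def)
          finally show ?thesis using mx[of "z + s *\<^sub>R v"] by (simp add: dist_norm)
        qed
        show ?thesis using Ck2_max_line[OF C e le] by simp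
      qed
      have g0: "grad \<phi> z = 0" and dt0: "dtime \<phi> z = 0"
        using line by (simp_all add: grad_def dtime_def vec_eq_iff)
      have "0 \<le> usc_env (Gu B F) (GDom B) (x0, t0, grad \<phi> z, hess \<phi> z)"
        by (rule Gu_usc_nonneg[OF F2 F3 t0(1) hess_symm[OF C]])
          (use line in \<open>auto simp: g0 D2_hess[OF C, symmetric]\<close>)
      then show False using neg by (simp add: dt0)
    next
      case False
      obtain \<rho> where \<rho>: "0 < \<rho>" "\<And>\<tau> w. \<bar>\<tau> - dtime \<phi> z\<bar> < \<rho> \<Longrightarrow> dist w (x0, t0, grad \<phi> z, hess \<phi> z) < \<rho>
          \<Longrightarrow> ereal \<tau> + usc_env (Gu B F) (GDom B) w < 0"
        using usc_env_less_imp[OF neg] by blast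
      let ?I = "mat 1 :: real^('m + 'k)^('m + 'k)"
      \<comment> \<open>The minorant changes the Hessian by \<open>\<kappa>\<close> times the
        identity; this choice keeps that change below \<open>\<rho>\<close>.\<close>
      define \<kappa> where "\<kappa> = \<rho> / (norm ?I + 1)"
      have n: "0 < norm ?I + 1" by (simp add: add_nonneg_pos)
      have \<kappa>: "0 < \<kappa>" using \<rho>(1) n by (simp add: \<kappa>_def)
      obtain P d1 where P: "smooth_fun P" "P z = \<phi> z"
        "\<And>v. frechet_derivative P (at z) v = frechet_derivative \<phi> (at z) v"
        "\<And>u v. D2 P z u v = D2 \<phi> z u v - \<kappa> * (u \<bullet> v)"
        and d1: "0 < d1" "\<And>w. w \<noteq> z \<Longrightarrow> dist w z < d1 \<Longrightarrow> P w < \<phi> w"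
        using Ck2_quadratic_minorant[OF C \<kappa>, of z] by blast
      have jets: "dtime P z = dtime \<phi> z" "grad P z = grad \<phi> z" by (simp_all add: dtime_def grad_def P(3))
      have "hess P z = hess \<phi> z - \<kappa> *\<^sub>R ?I"
        unfolding hess_D2 P(4) by (simp add: vec_eq_iff mat_def inner_axis_axis)
      then have "dist (hess P z) (hess \<phi> z) = \<kappa> * norm ?I" using \<kappa> by (simp add: dist_norm)
      also have "\<dots> < \<kappa> * (norm ?I + 1)" using \<kappa> by simp
      also have "\<dots> = \<rho>" using n by (simp add: \<kappa>_def)
      finally have "dist (x0, t0, grad P z, hess P z) (x0, t0, grad \<phi> z, hess \<phi> z) < \<rho>"
        by (simp add: jets dist_Pair_Pair)
      then have negP: "ereal (dtime P z) + usc_env (Gu B F) (GDom B) (x0, t0, grad P z, hess P z) < 0"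
        using \<rho> by (simp add: jets)
      define R where "R = min (min d d1) (min t0 (T - t0)) / 2"
      have R: "0 < R" "R < d" "R < d1" "R < t0" "R < T - t0" using d d1 t0 by (auto simp: R_def min_def)
      show False
      proof (rule doubling_contradiction[OF B F1 F2 F3 flow op P(1) _ R(1,4,5)])
        show "x0 \<notin> Om t0" using False t0 by (simp add: z_eq)
        show "ereal (dtime P (x0, t0)) + usc_env (Gu B F) (GDom B) (x0, t0, grad P (x0, t0), hess P (x0, t0)) < 0"
          using negP by (simp add: z_eq)
        fix x t assume xt: "dist (x, t) (x0, t0) \<le> R" "x \<notin> Om t" "(x, t) \<noteq> (x0, t0)"
        have "\<bar>t - t0\<bar> \<le> R" using xt(1) dist_snd_le[of "(x, t)" "(x0, t0)"] by (simp add: dist_real_def)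
        then have "(x, t) \<in> ?S" using R by auto
        then have "?u z - \<phi> z \<le> ?u (x, t) - \<phi> (x, t)" using xt(1) R by (intro d(2)) (auto simp: z_eq)
        then have "\<phi> (x, t) \<le> \<phi> z" using False xt(2) by auto
        moreover have "P (x, t) < \<phi> (x, t)" using xt R by (intro d1(2)) (auto simp: z_eq)
        ultimately show "P (x, t) < P (x0, t0)" using P(2) by (simp add: z_eq)
      qed
    qed
  qed
  ultimately show ?thesis unfolding visc_super_def by blast
qed

section \<open>Duality between subflows and superflows\<close>

text \<open>The operator satisfied by \<open>- u\<close> when \<open>u\<close> satisfies the one for
  \<open>F\<close>; passing to it exchanges upper and lower envelopes.\<close>

definition dual_F :: "(real^'n \<Rightarrow> real \<Rightarrow> real^'m \<Rightarrow> real^'m^'m \<Rightarrow> real) \<Rightarrow> real^'n \<Rightarrow> real \<Rightarrow> real^'m \<Rightarrow> real^'m^'m \<Rightarrow> real" where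
  "dual_F F x t p A = - F x t (- p) (- A)"

lemma symm_uminus [simp]: "symm (- A) \<longleftrightarrow> symm A"
  by (simp add: symm_def transpose_def vec_eq_iff)

lemma vector_matrix_uminus: "(- p) v* S = - (p v* (S :: real^'m::finite^'n::finite))"
  by (simp add: vector_matrix_mult_def vec_eq_iff sum_negf)

lemma matrix_sandwich_uminus: "(S :: real^'n::finite^'m::finite) ** (- A) ** (R :: real^'m^'n) = - (S ** A ** R)"
  by (simp add: matrix_matrix_mult_def vec_eq_iff sum_negf)

lemma Gu_usc_dual:
  fixes B :: "'k::finite \<Rightarrow> real^'m::finite^'m"
    and F :: "real^('m + 'k) \<Rightarrow> real \<Rightarrow> real^'m \<Rightarrow> real^'m^'m \<Rightarrow> real"
  shows "usc_env (Gu B (dual_F F)) (GDom B) (x, t, p, A) = - lsc_env (Gu B F) (GDom B) (x, t, - p, - A)"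
proof -
  define i where "i = (\<lambda>(x :: real^('m + 'k), t :: real, p :: real^('m + 'k), A :: real^('m + 'k)^('m + 'k)). (x, t, - p, - A))"
  have i_eq: "i (x, t, p, A) = (x, t, - p, - A)" for x t p A by (simp add: i_def)
  have i: "i (i w) = w" "dist (i w) (i v) = dist w v" "w \<in> GDom B \<Longrightarrow> i w \<in> GDom B"
    "Gu B (dual_F F) w = - Gu B F (i w)" for w v
    by (cases w, cases v, simp add: i_eq dist_Pair_Pair dist_minus GDom_def Gu_def dual_F_def
        vector_matrix_uminus matrix_sandwich_uminus)+
  show ?thesis
    using usc_env_uminus[where \<iota> = i and D = "GDom B" and g = "Gu B (dual_F F)" and f = "Gu B F" and z = "(x, t, p, A)", OF i]
    unfolding i_eq .
qed

lemma F1_dual: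
  fixes F :: "real^'n::finite \<Rightarrow> real \<Rightarrow> real^'m::finite \<Rightarrow> real^'m^'m \<Rightarrow> real"
  assumes "F1 F" shows "F1 (dual_F F)"
proof -
  define i where "i = (\<lambda>(x :: real^'n, t :: real, p :: real^'m, A :: real^'m^'m). (x, t, - p, - A))"
  have i_eq: "i (x, t, p, A) = (x, t, - p, - A)" for x t p A by (simp add: i_def)
  have i: "i (i w) = w" "dist (i w) (i v) = dist w v" "w \<in> FDom \<Longrightarrow> i w \<in> FDom"
    "Fu (dual_F F) w = - Fu F (i w)" for w v
    by (cases w, cases v, simp add: i_eq dist_Pair_Pair dist_minus FDom_def Fu_def dual_F_def)+
  have "i (x, t, 0, 0) = (x, t, 0, 0)" for x t by (simp add: i_def)
  then have "usc_env (Fu (dual_F F)) FDom (x, t, 0, 0) = - lsc_env (Fu F) FDom (x, t, 0, 0)"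
    and "lsc_env (Fu (dual_F F)) FDom (x, t, 0, 0) = - usc_env (Fu F) FDom (x, t, 0, 0)" for x t
    using usc_env_uminus[where \<iota> = i and D = FDom and g = "Fu (dual_F F)" and f = "Fu F" and z = "(x, t, 0, 0)", OF i]
      lsc_env_uminus[where \<iota> = i and D = FDom and g = "Fu (dual_F F)" and f = "Fu F" and z = "(x, t, 0, 0)", OF i]
    by simp_all
  then show ?thesis using assms by (simp add: F1_def)
qed

lemma F2_dual:
  fixes F :: "real^'n::finite \<Rightarrow> real \<Rightarrow> real^'m::finite \<Rightarrow> real^'m^'m \<Rightarrow> real"
  assumes "F2 F" shows "F2 (dual_F F)"
  unfolding F2_def dual_F_def
proof (intro allI impI)
  fix x :: "real^'n" and t and p :: "real^'m" and A C :: "real^'m^'m"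
  assume *: "(0::real) < t" "p \<noteq> 0" "symm A" "symm C" "psd (A - C)"
  have "psd (- C - - A)" using *(5) by simp
  then have "F x t (- p) (- C) \<le> F x t (- p) (- A)"
    using assms * by (simp add: F2_def)
  then show "- F x t (- p) (- A) \<le> - F x t (- p) (- C)" by simp
qed

lemma F3_dual:
  fixes F :: "real^'n::finite \<Rightarrow> real \<Rightarrow> real^'m::finite \<Rightarrow> real^'m^'m \<Rightarrow> real"
  assumes "F3 F" shows "F3 (dual_F F)"
  unfolding F3_def dual_F_def
proof (intro allI impI)
  fix x :: "real^'n" and t and p :: "real^'m" and A :: "real^'m^'m" and l \<mu> :: real
  assume *: "(0::real) < t" "p \<noteq> 0" "symm A" "0 < l"
  have "outer (- p) (- p) = outer p p" by (simp add: outer_def)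
  \<comment> \<open>\<open>outer\<close> is even in the gradient, so (F3) for \<open>F\<close> has
    to be applied with \<open>- \<mu>\<close>.\<close>
  then have 1: "- (l *\<^sub>R A + \<mu> *\<^sub>R outer p p) = l *\<^sub>R (- A) + (- \<mu>) *\<^sub>R outer (- p) (- p)" by simp
  have 2: "- (l *\<^sub>R p) = l *\<^sub>R (- p)" by simp
  have "F x t (l *\<^sub>R (- p)) (l *\<^sub>R (- A) + (- \<mu>) *\<^sub>R outer (- p) (- p)) = l * F x t (- p) (- A)"
    by (rule assms[unfolded F3_def, rule_format]) (use * in simp_all)
  then show "- F x t (- (l *\<^sub>R p)) (- (l *\<^sub>R A + \<mu> *\<^sub>R outer p p)) = l * - F x t (- p) (- A)"
    unfolding 1 2 by simp
qed

section \<open>Test functions and inequalities under change of sign\<close>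

lemma jets_minus:
  assumes "Ck 2 \<phi>"
  shows "dtime (\<lambda>z. - \<phi> z) z = - dtime \<phi> z" "grad (\<lambda>z. - \<phi> z) z = - grad \<phi> z" "hess (\<lambda>z. - \<phi> z) z = - hess \<phi> z"
  by (simp_all add: dtime_def grad_def hess_D2 D1_minus[OF assms] D2_minus[OF assms] vec_eq_iff)

lemma ereal_uminus_add_less_0: "ereal (- a) + - b < 0 \<longleftrightarrow> 0 < ereal a + b"
proof -
  have "ereal (- a) + - b = - (ereal a + b)" by (cases b) simp_all
  then show ?thesis by (simp only: ereal_uminus_less_reorder ereal_uminus_zero)
qed

lemma ereal_uminus_add_ge_0: "0 \<le> ereal (- a) + - b \<longleftrightarrow> ereal a + b \<le> 0"
proof -
  have "ereal (- a) + - b = - (ereal a + b)" by (cases b) simp_all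
  then show ?thesis by (simp only: ereal_0_le_uminus_iff)
qed

lemma Gu_usc_dual_minus:
  assumes "Ck 2 \<phi>"
  shows "ereal (dtime (\<lambda>z. - \<phi> z) z) + usc_env (Gu B (dual_F F)) (GDom B) (x, t, grad (\<lambda>z. - \<phi> z) z, hess (\<lambda>z. - \<phi> z) z) =
    ereal (- dtime \<phi> z) + - lsc_env (Gu B F) (GDom B) (x, t, grad \<phi> z, hess \<phi> z)"
  by (simp add: jets_minus[OF assms] Gu_usc_dual)

lemma Ck_uminus: "Ck k (\<lambda>z. - \<phi> z) \<longleftrightarrow> Ck k \<phi>"
  using Ck_minus[of k \<phi>] Ck_minus[of k "\<lambda>z. - \<phi> z"] by auto

lemma smooth_fun_uminus: "smooth_fun (\<lambda>z. - \<phi> z) \<longleftrightarrow> smooth_fun \<phi>"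
  by (simp add: smooth_fun_def Ck_uminus)

lemma admissible_test_uminus:
  assumes "Ck 2 \<phi>"
  shows "admissible_test B (\<lambda>z. - \<phi> z) x0 r t h \<longleftrightarrow> admissible_test B \<phi> x0 r t h"
  unfolding admissible_test_def jets_minus[OF assms] vector_matrix_uminus matrix_sandwich_uminus neg_equal_0_iff_equal ..

text \<open>Negation is a bijection of the test functions, so a quantifier over them can be
  reindexed to match the dual inequalities.\<close>

lemma all_uminus: "(\<forall>\<phi> :: 'a \<Rightarrow> real. Q \<phi>) \<longleftrightarrow> (\<forall>\<phi>. Q (\<lambda>z. - \<phi> z))"
proof (intro iffI allI)
  fix \<phi> assume "\<forall>\<phi>. Q (\<lambda>z. - \<phi> z)"
  from spec[OF this, of "\<lambda>z. - \<phi> z"] show "Q \<phi>" by simp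
qed blast

lemma gen_subflow_dual:
  "gen_subflow B F T Fm \<longleftrightarrow> gen_superflow B (dual_F F) T (\<lambda>t. - Fm t)"
proof -
  have *: "(smooth_fun (\<lambda>z. - \<phi> z) \<longrightarrow>
        (\<forall>x\<in>cball x0 r. \<forall>s\<in>{t..t+h}.
           ereal (dtime (\<lambda>z. - \<phi> z) (x,s)) + usc_env (Gu B (dual_F F)) (GDom B) (x, s, grad (\<lambda>z. - \<phi> z) (x,s), hess (\<lambda>z. - \<phi> z) (x,s)) < 0) \<longrightarrow>
        admissible_test B (\<lambda>z. - \<phi> z) x0 r t h \<longrightarrow> R) \<longleftrightarrow>
     (smooth_fun \<phi> \<longrightarrow>
        (\<forall>x\<in>cball x0 r. \<forall>s\<in>{t..t+h}.
           0 < ereal (dtime \<phi> (x,s)) + lsc_env (Gu B F) (GDom B) (x, s, grad \<phi> (x,s), hess \<phi> (x,s))) \<longrightarrow>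
        admissible_test B \<phi> x0 r t h \<longrightarrow> R)" for \<phi> x0 r t h R
  proof (cases "smooth_fun \<phi>")
    case True
    then have C: "Ck 2 \<phi>" by (rule smooth_fun_imp_Ck)
    show ?thesis
      by (simp only: smooth_fun_uminus Gu_usc_dual_minus[OF C] ereal_uminus_add_less_0 admissible_test_uminus[OF C])
  qed (simp add: smooth_fun_uminus)
  show ?thesis
    unfolding gen_subflow_def gen_superflow_def
    by (subst (2) all_uminus, unfold *) (simp only: neg_0_le_iff_le neg_0_less_iff_less)
qed

lemma visc_sub_dual: "visc_sub B F S u \<longleftrightarrow> visc_super B (dual_F F) S (\<lambda>z. - u z)"
proof -
  have 1: "usc_on u S \<longleftrightarrow> lsc_on (\<lambda>z. - u z) S"
  proof -
    have "u w < u z + e \<longleftrightarrow> - u z - e < - u w" for w z e by linarith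
    then show ?thesis by (simp add: usc_on_def lsc_on_def)
  qed
  have *: "(Ck 2 (\<lambda>z. - \<phi> z) \<longrightarrow> R1 \<longrightarrow> R2 \<longrightarrow>
      0 \<le> ereal (dtime (\<lambda>z. - \<phi> z) z) + usc_env (Gu B (dual_F F)) (GDom B) (fst z, snd z, grad (\<lambda>z. - \<phi> z) z, hess (\<lambda>z. - \<phi> z) z))
    \<longleftrightarrow> (Ck 2 \<phi> \<longrightarrow> R1 \<longrightarrow> R2 \<longrightarrow>
      ereal (dtime \<phi> z) + lsc_env (Gu B F) (GDom B) (fst z, snd z, grad \<phi> z, hess \<phi> z) \<le> 0)" for \<phi> z R1 R2
  proof (cases "Ck 2 \<phi>")
    case True
    show ?thesis by (simp only: Ck_uminus Gu_usc_dual_minus[OF True] ereal_uminus_add_ge_0)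
  qed (simp add: Ck_uminus)
  have le: "- u z - - \<phi> z \<le> - u w - - \<phi> w \<longleftrightarrow> u w - \<phi> w \<le> u z - \<phi> z" for z w \<phi> by linarith
  show ?thesis
    unfolding visc_sub_def visc_super_def 1
    by (subst (2) all_uminus, unfold *) (simp only: le)
qed

text \<open>The duality needs this because the negated characteristic function and that of the
  complementary family agree only for times strictly between 0 and \<open>T\<close>.\<close>

lemma visc_super_cong:
  assumes "\<And>z. z \<in> S \<Longrightarrow> u z = v z"
  shows "visc_super B F S u \<longleftrightarrow> visc_super B F S v"
proof -
  have "lsc_on u S \<longleftrightarrow> lsc_on v S" unfolding lsc_on_def using assms by auto
  then show ?thesis unfolding visc_super_def using assms by auto
qed

lemma superflow_iff_visc_super:
  fixes B :: "'k::finite \<Rightarrow> real^'m::finite^'m"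
  assumes "carnot_data B" "F1 F" "F2 F" "F3 F" "open (spacetime_set T Om)"
  shows "gen_superflow B F T Om \<longleftrightarrow>
    visc_super B F (UNIV \<times> {0<..<T}) (\<lambda>z. if z \<in> spacetime_set T Om then 1 else -1)"
  using superflow_if_visc_super visc_super_if_superflow assms by blast

theorem theorem5p3:
  fixes B :: "'k::finite \<Rightarrow> real^'m::finite^'m"
    and F :: "real^('m+'k) \<Rightarrow> real \<Rightarrow> real^'m \<Rightarrow> real^'m^'m \<Rightarrow> real"
    and T :: real
  assumes "2 \<le> CARD('m)"
    and "carnot_data B"
    and "standing_F F" and "F1 F" and "F2 F" and "F3 F"
    and "0 < T"
  shows "(\<forall>Om :: real \<Rightarrow> (real^('m+'k)) set.
            (\<forall>t\<in>{0<..<T}. open (Om t)) \<longrightarrow>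
            openin (top_of_set (UNIV \<times> {0..T})) {(x,t). t \<in> {0<..<T} \<and> x \<in> Om t} \<longrightarrow>
            (gen_superflow B F T Om \<longleftrightarrow>
             visc_super B F (UNIV \<times> {0<..<T})
               (\<lambda>z. if z \<in> {(x,t). t \<in> {0<..<T} \<and> x \<in> Om t} then 1 else -1)))
       \<and> (\<forall>Fm :: real \<Rightarrow> (real^('m+'k)) set.
            (\<forall>t\<in>{0<..<T}. closed (Fm t)) \<longrightarrow>
            closedin (top_of_set (UNIV \<times> {0..T})) {(x,t). t \<in> {0<..<T} \<and> x \<in> Fm t} \<longrightarrow>
            (gen_subflow B F T Fm \<longleftrightarrow>
             visc_sub B F (UNIV \<times> {0<..<T})
               (\<lambda>z. if z \<in> {(x,t). t \<in> {0<..<T} \<and> x \<in> Fm t} then 1 else -1)))"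
proof (intro conjI allI impI)
  have strip: "open (UNIV \<times> {0<..<T} :: ((real^('m+'k)) \<times> real) set)" by (intro open_Times) auto
  fix Om :: "real \<Rightarrow> (real^('m+'k)) set"
  assume "openin (top_of_set (UNIV \<times> {0..T})) (spacetime_set T Om)"
  then obtain U where U: "open U" "spacetime_set T Om = (UNIV \<times> {0..T}) \<inter> U"
    by (auto simp: openin_open)
  \<comment> \<open>The set contains no point at the times 0 and \<open>T\<close>, so relative
    openness in the closed strip becomes openness in the whole space.\<close>
  have "spacetime_set T Om = (UNIV \<times> {0<..<T}) \<inter> U" using U(2) by fastforce
  then have "open (spacetime_set T Om)" using U(1) strip by (simp add: open_Int)
  then show "gen_superflow B F T Om \<longleftrightarrow>
      visc_super B F (UNIV \<times> {0<..<T}) (\<lambda>z. if z \<in> spacetime_set T Om then 1 else -1)"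
    using assms by (intro superflow_iff_visc_super)
next
  have strip: "open (UNIV \<times> {0<..<T} :: ((real^('m+'k)) \<times> real) set)" by (intro open_Times) auto
  fix Fm :: "real \<Rightarrow> (real^('m+'k)) set"
  assume "closedin (top_of_set (UNIV \<times> {0..T})) (spacetime_set T Fm)"
  then obtain C where C: "closed C" "spacetime_set T Fm = (UNIV \<times> {0..T}) \<inter> C"
    by (auto simp: closedin_closed)
  \<comment> \<open>The complement is taken within the open strip, where removing a closed set
    leaves an open one.\<close>
  have "spacetime_set T (\<lambda>t. - Fm t) = (UNIV \<times> {0<..<T}) - spacetime_set T Fm" by auto
  also have "\<dots> = (UNIV \<times> {0<..<T}) - C" unfolding C(2) by auto
  finally have "open (spacetime_set T (\<lambda>t. - Fm t))" using C(1) strip by (simp add: open_Diff)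
  then have "gen_subflow B F T Fm \<longleftrightarrow> visc_super B (dual_F F) (UNIV \<times> {0<..<T})
      (\<lambda>z. if z \<in> spacetime_set T (\<lambda>t. - Fm t) then 1 else -1)"
    unfolding gen_subflow_dual using assms
    by (intro superflow_iff_visc_super F1_dual F2_dual F3_dual)
  also have "\<dots> \<longleftrightarrow> visc_super B (dual_F F) (UNIV \<times> {0<..<T})
      (\<lambda>z. - (if z \<in> spacetime_set T Fm then 1 else -1))"
    by (rule visc_super_cong) auto
  finally show "gen_subflow B F T Fm \<longleftrightarrow> visc_sub B F (UNIV \<times> {0<..<T})
      (\<lambda>z. if z \<in> spacetime_set T Fm then 1 else -1)"
    unfolding visc_sub_dual .
qed

end
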